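(* The sequence $\mathcal F:=\{\varphi(x,\lambda_{nk})T_{nk}\mathcal E_{nk}\}_{(n,k)\in J}$ of the vector eigenfunctions of $L$ is complete in $L_2((0,\pi);\mathbb C^m)$ and, moreover, is a Riesz basis in $L_2((0,\pi);\mathbb C^m)$.
   Context: Let $m\ge 1$; $\dagger$ denotes conjugate transpose and $I$ the unit $(m\times m)$-matrix. Let $\sigma\in L_2((0,\pi);\mathbb C^{m\times m})$ with $\sigma(x)=(\sigma(x))^\dagger$. Put $Y^{[1]}:=Y'-\sigma Y$ and $\ell Y:=-(Y^{[1]})'-\sigma Y^{[1]}-\sigma^2Y$. Let $T_j,H_j\in\mathbb C^{m\times m}$, $j=1,2$, satisfy $T_j=T_j^\dagger=T_j^2$, $T_j^\perp:=I-T_j$, $H_j=H_j^\dagger=T_jH_jT_j$. Denote $$V_1(Y):=T_1(Y^{[1]}(0)-H_1Y(0))-T_1^\perp Y(0),\quad V_2(Y):=T_2(Y^{[1]}(\pi)-H_2Y(\pi))-T_2^\perp Y(\pi),\quad V_1^\perp(Y):=T_1Y(0)+T_1^\perp Y^{[1]}(0).$$ $L$ is the boundary value problem $\ell Y=\lambda Y$ on $(0,\pi)$, $V_1(Y)=V_2(Y)=0$ (solutions have $Y,Y^{[1]}$ absolutely continuous on $[0,\pi]$). $\varphi(x,\lambda)$ is the matrix solution of $\ell\varphi=\lambda\varphi$ with $\varphi(0,\lambda)=T_1$, $\varphi^{[1]}(0,\lambda)=T_1^\perp+H_1$. Spectral data: let $p^\perp:=\dim(\operatorname{Ker}T_1\cap\operatorname{Ker}T_2)$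 and $J:=\{(n,k)\colon n\in\mathbb N,\ k=1,\dots,m\}\cup\{(0,k)\colon k=p^\perp+1,\dots,m\}$, ordered lexicographically, $\mathbb N=\{1,2,\dots\}$. The eigenvalues of $L$ are real and, counted with multiplicity (dimension of the space of eigenfunctions), are numbered as $\{\lambda_{nk}\}_{(n,k)\in J}$ in non-decreasing order; $\rho_{nk}:=\sqrt{\lambda_{nk}}$ with $\arg\rho_{nk}\in[-\pi/2,\pi/2)$. The Weyl solution $\Phi(x,\lambda)$ is the matrix solution of $\ell\Phi=\lambda\Phi$ with $V_1(\Phi)=I$, $V_2(\Phi)=0$; the Weyl matrix $M(\lambda):=V_1^\perp(\Phi)$ is meromorphic with simple poles at the eigenvalues of $L$; the weight matrices are $\alpha_{nk}:=\operatorname{Res}_{\lambda=\lambda_{nk}}M(\lambda)$, and $\operatorname{rank}(\alpha_{nk})$ equals the multiplicity of $\lambda_{nk}$. Put $T_{nk}:=T_1+\rho_{nk}T_1^\perp$ if $\rho_{nk}\ne0$, $T_{nk}:=I$ if $\rho_{nk}=0$, and $B_{nk}:=\frac\pi2T_{nk}^{-1}\alpha_{nk}T_{nk}^{-1}$. For every maximal group of equal eigenvalues $\lambda_{n_1k_1}=\dots=\lambda_{n_rk_r}$, the subspace $\operatorname{Ran}B_{n_1k_1}\subset\mathbb C^m$ is $r$-dimensional; $\{\mathcal E_{n_jk_j}\}_{j=1}^r$ is an arbitrarily chosen orthonormal basis of it. This defines $\{\mathcal E_{nk}\}_{(n,k)\in J}$. *)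

theory Defs
  imports "HOL-Complex_Analysis.Complex_Analysis" "HOL-Library.Function_Algebras"
begin

section \<open>Matrices and vectors over the complex numbers\<close>

definition dagger :: "complex^'m^'m \<Rightarrow> complex^'m^'m" where
  "dagger A = (\<chi> i j. cnj (A $ j $ i))"

definition cinner :: "complex^'m \<Rightarrow> complex^'m \<Rightarrow> complex" where
  "cinner v w = (\<Sum>i\<in>UNIV. v $ i * cnj (w $ i))"

definition orth_compl :: "complex^'m^'m \<Rightarrow> complex^'m^'m" where
  "orth_compl T = mat 1 - T"


section \<open>The space \<open>L\<^sub>2(0,\<pi>)\<close>\<close>

text \<open>Elements of \<open>L\<^sub>2\<close> are represented by functions; equality in \<open>L\<^sub>2\<close> is equality almost
  everywhere, and values outside \<open>(0,\<pi>)\<close> are irrelevant.\<close>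

abbreviation leb_pi :: "real measure" where
  "leb_pi \<equiv> lebesgue_on {0<..<pi}"

definition L2_fun :: "(real \<Rightarrow> 'v::euclidean_space) \<Rightarrow> bool" where
  "L2_fun f \<longleftrightarrow> f \<in> borel_measurable leb_pi \<and> integrable leb_pi (\<lambda>x. (norm (f x))\<^sup>2)"

definition L2_norm :: "(real \<Rightarrow> complex^'m) \<Rightarrow> real" where
  "L2_norm f = sqrt (LINT x|leb_pi. (norm (f x))\<^sup>2)"

definition L2_inner :: "(real \<Rightarrow> complex^'m) \<Rightarrow> (real \<Rightarrow> complex^'m) \<Rightarrow> complex" where
  "L2_inner f g = (LINT x|leb_pi. cinner (f x) (g x))"

definition L2_eq :: "(real \<Rightarrow> complex^'m) \<Rightarrow> (real \<Rightarrow> complex^'m) \<Rightarrow> bool" where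
  "L2_eq f g \<longleftrightarrow> (AE x in leb_pi. f x = g x)"

definition complete_in_L2 :: "'i set \<Rightarrow> ('i \<Rightarrow> real \<Rightarrow> complex^'m) \<Rightarrow> bool" where
  "complete_in_L2 J F \<longleftrightarrow> (\<forall>p\<in>J. L2_fun (F p)) \<and>
     (\<forall>f. L2_fun f \<longrightarrow> (\<forall>\<epsilon>>0. \<exists>S c. finite S \<and> S \<subseteq> J \<and>
        L2_norm (\<lambda>x. f x - (\<Sum>p\<in>S. c p *s F p x)) < \<epsilon>))"

definition orthonormal_basis_L2 :: "'i set \<Rightarrow> ('i \<Rightarrow> real \<Rightarrow> complex^'m) \<Rightarrow> bool" where
  "orthonormal_basis_L2 J e \<longleftrightarrow> complete_in_L2 J e \<and>
     (\<forall>p\<in>J. \<forall>q\<in>J. L2_inner (e p) (e q) = (if p = q then 1 else 0))"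

definition bounded_operator_L2 ::
    "((real \<Rightarrow> complex^'m) \<Rightarrow> (real \<Rightarrow> complex^'m)) \<Rightarrow> bool" where
  "bounded_operator_L2 A \<longleftrightarrow>
     (\<forall>f. L2_fun f \<longrightarrow> L2_fun (A f)) \<and>
     (\<forall>f g. L2_fun f \<longrightarrow> L2_fun g \<longrightarrow>
        L2_eq (A (\<lambda>x. f x + g x)) (\<lambda>x. A f x + A g x)) \<and>
     (\<forall>c f. L2_fun f \<longrightarrow> L2_eq (A (\<lambda>x. c *s f x)) (\<lambda>x. c *s A f x)) \<and>
     (\<exists>C. \<forall>f. L2_fun f \<longrightarrow> L2_norm (A f) \<le> C * L2_norm f)"

text \<open>A Riesz basis is the image of an orthonormal basis under a bounded linear operator
  with bounded inverse.  A bounded operator in the above sense maps functions that are equal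
  almost everywhere to functions that are equal almost everywhere, since it is linear and the
  norm of the image of a null function is \<open>0\<close>.\<close>

definition Riesz_basis_L2 :: "'i set \<Rightarrow> ('i \<Rightarrow> real \<Rightarrow> complex^'m) \<Rightarrow> bool" where
  "Riesz_basis_L2 J F \<longleftrightarrow> (\<forall>p\<in>J. L2_fun (F p)) \<and>
     (\<exists>e A B. orthonormal_basis_L2 J e \<and>
        bounded_operator_L2 A \<and> bounded_operator_L2 B \<and>
        (\<forall>f. L2_fun f \<longrightarrow> L2_eq (B (A f)) f \<and> L2_eq (A (B f)) f) \<and>
        (\<forall>p\<in>J. L2_eq (A (e p)) (F p)))"


section \<open>The differential equation\<close>

definition abs_cont_on :: "real set \<Rightarrow> (real \<Rightarrow> 'v::real_normed_vector) \<Rightarrow> bool" where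
  "abs_cont_on S f \<longleftrightarrow>
     (\<forall>\<epsilon>>0. \<exists>\<delta>>0. \<forall>D :: (real \<times> real) set.
        finite D \<and> (\<forall>(a,b)\<in>D. a \<le> b \<and> {a..b} \<subseteq> S) \<and>
        pairwise (\<lambda>(a,b) (c,d). {a<..<b} \<inter> {c<..<d} = {}) D \<and>
        (\<Sum>(a,b)\<in>D. b - a) < \<delta>
        \<longrightarrow> (\<Sum>(a,b)\<in>D. norm (f b - f a)) < \<epsilon>)"

text \<open>The equation is used both for vector functions and for matrix functions.  The parameter
  \<open>act\<close> is the corresponding product by a matrix from the left, i.e. \<open>(*v)\<close> or \<open>(**)\<close>.

  The quasi-derivative \<open>Y' - \<sigma> Y\<close> only exists almost everywhere, while its values at \<open>0\<close> and \<open>\<pi>\<close>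
  are needed.  Therefore it is carried along as a second function \<open>Y1\<close>, which for a
  solution is absolutely continuous and hence determined by \<open>Y\<close> on \<open>[0,\<pi>]\<close>.\<close>

definition quasi_derivative ::
    "(complex^'m^'m \<Rightarrow> 'v \<Rightarrow> 'v) \<Rightarrow> (real \<Rightarrow> complex^'m^'m) \<Rightarrow>
     (real \<Rightarrow> 'v::euclidean_space) \<Rightarrow> (real \<Rightarrow> 'v) \<Rightarrow> bool" where
  "quasi_derivative act \<sigma> Y Y1 \<longleftrightarrow>
     (AE x in leb_pi. \<exists>Y'. (Y has_vector_derivative Y') (at x) \<and> Y1 x = Y' - act (\<sigma> x) (Y x))"

definition solution ::
    "(complex^'m^'m \<Rightarrow> 'v \<Rightarrow> 'v) \<Rightarrow> (real \<Rightarrow> complex^'m^'m) \<Rightarrow> complex \<Rightarrow>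
     (real \<Rightarrow> 'v::euclidean_space) \<Rightarrow> (real \<Rightarrow> 'v) \<Rightarrow> bool" where
  "solution act \<sigma> \<mu> Y Y1 \<longleftrightarrow>
     abs_cont_on {0..pi} Y \<and> abs_cont_on {0..pi} Y1 \<and> quasi_derivative act \<sigma> Y Y1 \<and>
     (AE x in leb_pi. \<exists>Y1'. (Y1 has_vector_derivative Y1') (at x) \<and>
        - Y1' - act (\<sigma> x) (Y1 x) - act (\<sigma> x ** \<sigma> x) (Y x) = act (mat \<mu>) (Y x))"

text \<open>\<open>V\<^sub>j(Y)\<close> as a function of the values of \<open>Y\<close> and of its quasi-derivative at the endpoint:
  \<open>0\<close> for \<open>j = 1\<close> and \<open>\<pi>\<close> for \<open>j = 2\<close>.\<close>

definition boundary_form ::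
    "(complex^'m^'m \<Rightarrow> 'v \<Rightarrow> 'v) \<Rightarrow> complex^'m^'m \<Rightarrow> complex^'m^'m \<Rightarrow>
     'v::ab_group_add \<Rightarrow> 'v \<Rightarrow> 'v" where
  "boundary_form act T H y y1 = act T (y1 - act H y) - act (orth_compl T) y"

definition phi ::
    "(real \<Rightarrow> complex^'m^'m) \<Rightarrow> complex^'m^'m \<Rightarrow> complex^'m^'m \<Rightarrow>
     complex \<Rightarrow> real \<Rightarrow> complex^'m^'m" where
  "phi \<sigma> T1 H1 \<mu> = (SOME Y. \<exists>Y1. solution (**) \<sigma> \<mu> Y Y1 \<and>
     Y 0 = T1 \<and> Y1 0 = orth_compl T1 + H1)"


section \<open>Spectral data\<close>

definition fun_scale :: "complex \<Rightarrow> (real \<Rightarrow> complex^'m) \<Rightarrow> (real \<Rightarrow> complex^'m)" where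
  "fun_scale c Y = (\<lambda>x. c *s Y x)"

lemma vector_space_fun_scale: "vector_space fun_scale"
  by unfold_locales
    (auto simp: fun_scale_def fun_eq_iff vec.scale_right_distrib vec.scale_left_distrib)

text \<open>Functions on \<open>[0,\<pi>]\<close> are represented by their extension by \<open>0\<close>, so that the dimension is
  the correct one.\<close>

definition eigenspace ::
    "(real \<Rightarrow> complex^'m^'m) \<Rightarrow> complex^'m^'m \<Rightarrow> complex^'m^'m \<Rightarrow>
     complex^'m^'m \<Rightarrow> complex^'m^'m \<Rightarrow> complex \<Rightarrow> (real \<Rightarrow> complex^'m) set" where
  "eigenspace \<sigma> T1 T2 H1 H2 \<mu> =
     {Y. (\<forall>x. x \<notin> {0..pi} \<longrightarrow> Y x = 0) \<and>
         (\<exists>Y1. solution (*v) \<sigma> \<mu> Y Y1 \<and>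
            boundary_form (*v) T1 H1 (Y 0) (Y1 0) = 0 \<and>
            boundary_form (*v) T2 H2 (Y pi) (Y1 pi) = 0)}"

definition multiplicity_L ::
    "(real \<Rightarrow> complex^'m^'m) \<Rightarrow> complex^'m^'m \<Rightarrow> complex^'m^'m \<Rightarrow>
     complex^'m^'m \<Rightarrow> complex^'m^'m \<Rightarrow> complex \<Rightarrow> nat" where
  "multiplicity_L \<sigma> T1 T2 H1 H2 \<mu> = vector_space.dim fun_scale (eigenspace \<sigma> T1 T2 H1 H2 \<mu>)"

definition p_perp :: "complex^'m^'m \<Rightarrow> complex^'m^'m \<Rightarrow> nat" where
  "p_perp T1 T2 = vec.dim ({v. T1 *v v = 0} \<inter> {v. T2 *v v = 0})"

definition index_set :: "complex^'m^'m \<Rightarrow> complex^'m^'m \<Rightarrow> (nat \<times> nat) set" where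
  "index_set T1 T2 = {(n,k). 1 \<le> n \<and> 1 \<le> k \<and> k \<le> CARD('m)} \<union>
     {(0,k) |k. p_perp T1 T2 + 1 \<le> k \<and> k \<le> CARD('m)}"

text \<open>The eigenvalues are real, so the numbering takes real values.  The second condition says
  that each complex number occurs in the numbering as often as its multiplicity as an eigenvalue
  (not at all, if it is not an eigenvalue).\<close>

definition eigenvalue_numbering ::
    "(real \<Rightarrow> complex^'m^'m) \<Rightarrow> complex^'m^'m \<Rightarrow> complex^'m^'m \<Rightarrow>
     complex^'m^'m \<Rightarrow> complex^'m^'m \<Rightarrow> (nat \<times> nat \<Rightarrow> real) \<Rightarrow> bool" where
  "eigenvalue_numbering \<sigma> T1 T2 H1 H2 lam \<longleftrightarrow>
     (\<forall>(n,k)\<in>index_set T1 T2. \<forall>(n',k')\<in>index_set T1 T2.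
        n < n' \<or> (n = n' \<and> k \<le> k') \<longrightarrow> lam (n,k) \<le> lam (n',k')) \<and>
     (\<forall>\<mu>::complex. finite {p \<in> index_set T1 T2. of_real (lam p) = \<mu>} \<and>
        card {p \<in> index_set T1 T2. of_real (lam p) = \<mu>} = multiplicity_L \<sigma> T1 T2 H1 H2 \<mu>)"

definition rho :: "complex \<Rightarrow> complex" where
  "rho \<mu> = (THE r. r\<^sup>2 = \<mu> \<and> - pi/2 \<le> Arg r \<and> Arg r < pi/2)"

definition Weyl_solution ::
    "(real \<Rightarrow> complex^'m^'m) \<Rightarrow> complex^'m^'m \<Rightarrow> complex^'m^'m \<Rightarrow>
     complex^'m^'m \<Rightarrow> complex^'m^'m \<Rightarrow> complex \<Rightarrow>
     (real \<Rightarrow> complex^'m^'m) \<times> (real \<Rightarrow> complex^'m^'m)" where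
  "Weyl_solution \<sigma> T1 T2 H1 H2 \<mu> = (SOME (\<Phi>,\<Phi>1). solution (**) \<sigma> \<mu> \<Phi> \<Phi>1 \<and>
     boundary_form (**) T1 H1 (\<Phi> 0) (\<Phi>1 0) = mat 1 \<and>
     boundary_form (**) T2 H2 (\<Phi> pi) (\<Phi>1 pi) = 0)"

definition Weyl_matrix ::
    "(real \<Rightarrow> complex^'m^'m) \<Rightarrow> complex^'m^'m \<Rightarrow> complex^'m^'m \<Rightarrow>
     complex^'m^'m \<Rightarrow> complex^'m^'m \<Rightarrow> complex \<Rightarrow> complex^'m^'m" where
  "Weyl_matrix \<sigma> T1 T2 H1 H2 \<mu> =
     (case Weyl_solution \<sigma> T1 T2 H1 H2 \<mu> of (\<Phi>,\<Phi>1) \<Rightarrow> T1 ** \<Phi> 0 + orth_compl T1 ** \<Phi>1 0)"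

definition weight_matrix ::
    "(real \<Rightarrow> complex^'m^'m) \<Rightarrow> complex^'m^'m \<Rightarrow> complex^'m^'m \<Rightarrow>
     complex^'m^'m \<Rightarrow> complex^'m^'m \<Rightarrow> complex \<Rightarrow> complex^'m^'m" where
  "weight_matrix \<sigma> T1 T2 H1 H2 \<mu> =
     (\<chi> i j. residue (\<lambda>z. Weyl_matrix \<sigma> T1 T2 H1 H2 z $ i $ j) \<mu>)"

definition T_mat :: "complex^'m^'m \<Rightarrow> complex \<Rightarrow> complex^'m^'m" where
  "T_mat T1 \<mu> = (if rho \<mu> \<noteq> 0 then T1 + mat (rho \<mu>) ** orth_compl T1 else mat 1)"

definition B_mat ::
    "(real \<Rightarrow> complex^'m^'m) \<Rightarrow> complex^'m^'m \<Rightarrow> complex^'m^'m \<Rightarrow>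
     complex^'m^'m \<Rightarrow> complex^'m^'m \<Rightarrow> complex \<Rightarrow> complex^'m^'m" where
  "B_mat \<sigma> T1 T2 H1 H2 \<mu> = (pi/2) *\<^sub>R
     (matrix_inv (T_mat T1 \<mu>) ** weight_matrix \<sigma> T1 T2 H1 H2 \<mu> ** matrix_inv (T_mat T1 \<mu>))"

text \<open>For every maximal group \<open>G\<close> of indices with equal eigenvalues, \<open>E\<close> restricted to \<open>G\<close> is an
  orthonormal basis of the range of the matrix \<open>B\<close> of that group.\<close>

definition basis_choice ::
    "(real \<Rightarrow> complex^'m^'m) \<Rightarrow> complex^'m^'m \<Rightarrow> complex^'m^'m \<Rightarrow>
     complex^'m^'m \<Rightarrow> complex^'m^'m \<Rightarrow> (nat \<times> nat \<Rightarrow> real) \<Rightarrow>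
     (nat \<times> nat \<Rightarrow> complex^'m) \<Rightarrow> bool" where
  "basis_choice \<sigma> T1 T2 H1 H2 lam E \<longleftrightarrow>
     (\<forall>p\<in>index_set T1 T2.
        let G = {q \<in> index_set T1 T2. lam q = lam p} in
        (\<forall>q\<in>G. \<forall>r\<in>G. cinner (E q) (E r) = (if q = r then 1 else 0)) \<and>
        vec.span (E ` G) = range ((*v) (B_mat \<sigma> T1 T2 H1 H2 (of_real (lam p)))))"

end

theory Submission
  imports Defs
begin

text \<open>
  Let \<open>f\<close> be orthogonal to all eigenfunctions.  Then the solution \<open>Y\<^sub>z\<close> of \<open>\<ell>Y = zY + f\<close> with the boundary
  conditions of \<open>L\<close> can be chosen as an entire function of \<open>z\<close>, and Green's formula gives
  \<open>Im z \<parallel>Y\<^sub>z\<parallel>\<^sup>2 = Im \<langle>Y\<^sub>z,f\<rangle>\<close>.  Hence \<open>\<bar>Im z\<bar> \<bar>\<langle>Y\<^sub>z,f\<rangle>\<bar> \<le> \<parallel>f\<parallel>\<^sup>2\<close>, which forces an entire function to vanish,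
  and therefore \<open>f = 0\<close>.

  For the Riesz property, eigenfunctions of different eigenvalues are orthogonal, so it suffices to have
  \<open>c\<bar>v\<bar>\<^sup>2 \<le> \<parallel>\<phi>(\<cdot>,\<lambda>) T v\<parallel>\<^sup>2 \<le> C\<bar>v\<bar>\<^sup>2\<close>, where \<open>T\<close> is the scaling matrix of the eigenvalue \<open>\<lambda>\<close>, with constants
  that do not depend on the eigenvalue.  For large \<open>\<lambda>\<close> this is an energy estimate, and only finitely many eigenvalues remain.
  No asymptotics of the spectral data are needed.

  The matrix \<open>B\<close> of an eigenvalue enters only through two facts: \<open>T\<close> maps its range into the initial data of
  eigenfunctions, because the residue of the Weyl matrix does, and the range has the dimension of the
  eigenspace, since the orthonormal basis has as many elements.
\<close>

section \<open>Absolutely continuous functions\<close>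

text \<open>Since \<open>\<sigma>\<close> is only square integrable, the equation is treated as a
  first-order system for \<open>(Y, Y1)\<close> whose coefficients \<open>\<sigma>\<close> and
  \<open>\<sigma>\<^sup>2\<close> are merely integrable. Solutions satisfy it almost everywhere, so
  existence, uniqueness, Green's formula and the energy estimate all rest on the fundamental theorem
  for absolutely continuous functions.

  Neither a resolvent operator nor a characteristic determinant appears. A solution is fixed by its
  parameter, its force and two vectors of C^m, one of which is prescribed by the boundary condition
  at 0. Families of solutions with varying parameter are controlled by Bolzano-Weierstrass for the
  remaining vector. This one compactness argument yields isolated eigenvalues, continuity and simple
  residues of the Weyl matrix, and the continuation of \<open>Y\<^sub>z\<close> through the
  eigenvalues.

  The matrix \<open>T\<close> balances the initial data: up to \<open>H1 v\<close> the coefficient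
  \<open>T v\<close> produces \<open>Y(0) = T1 v\<close> and a quasi-derivative
  \<open>\<rho> (v - T1 v)\<close>. After division of the latter by \<open>\<rho>\<close> the
  initial energy is comparable to \<open>\<bar>v\<bar>\<^sup>2\<close> uniformly in the
  eigenvalue.\<close>

lemma AE_lebesgue_on_iff_negligible:
  assumes "S \<in> sets lebesgue"
  shows "(AE x in lebesgue_on S. P x) \<longleftrightarrow> negligible {x \<in> S. \<not> P x}"
proof -
  have "(AE x in lebesgue_on S. P x) \<longleftrightarrow> (AE x in lebesgue. x \<in> S \<longrightarrow> P x)"
    using assms by (subst AE_restrict_space_iff) auto
  also have "\<dots> \<longleftrightarrow> negligible {x \<in> S. \<not> P x}"
  proof
    assume "AE x in lebesgue. x \<in> S \<longrightarrow> P x"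
    then obtain N where "{x. \<not> (x \<in> S \<longrightarrow> P x)} \<subseteq> N" "N \<in> null_sets lebesgue"
      by (auto simp: eventually_ae_filter)
    then show "negligible {x \<in> S. \<not> P x}"
      using negligible_subset[of N "{x \<in> S. \<not> P x}"] unfolding negligible_iff_null_sets by blast
  next
    assume "negligible {x \<in> S. \<not> P x}"
    then show "AE x in lebesgue. x \<in> S \<longrightarrow> P x"
      unfolding negligible_iff_null_sets by (rule AE_I') auto
  qed
  finally show ?thesis .
qed

lemma abs_cont_onD:
  assumes "abs_cont_on S f" "e > 0"
  obtains d where "d > 0"
    "\<And>D. \<lbrakk>finite D; \<And>a b. (a,b) \<in> D \<Longrightarrow> a \<le> b \<and> {a..b} \<subseteq> S;
        pairwise (\<lambda>(a,b) (c,d). {a<..<b} \<inter> {c<..<d} = {}) D; (\<Sum>(a,b)\<in>D. b - a) < d\<rbrakk>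
       \<Longrightarrow> (\<Sum>(a,b)\<in>D. norm (f b - f a)) < e"
proof -
  obtain d where d: "d > 0" "\<forall>D. finite D \<and> (\<forall>(a,b)\<in>D. a \<le> b \<and> {a..b} \<subseteq> S) \<and>
        pairwise (\<lambda>(a,b) (c,d). {a<..<b} \<inter> {c<..<d} = {}) D \<and>
        (\<Sum>(a,b)\<in>D. b - a) < d \<longrightarrow> (\<Sum>(a,b)\<in>D. norm (f b - f a)) < e"
    using assms unfolding abs_cont_on_def by meson
  show ?thesis
    by (rule that[OF d(1)]) (use d(2) in blast)
qed

text \<open>Comparison of increments from which sums, products, Lipschitz images and pairs are
  obtained. Two dominating functions are allowed because the increment of a product involves those
  of both factors.\<close>

lemma abs_cont_on_dominated:
  assumes g: "abs_cont_on S g" and h: "abs_cont_on S h"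
    and le: "\<And>a b. a \<le> b \<Longrightarrow> {a..b} \<subseteq> S \<Longrightarrow>
      norm (f b - f a) \<le> C * (norm (g b - g a) + norm (h b - h a))"
  shows "abs_cont_on S f"
  unfolding abs_cont_on_def
proof (intro allI impI)
  fix e :: real assume e: "e > 0"
  \<comment> \<open>Replacing \<open>C\<close> by \<open>\<bar>C\<bar> + 1\<close> keeps the factor
    positive, so that the final inequality is strict for every sign of \<open>C\<close>.\<close>
  define e' where "e' = e / (2 * (\<bar>C\<bar> + 1))"
  have e': "e' > 0" using e by (simp add: e'_def)
  obtain d1 where d1: "d1 > 0" "\<And>D. \<lbrakk>finite D; \<And>a b. (a,b) \<in> D \<Longrightarrow> a \<le> b \<and> {a..b} \<subseteq> S;
        pairwise (\<lambda>(a,b) (c,d). {a<..<b} \<inter> {c<..<d} = {}) D; (\<Sum>(a,b)\<in>D. b - a) < d1\<rbrakk>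
       \<Longrightarrow> (\<Sum>(a,b)\<in>D. norm (g b - g a)) < e'"
    using abs_cont_onD[OF g e'] by metis
  obtain d2 where d2: "d2 > 0" "\<And>D. \<lbrakk>finite D; \<And>a b. (a,b) \<in> D \<Longrightarrow> a \<le> b \<and> {a..b} \<subseteq> S;
        pairwise (\<lambda>(a,b) (c,d). {a<..<b} \<inter> {c<..<d} = {}) D; (\<Sum>(a,b)\<in>D. b - a) < d2\<rbrakk>
       \<Longrightarrow> (\<Sum>(a,b)\<in>D. norm (h b - h a)) < e'"
    using abs_cont_onD[OF h e'] by metis
  show "\<exists>d>0. \<forall>D. finite D \<and> (\<forall>(a,b)\<in>D. a \<le> b \<and> {a..b} \<subseteq> S) \<and>
        pairwise (\<lambda>(a,b) (c,d). {a<..<b} \<inter> {c<..<d} = {}) D \<and>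
        (\<Sum>(a,b)\<in>D. b - a) < d \<longrightarrow> (\<Sum>(a,b)\<in>D. norm (f b - f a)) < e"
  proof (intro exI[of _ "min d1 d2"] conjI allI impI)
    show "0 < min d1 d2" using d1 d2 by simp
    fix D :: "(real \<times> real) set"
    assume D: "finite D \<and> (\<forall>(a,b)\<in>D. a \<le> b \<and> {a..b} \<subseteq> S) \<and>
        pairwise (\<lambda>(a,b) (c,d). {a<..<b} \<inter> {c<..<d} = {}) D \<and>
        (\<Sum>(a,b)\<in>D. b - a) < min d1 d2"
    let ?G = "\<Sum>(a,b)\<in>D. norm (g b - g a)" and ?H = "\<Sum>(a,b)\<in>D. norm (h b - h a)"
    have G: "?G < e'" and H: "?H < e'" by (rule d1 d2; use D in auto)+
    have "(\<Sum>(a,b)\<in>D. norm (f b - f a)) \<le>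
        (\<Sum>(a,b)\<in>D. (\<bar>C\<bar> + 1) * (norm (g b - g a) + norm (h b - h a)))"
    proof (rule sum_mono, clarify)
      fix a b assume ab: "(a,b) \<in> D"
      then have "norm (f b - f a) \<le> C * (norm (g b - g a) + norm (h b - h a))"
        using D by (intro le) auto
      also have "\<dots> \<le> (\<bar>C\<bar> + 1) * (norm (g b - g a) + norm (h b - h a))"
        by (intro mult_right_mono) auto
      finally show "norm (f b - f a) \<le> (\<bar>C\<bar> + 1) * (norm (g b - g a) + norm (h b - h a))" .
    qed
    also have "\<dots> = (\<bar>C\<bar> + 1) * (?G + ?H)"
      by (simp add: sum_distrib_left sum.distrib[symmetric] case_prod_beta)
    also have "\<dots> < (\<bar>C\<bar> + 1) * (e' + e')"
      using G H by (intro mult_strict_left_mono) auto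
    also have "\<dots> = e"
    proof -
      have "e' * (2 * (\<bar>C\<bar> + 1)) = e" unfolding e'_def by simp
      then show ?thesis by (simp add: algebra_simps)
    qed
    finally show "(\<Sum>(a,b)\<in>D. norm (f b - f a)) < e" .
  qed
qed

lemma abs_cont_on_lipschitz:
  assumes "abs_cont_on S g" "\<And>a b. a \<le> b \<Longrightarrow> {a..b} \<subseteq> S \<Longrightarrow> norm (f b - f a) \<le> C * norm (g b - g a)"
  shows "abs_cont_on S f"
proof (rule abs_cont_on_dominated[OF assms(1) assms(1)])
  fix a b :: real assume "a \<le> b" "{a..b} \<subseteq> S"
  then show "norm (f b - f a) \<le> (C/2) * (norm (g b - g a) + norm (g b - g a))"
    using assms(2)[of a b] by simp
qed

lemma abs_cont_on_const: "abs_cont_on S (\<lambda>x. c)"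
  unfolding abs_cont_on_def by (auto intro!: exI[of _ 1] simp: case_prod_beta)

lemma abs_cont_on_add:
  assumes "abs_cont_on S f" "abs_cont_on S g"
  shows "abs_cont_on S (\<lambda>x. f x + g x)"
proof (rule abs_cont_on_dominated[OF assms])
  fix a b :: real
  have "f b + g b - (f a + g a) = (f b - f a) + (g b - g a)" by simp
  then show "norm (f b + g b - (f a + g a)) \<le> 1 * (norm (f b - f a) + norm (g b - g a))"
    by (metis mult_1 norm_triangle_ineq)
qed

lemma abs_cont_on_linear:
  assumes "bounded_linear L" "abs_cont_on S f"
  shows "abs_cont_on S (\<lambda>x. L (f x))"
proof -
  interpret L: bounded_linear L by fact
  obtain K where K: "\<And>x. norm (L x) \<le> norm x * K" using L.bounded by auto
  show ?thesis
    by (rule abs_cont_on_lipschitz[OF assms(2), of _ K])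
       (metis K L.diff mult.commute)
qed

lemma abs_cont_on_imp_continuous_on:
  assumes "abs_cont_on {a..b} f"
  shows "continuous_on {a..b} f"
  unfolding continuous_on_iff
proof (intro ballI allI impI)
  fix x e :: real assume x: "x \<in> {a..b}" and e: "e > 0"
  obtain d where d: "d > 0" "\<And>D. \<lbrakk>finite D; \<And>u v. (u,v) \<in> D \<Longrightarrow> u \<le> v \<and> {u..v} \<subseteq> {a..b};
        pairwise (\<lambda>(a,b) (c,d). {a<..<b} \<inter> {c<..<d} = {}) D; (\<Sum>(a,b)\<in>D. b - a) < d\<rbrakk>
       \<Longrightarrow> (\<Sum>(a,b)\<in>D. norm (f b - f a)) < e"
    using abs_cont_onD[OF assms e] by metis
  have *: "norm (f v - f u) < e" if "u \<le> v" "u \<in> {a..b}" "v \<in> {a..b}" "v - u < d" for u v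
    using d(2)[of "{(u,v)}"] that by auto
  show "\<exists>d>0. \<forall>x'\<in>{a..b}. dist x' x < d \<longrightarrow> dist (f x') (f x) < e"
  proof (intro exI[of _ d] conjI ballI impI d(1))
    fix y assume y: "y \<in> {a..b}" "dist y x < d"
    show "dist (f y) (f x) < e"
      using *[of x y] *[of y x] x y by (cases "x \<le> y") (auto simp: dist_norm norm_minus_commute)
  qed
qed

lemma abs_cont_on_bilinear:
  fixes f :: "real \<Rightarrow> 'b::real_normed_vector" and g :: "real \<Rightarrow> 'c::real_normed_vector"
  assumes B: "bounded_bilinear B" and f: "abs_cont_on {a..b} f" and g: "abs_cont_on {a..b} g"
  shows "abs_cont_on {a..b} (\<lambda>x. B (f x) (g x))"
proof -
  interpret B: bounded_bilinear B by fact
  obtain K where K: "K > 0" "\<And>x y. norm (B x y) \<le> norm x * norm y * K" using B.pos_bounded by auto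
  have "bounded (f ` {a..b})" "bounded (g ` {a..b})"
    using f g by (auto intro!: compact_imp_bounded compact_continuous_image abs_cont_on_imp_continuous_on)
  then obtain M N where M: "\<And>x. x \<in> {a..b} \<Longrightarrow> norm (f x) \<le> M" and N: "\<And>x. x \<in> {a..b} \<Longrightarrow> norm (g x) \<le> N"
    unfolding bounded_iff by fastforce
  show ?thesis
  proof (rule abs_cont_on_dominated[OF f g])
    fix u v :: real assume uv: "u \<le> v" "{u..v} \<subseteq> {a..b}"
    have "B (f v) (g v) - B (f u) (g u) = B (f v - f u) (g v) + B (f u) (g v - g u)"
      by (simp add: B.diff_left B.diff_right)
    then have "norm (B (f v) (g v) - B (f u) (g u)) \<le>
        norm (f v - f u) * norm (g v) * K + norm (f u) * norm (g v - g u) * K"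
      by (metis K(2) add_mono norm_triangle_le)
    also have "\<dots> \<le> norm (f v - f u) * (\<bar>M\<bar> + \<bar>N\<bar>) * K + (\<bar>M\<bar> + \<bar>N\<bar>) * norm (g v - g u) * K"
      using uv M[of u] N[of v] K(1)
      by (intro add_mono mult_right_mono mult_left_mono) auto
    finally show "norm (B (f v) (g v) - B (f u) (g u)) \<le>
        ((\<bar>M\<bar> + \<bar>N\<bar>) * K) * (norm (f v - f u) + norm (g v - g u))"
      by (simp add: algebra_simps)
  qed
qed

text \<open>Intervals that share endpoints overlap only in finite sets, which the integral does not
  see. With \<open>h\<close> the indicator of an open set this bounds the total length of intervals
  inside it; with \<open>h\<close> the excess of an integrand over a level it gives absolute
  continuity of the integral.\<close>

lemma sum_integral_le_nonoverlapping:
  fixes h :: "real \<Rightarrow> real"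
  assumes h: "h integrable_on {a..b}" "\<And>x. x \<in> {a..b} \<Longrightarrow> h x \<ge> 0"
    and D: "finite D" "\<And>u v. (u,v) \<in> D \<Longrightarrow> u \<le> v \<and> {u..v} \<subseteq> {a..b}"
      "pairwise (\<lambda>(a,b) (c,d). {a<..<b} \<inter> {c<..<d} = {}) D"
  shows "(\<Sum>(u,v)\<in>D. integral {u..v} h) \<le> integral {a..b} h"
proof -
  let ?I = "\<lambda>(u,v). {u..v::real}"
  have inj: "inj_on ?I D"
    using D(2) by (auto simp: inj_on_def)
  have int: "h integrable_on {u..v}" if "(u,v) \<in> D" for u v
    using h(1) D(2)[OF that] integrable_on_subinterval by blast
  have "(h has_integral (\<Sum>S\<in>?I ` D. integral S h)) (\<Union>(?I ` D))"
  proof (rule has_integral_Union)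
    show "(h has_integral integral S h) S" if "S \<in> ?I ` D" for S
      using that int by (auto intro: integrable_integral)
    show "pairwise (\<lambda>S S'. negligible (S \<inter> S')) (?I ` D)"
    proof (rule pairwise_imageI)
      fix p q assume *: "p \<in> D" "q \<in> D" "p \<noteq> q"
      obtain a b c d where pq: "p = (a,b)" "q = (c,d)" by (metis surj_pair)
      then have "{a<..<b} \<inter> {c<..<d} = {}" using * D(3) by (auto simp: pairwise_def)
      then have "{a..b} \<inter> {c..d} \<subseteq> {a,b,c,d}" by force
      then show "negligible (?I p \<inter> ?I q)"
        unfolding pq prod.case by (meson finite.emptyI finite.insertI negligible_finite negligible_subset)
    qed
  qed (use D in auto)
  then have "(\<Sum>S\<in>?I ` D. integral S h) \<le> integral {a..b} h"
  proof (rule has_integral_subset_le[rotated 1])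
    show "(h has_integral integral {a..b} h) {a..b}" using h(1) by (rule integrable_integral)
    show "\<Union> (?I ` D) \<subseteq> {a..b}" using D(2) by fast
    show "\<forall>x\<in>{a..b}. 0 \<le> h x" using h(2) by blast
  qed
  then show ?thesis
    by (subst (asm) sum.reindex[OF inj]) (simp add: case_prod_unfold comp_def)
qed

text \<open>Tags in the exceptional set are forced by the gauge into an open set of small measure, so by absolute
  continuity the increments of \<open>f\<close> over their intervals are negligible.\<close>

lemma fundamental_theorem_of_calculus_abs_cont:
  fixes f :: "real \<Rightarrow> 'a::euclidean_space"
  assumes ab: "a \<le> b" and f: "abs_cont_on {a..b} f" and N: "negligible N"
    and d: "\<And>x. x \<in> {a<..<b} - N \<Longrightarrow> (f has_vector_derivative g x) (at x)"
  shows "(g has_integral (f b - f a)) {a..b}"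
proof (cases "a = b")
  case True
  then show ?thesis using has_integral_refl(2)[of g b] by simp
next
  case False
  with ab have ab: "a < b" by simp
  \<comment> \<open>The endpoints join the exceptional set, because differentiability is assumed
    only in the interior.\<close>
  define N' where "N' = insert a (insert b N)"
  have N': "negligible N'" unfolding N'_def using N by (simp add: negligible_insert)
  \<comment> \<open>With the value 0 on \<open>N'\<close> the exceptional tags drop out of the
    Riemann sum, and only the increments of \<open>f\<close> over their intervals remain to be
    estimated.\<close>
  define g' where "g' = (\<lambda>x. if x \<in> N' then 0 else g x)"
  have "(g' has_integral (f b - f a)) {a..b}"
    unfolding has_integral_factor_content box_real[symmetric]
  proof safe
    fix e :: real assume e: "e > 0"
    \<comment> \<open>Half of the admissible error is reserved for the exceptional tags, the other
      half for the tags at which \<open>f\<close> is differentiable.\<close>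
    define e1 where "e1 = e / 2 * (b - a)"
    have e1: "e1 > 0" using e ab by (simp add: e1_def)
    obtain dl where dl: "dl > 0" "\<And>D. \<lbrakk>finite D; \<And>u v. (u,v) \<in> D \<Longrightarrow> u \<le> v \<and> {u..v} \<subseteq> {a..b};
        pairwise (\<lambda>(a,b) (c,d). {a<..<b} \<inter> {c<..<d} = {}) D; (\<Sum>(a,b)\<in>D. b - a) < dl\<rbrakk>
       \<Longrightarrow> (\<Sum>(a,b)\<in>D. norm (f b - f a)) < e1"
      using abs_cont_onD[OF f e1] by metis
    obtain T where T: "N' \<subseteq> T" "T \<in> lmeasurable" "measure lebesgue T < dl / 2"
      using N' dl(1) unfolding negligible_outer by (meson half_gt_zero)
    obtain U where U: "open U" "T \<subseteq> U" "U - T \<in> lmeasurable" "emeasure lebesgue (U - T) < ennreal (dl / 2)"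
      using sets_lebesgue_outer_open[of T "dl/2"] T(2) dl(1) by auto
    have "measure lebesgue (U - T) < dl / 2"
      using U(3,4) dl(1) by (simp add: emeasure_eq_measure2 ennreal_less_iff)
    moreover have "U = T \<union> (U - T)" using U by auto
    ultimately have mU: "U \<in> lmeasurable" "measure lebesgue U < dl"
      using T U(3) measure_Un_le[of T lebesgue "U - T"]
      by (metis fmeasurable.Un, smt (verit) fmeasurableD field_sum_of_halves)
    have "\<forall>x. \<exists>r>0. (x \<notin> N' \<longrightarrow> x \<in> {a..b} \<longrightarrow> (\<forall>y\<in>{a..b}. norm (y - x) < r \<longrightarrow>
        norm (f y - f x - (y - x) *\<^sub>R g' x) \<le> e / 2 * norm (y - x))) \<and> (x \<in> N' \<longrightarrow> ball x r \<subseteq> U)"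
    proof
      fix x
      show "\<exists>r>0. (x \<notin> N' \<longrightarrow> x \<in> {a..b} \<longrightarrow> (\<forall>y\<in>{a..b}. norm (y - x) < r \<longrightarrow>
        norm (f y - f x - (y - x) *\<^sub>R g' x) \<le> e / 2 * norm (y - x))) \<and> (x \<in> N' \<longrightarrow> ball x r \<subseteq> U)"
      proof (cases "x \<in> N'")
        case True
        then have "x \<in> U" using T U by auto
        then obtain r where "r > 0" "ball x r \<subseteq> U" using U(1) open_contains_ball by blast
        then show ?thesis using True by (auto intro!: exI[of _ r])
      next
        case xN: False
        show ?thesis
        proof (cases "x \<in> {a..b}")
          case True
          then have "(f has_vector_derivative g' x) (at x)"
            using d[of x] xN by (auto simp: N'_def g'_def)
          then have "\<exists>r>0. \<forall>y. norm (y - x) < r \<longrightarrow>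
              norm (f y - f x - (y - x) *\<^sub>R g' x) \<le> e / 2 * norm (y - x)"
            unfolding has_vector_derivative_def has_derivative_at_alt using e by (meson half_gt_zero)
          then show ?thesis using xN by blast
        next
          case False
          then show ?thesis using xN by (auto intro: exI[of _ 1])
        qed
      qed
    qed
    then obtain r where r: "\<And>x. r x > 0"
      "\<And>x y. \<lbrakk>x \<notin> N'; x \<in> {a..b}; y \<in> {a..b}; norm (y - x) < r x\<rbrakk> \<Longrightarrow>
        norm (f y - f x - (y - x) *\<^sub>R g' x) \<le> e / 2 * norm (y - x)"
      "\<And>x. x \<in> N' \<Longrightarrow> ball x (r x) \<subseteq> U"
      by metis
    show "\<exists>d. gauge d \<and> (\<forall>p. p tagged_division_of (cbox a b) \<and> d fine p \<longrightarrow>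
      norm ((\<Sum>(x, k)\<in>p. measure lborel k *\<^sub>R g' x) - (f b - f a)) \<le> e * measure lborel (cbox a b))"
    proof (intro exI[of _ "\<lambda>x. ball x (r x)"] conjI allI impI)
      show "gauge (\<lambda>x. ball x (r x))" using r(1) by (simp add: gauge_ball_dependent)
      fix p assume "p tagged_division_of cbox a b \<and> (\<lambda>x. ball x (r x)) fine p"
      then have p: "p tagged_division_of {a..b}" and fine: "(\<lambda>x. ball x (r x)) fine p" by auto
      note pD = tagged_division_ofD[OF p]
      have fin: "finite p" by (rule pD)
      have K: "K = {Inf K..Sup K} \<and> Inf K \<le> x \<and> x \<le> Sup K \<and> a \<le> Inf K \<and> Sup K \<le> b \<and> K \<subseteq> ball x (r x)
          \<and> measure lborel K = Sup K - Inf K"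
        if xK: "(x,K) \<in> p" for x K
      proof -
        obtain u v where uv: "K = {u..v}" using pD(4)[OF xK] by auto
        have "x \<in> {u..v}" using pD(2)[OF xK] uv by simp
        then have "u \<le> v" by simp
        then show ?thesis using uv \<open>x \<in> {u..v}\<close> pD(3)[OF xK] fineD[OF fine xK] by simp
      qed
      \<comment> \<open>Degenerate intervals carry no increment. Without them the interiors are
        nonempty, so disjointness of the interiors makes the map to endpoint pairs
        injective.\<close>
      define bad where "bad = {(x,K)\<in>p. x \<in> N' \<and> Inf K < Sup K}"
      define D where "D = (\<lambda>(x,K). (Inf K, Sup K)) ` bad"
      have finb: "finite bad" unfolding bad_def by (rule finite_subset[OF _ fin]) auto
      have bp: "(x,K) \<in> p \<and> x \<in> N' \<and> Inf K < Sup K" if "(x,K) \<in> bad" for x K using that by (auto simp: bad_def)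
      have disj: "{Inf K<..<Sup K} \<inter> {Inf L<..<Sup L} = {}" if "(x,K) \<in> p" "(y,L) \<in> p" "(x,K) \<noteq> (y,L)" for x y K L
      proof -
        have "interior K \<inter> interior L = {}" by (rule pD(5)[OF that])
        moreover have "interior K = {Inf K<..<Sup K}" "interior L = {Inf L<..<Sup L}"
          using K[OF that(1)] K[OF that(2)] by (metis interior_atLeastAtMost_real)+
        ultimately show ?thesis by simp
      qed
      have inj: "inj_on (\<lambda>(x,K). (Inf K, Sup K)) bad"
      proof (rule inj_onI, clarify)
        fix x K y L assume *: "(x,K) \<in> bad" "(y,L) \<in> bad" "Inf K = Inf L" "Sup K = Sup L"
        show "x = y \<and> K = L"
        proof (rule ccontr)
          assume "\<not> (x = y \<and> K = L)"
          then have "{Inf K<..<Sup K} \<inter> {Inf L<..<Sup L} = {}" using disj[of x K y L] bp * by auto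
          then have "{Inf K<..<Sup K} = {}" using * by simp
          then show False using bp[OF *(1)] by auto
        qed
      qed
      have Dprop: "u \<le> v \<and> {u..v} \<subseteq> {a..b} \<and> {u..v} \<subseteq> U" if uv: "(u,v) \<in> D" for u v
      proof -
        obtain x K where xK: "(x,K) \<in> bad" "u = Inf K" "v = Sup K" using uv by (auto simp: D_def)
        then have "u \<le> v" "a \<le> u" "v \<le> b" "{u..v} = K" "K \<subseteq> U"
          using K[of x K] bp[OF xK(1)] r(3)[of x] by auto
        then show ?thesis by auto
      qed
      have pw: "pairwise (\<lambda>(a,b) (c,d). {a<..<b} \<inter> {c<..<d} = {}) D"
        unfolding D_def
      proof (rule pairwise_imageI)
        fix s t assume *: "s \<in> bad" "t \<in> bad" "s \<noteq> t"
        obtain x K y L where st: "s = (x,K)" "t = (y,L)" by (metis surj_pair)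
        show "(case (case s of (x, K) \<Rightarrow> (Inf K, Sup K)) of (a, b) \<Rightarrow>
            \<lambda>(c, d). {a<..<b} \<inter> {c<..<d} = {}) (case t of (x, K) \<Rightarrow> (Inf K, Sup K))"
          using disj[of x K y L] * bp unfolding st by auto
      qed
      have intU: "indicat_real U integrable_on {a..b}"
      proof -
        have "indicat_real U integrable_on UNIV"
          using mU(1) by (simp add: integrable_on_indicator)
        then show ?thesis using integrable_on_subcbox[of "indicat_real U" UNIV a b] by simp
      qed
      have "(\<Sum>(u,v)\<in>D. v - u) = (\<Sum>(u,v)\<in>D. integral {u..v} (indicat_real U))"
      proof (rule sum.cong[OF refl], clarify)
        fix u v assume "(u,v) \<in> D"
        then have "integral {u..v} (indicat_real U) = integral {u..v} (\<lambda>x. 1)"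
          using Dprop[of u v] by (intro integral_cong) (auto simp: indicator_def dest!: subsetD)
        then show "v - u = integral {u..v} (indicat_real U)" using Dprop[OF \<open>(u,v) \<in> D\<close>] by simp
      qed
      also have "\<dots> \<le> integral {a..b} (indicat_real U)"
        by (rule sum_integral_le_nonoverlapping[OF intU]) (use Dprop pw finb in \<open>auto simp: D_def\<close>)
      also have "\<dots> = measure lebesgue (U \<inter> {a..b})"
        using mU(1) by (subst integral_indicator) (auto intro!: fmeasurable_Int_fmeasurable)
      also have "\<dots> \<le> measure lebesgue U"
        using mU(1) by (intro measure_mono_fmeasurable) auto
      finally have "(\<Sum>(u,v)\<in>D. v - u) < dl" using mU(2) by simp
      then have "(\<Sum>(u,v)\<in>D. norm (f v - f u)) < e1"
        by (intro dl(2)) (use Dprop pw finb in \<open>auto simp: D_def\<close>)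
      then have bad_le: "(\<Sum>(x,K)\<in>bad. norm (f (Sup K) - f (Inf K))) < e1"
        unfolding D_def by (subst (asm) sum.reindex[OF inj]) (simp add: case_prod_unfold comp_def)
      have "(\<Sum>(x, k)\<in>p. measure lborel k *\<^sub>R g' x) - (f b - f a) =
          (\<Sum>(x,K)\<in>p. measure lborel K *\<^sub>R g' x - (f (Sup K) - f (Inf K)))"
        using additive_tagged_division_1[OF less_imp_le[OF ab] p, of f]
        by (simp add: sum_subtractf case_prod_beta)
      also have "norm \<dots> \<le> (\<Sum>(x,K)\<in>p. e / 2 * (Sup K - Inf K) +
          (if x \<in> N' \<and> Inf K < Sup K then norm (f (Sup K) - f (Inf K)) else 0))"
      proof (rule sum_norm_le, clarify)
        fix x K assume xK: "(x,K) \<in> p"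
        note k = K[OF xK]
        show "norm (measure lborel K *\<^sub>R g' x - (f (Sup K) - f (Inf K))) \<le> e / 2 * (Sup K - Inf K) +
          (if x \<in> N' \<and> Inf K < Sup K then norm (f (Sup K) - f (Inf K)) else 0)"
        proof (cases "x \<in> N'")
          case True
          then have g0: "g' x = 0" by (simp add: g'_def)
          show ?thesis
          proof (cases "Inf K < Sup K")
            case True
            then show ?thesis using \<open>x \<in> N'\<close> g0 e by (simp add: norm_minus_commute)
          next
            case False
            then have "Sup K = Inf K" using k by linarith
            then show ?thesis using g0 by simp
          qed
        next
          case False
          have kx: "Inf K \<le> x" "x \<le> Sup K" "measure lborel K = Sup K - Inf K"
            by (fact k[THEN conjunct2, THEN conjunct1] k[THEN conjunct2, THEN conjunct2, THEN conjunct1]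
              k[THEN conjunct2, THEN conjunct2, THEN conjunct2, THEN conjunct2, THEN conjunct2, THEN conjunct2])+
          have xab: "x \<in> {a..b}" using k by auto
          have "Inf K \<in> K" "Sup K \<in> K" using k by (metis atLeastAtMost_iff order.trans order_refl)+
          then have "Inf K \<in> ball x (r x)" "Sup K \<in> ball x (r x)" using k by blast+
          then have near: "norm (Inf K - x) < r x" "norm (Sup K - x) < r x"
            by (auto simp: dist_norm norm_minus_commute)
          then have ends: "Inf K \<in> {a..b}" "Sup K \<in> {a..b}"
            using k by auto
          have 1: "norm (f (Inf K) - f x - (Inf K - x) *\<^sub>R g' x) \<le> e / 2 * norm (Inf K - x)"
            and 2: "norm (f (Sup K) - f x - (Sup K - x) *\<^sub>R g' x) \<le> e / 2 * norm (Sup K - x)"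
            by (rule r(2)[OF False xab]; fact ends near)+
          \<comment> \<open>Straddle argument: the tag lies between the endpoints, so the two
            one-sided errors add up to a multiple of the length of the interval.\<close>
          have "measure lborel K *\<^sub>R g' x - (f (Sup K) - f (Inf K)) =
              (f (Inf K) - f x - (Inf K - x) *\<^sub>R g' x) - (f (Sup K) - f x - (Sup K - x) *\<^sub>R g' x)"
            by (simp add: kx algebra_simps)
          then have "norm (measure lborel K *\<^sub>R g' x - (f (Sup K) - f (Inf K))) \<le>
              e / 2 * norm (Inf K - x) + e / 2 * norm (Sup K - x)"
            by (simp only:) (rule order_trans[OF norm_triangle_ineq4 add_mono[OF 1 2]])
          also have "\<dots> = e / 2 * (Sup K - Inf K)" using kx by (simp add: field_simps)
          finally show ?thesis using False by simp
        qed
      qed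
      also have "\<dots> = e / 2 * (\<Sum>(x,K)\<in>p. Sup K - Inf K) +
          (\<Sum>(x,K)\<in>p. if x \<in> N' \<and> Inf K < Sup K then norm (f (Sup K) - f (Inf K)) else 0)"
        by (simp add: sum.distrib sum_distrib_left case_prod_beta)
      also have "(\<Sum>(x,K)\<in>p. if x \<in> N' \<and> Inf K < Sup K then norm (f (Sup K) - f (Inf K)) else 0) =
          (\<Sum>(x,K)\<in>bad. norm (f (Sup K) - f (Inf K)))"
      proof -
        have "bad = {z \<in> p. case z of (x,K) \<Rightarrow> x \<in> N' \<and> Inf K < Sup K}" by (auto simp: bad_def)
        then show ?thesis
          using sum.inter_filter[OF fin, of "\<lambda>z. norm (f (Sup (snd z)) - f (Inf (snd z)))"
            "\<lambda>(x,K). x \<in> N' \<and> Inf K < Sup K"] by (simp add: case_prod_unfold)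
      qed
      also have "(\<Sum>(x,K)\<in>p. Sup K - Inf K) = b - a"
        using additive_tagged_division_1[OF less_imp_le[OF ab] p, of "\<lambda>x. x"] by simp
      finally have "norm ((\<Sum>(x, k)\<in>p. measure lborel k *\<^sub>R g' x) - (f b - f a)) \<le>
          e / 2 * (b - a) + (\<Sum>(x,K)\<in>bad. norm (f (Sup K) - f (Inf K)))" .
      moreover have "e * measure lborel (cbox a b) = e / 2 * (b - a) + e1"
        using ab by (simp add: e1_def field_simps)
      ultimately show "norm ((\<Sum>(x, k)\<in>p. measure lborel k *\<^sub>R g' x) - (f b - f a)) \<le> e * measure lborel (cbox a b)"
        using bad_le by linarith
    qed
  qed
  then show ?thesis
    by (rule has_integral_spike[OF N', rotated]) (auto simp: g'_def)
qed

text \<open>Truncation at height \<open>n\<close>: the bounded part of \<open>norm g\<close>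
  contributes at most \<open>n\<close> times the total length, and the excess \<open>k n\<close> has
  a small integral over the whole interval for large \<open>n\<close>, by dominated
  convergence.\<close>

lemma abs_cont_on_indefinite_integral:
  fixes g :: "real \<Rightarrow> 'a::euclidean_space"
  assumes g: "g absolutely_integrable_on {a..b}"
  shows "abs_cont_on {a..b} (\<lambda>x. integral {a..x} g)"
  unfolding abs_cont_on_def
proof (intro allI impI)
  fix e :: real assume e: "e > 0"
  define k where "k = (\<lambda>n x. max (norm (g x) - real n) 0)"
  have gn: "(\<lambda>x. norm (g x)) absolutely_integrable_on {a..b}"
    by (rule absolutely_integrable_norm[OF g, unfolded comp_def])
  have k_int: "k n integrable_on {a..b}" for n
    unfolding k_def
    by (intro set_lebesgue_integral_eq_integral absolutely_integrable_max_1 set_integral_diff gn)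
      (auto intro: absolutely_integrable_on_const)
  have "(\<lambda>n. integral {a..b} (k n)) \<longlonglongrightarrow> integral {a..b} (\<lambda>x. 0)"
  proof (rule dominated_convergence(2)[OF k_int])
    show "(\<lambda>x. norm (g x)) integrable_on {a..b}" using gn by (rule set_lebesgue_integral_eq_integral)
    show "norm (k n x) \<le> norm (g x)" for n x by (auto simp: k_def)
    fix x
    obtain m :: nat where m: "norm (g x) \<le> m" using real_arch_simple by blast
    have "k n x = 0" if "n \<ge> m" for n using m that by (auto simp: k_def)
    then show "(\<lambda>n. k n x) \<longlonglongrightarrow> 0"
      by (intro tendsto_eventually eventually_sequentiallyI[of m]) auto
  qed
  then have "\<forall>\<^sub>F n in sequentially. integral {a..b} (k n) < e / 2"
    using e by (intro order_tendstoD(2)[of _ 0]) auto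
  then obtain n where n: "integral {a..b} (k n) < e / 2"
    by (meson eventually_sequentially order_refl)
  show "\<exists>d>0. \<forall>D. finite D \<and> (\<forall>(u,v)\<in>D. u \<le> v \<and> {u..v} \<subseteq> {a..b}) \<and>
        pairwise (\<lambda>(a,b) (c,d). {a<..<b} \<inter> {c<..<d} = {}) D \<and>
        (\<Sum>(u,v)\<in>D. v - u) < d \<longrightarrow>
        (\<Sum>(u,v)\<in>D. norm (integral {a..v} g - integral {a..u} g)) < e"
  proof (intro exI[of _ "e / 2 / (real n + 1)"] conjI allI impI)
    show "e / 2 / (real n + 1) > 0" using e by simp
    fix D :: "(real \<times> real) set"
    assume "finite D \<and> (\<forall>(u,v)\<in>D. u \<le> v \<and> {u..v} \<subseteq> {a..b}) \<and>
        pairwise (\<lambda>(a,b) (c,d). {a<..<b} \<inter> {c<..<d} = {}) D \<and>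
        (\<Sum>(u,v)\<in>D. v - u) < e / 2 / (real n + 1)"
    then have D: "finite D" "\<And>u v. (u,v) \<in> D \<Longrightarrow> u \<le> v \<and> {u..v} \<subseteq> {a..b}"
      "pairwise (\<lambda>(a,b) (c,d). {a<..<b} \<inter> {c<..<d} = {}) D" "(\<Sum>(u,v)\<in>D. v - u) < e / 2 / (real n + 1)"
      by blast+
    have "(\<Sum>(u,v)\<in>D. norm (integral {a..v} g - integral {a..u} g)) \<le>
        (\<Sum>(u,v)\<in>D. integral {u..v} (k n) + real n * (v - u))"
    proof (rule sum_mono, clarify)
      fix u v assume "(u,v) \<in> D"
      then have uv: "u \<le> v" "a \<le> u" "v \<le> b" using D(2)[of u v] by auto
      have sub: "{u..v} \<subseteq> {a..b}" using uv by auto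
      have gi: "g integrable_on {a..v}" "g integrable_on {u..v}"
        using set_lebesgue_integral_eq_integral(1)[OF g] uv by (auto intro!: integrable_on_subinterval[of g "{a..b}"])
      have ki: "k n integrable_on {u..v}" using k_int[of n] sub integrable_on_subinterval by blast
      have "integral {a..v} g - integral {a..u} g = integral {u..v} g"
        using Henstock_Kurzweil_Integration.integral_combine[OF uv(2,1) gi(1)] by (simp add: algebra_simps)
      also have "norm \<dots> \<le> integral {u..v} (\<lambda>x. k n x + real n)"
        by (rule Henstock_Kurzweil_Integration.integral_norm_bound_integral[OF gi(2)])
          (use ki in \<open>auto intro!: integrable_add simp: k_def\<close>)
      also have "\<dots> = integral {u..v} (k n) + real n * (v - u)"
        using ki uv by (subst Henstock_Kurzweil_Integration.integral_add) auto
      finally show "norm (integral {a..v} g - integral {a..u} g) \<le> integral {u..v} (k n) + real n * (v - u)" .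
    qed
    also have "\<dots> = (\<Sum>(u,v)\<in>D. integral {u..v} (k n)) + real n * (\<Sum>(u,v)\<in>D. v - u)"
      by (simp add: sum.distrib sum_distrib_left case_prod_beta)
    also have "\<dots> \<le> integral {a..b} (k n) + real n * (e / 2 / (real n + 1))"
      by (intro add_mono sum_integral_le_nonoverlapping k_int mult_left_mono)
        (use D in \<open>auto simp: k_def\<close>)
    also have "\<dots> < e / 2 + e / 2"
      using n e by (intro add_less_le_mono) (auto simp: field_simps)
    finally show "(\<Sum>(u,v)\<in>D. norm (integral {a..v} g - integral {a..u} g)) < e" by simp
  qed
qed

text \<open>The library's differentiability property of the indefinite integral is one-sided; it is
  applied to \<open>g\<close> and to the reflected function.\<close>

lemma has_vector_derivative_indefinite_integral_AE:
  fixes g :: "real \<Rightarrow> 'a::euclidean_space"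
  assumes g: "g integrable_on {a..b}"
  obtains N where "negligible N"
    "\<And>x. x \<in> {a<..<b} - N \<Longrightarrow> ((\<lambda>x. integral {a..x} g) has_vector_derivative g x) (at x)"
proof -
  define G where "G = (\<lambda>x. integral {a..x} g)"
  \<comment> \<open>Extension by 0, so that the function is integrable on every interval of the
    line, as the one-sided criterion demands.\<close>
  define f where "f = (\<lambda>x. if x \<in> {a..b} then g x else 0)"
  have f: "f integrable_on S" if "S = {c..d}" for S c d
  proof -
    have "f integrable_on UNIV" unfolding f_def by (subst integrable_restrict_UNIV) (rule g)
    then show ?thesis using integrable_on_subcbox[of f UNIV c d] that by simp
  qed
  obtain N1 where N1: "negligible N1" "\<And>x e. \<lbrakk>x \<notin> N1; 0 < e\<rbrakk> \<Longrightarrow>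
      \<exists>d>0. \<forall>h. 0 < h \<and> h < d \<longrightarrow> norm (integral {x..x + h} f /\<^sub>R h - f x) < e"
    using integrable_ccontinuous_explicit[of f] f by auto
  obtain N2 where N2: "negligible N2" "\<And>x e. \<lbrakk>x \<notin> N2; 0 < e\<rbrakk> \<Longrightarrow>
      \<exists>d>0. \<forall>h. 0 < h \<and> h < d \<longrightarrow> norm (integral {x..x + h} (\<lambda>x. f (-x)) /\<^sub>R h - f (-x)) < e"
  proof -
    have "(\<lambda>x. f (-x)) integrable_on {c..d}" for c d
      by (subst Henstock_Kurzweil_Integration.integrable_reflect_real[symmetric]) (simp add: f[OF refl])
    then show ?thesis using integrable_ccontinuous_explicit[of "\<lambda>x. f (-x)"] that by auto
  qed
  have Gdiff: "G v - G u = integral {u..v} f" if "a \<le> u" "u \<le> v" "v \<le> b" for u v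
  proof -
    have "integral {u..v} f = integral {u..v} g"
      using that by (intro integral_cong) (auto simp: f_def)
    moreover have "g integrable_on {a..v}" using g that integrable_on_subinterval by fastforce
    ultimately show ?thesis
      using Henstock_Kurzweil_Integration.integral_combine[of a u v g] that by (simp add: G_def algebra_simps)
  qed
  show ?thesis
  proof
    show "negligible (N1 \<union> uminus ` N2)"
      using N1 N2 by (intro negligible_Un negligible_differentiable_image_negligible) (auto intro!: derivative_intros simp: differentiable_on_def)
    fix x assume x: "x \<in> {a<..<b} - (N1 \<union> uminus ` N2)"
    then have xN: "x \<notin> N1" "- x \<notin> N2" by (auto simp: image_iff)
    have "(G has_vector_derivative g x) (at x)"
      unfolding has_vector_derivative_def has_derivative_at_alt
    proof (intro conjI allI impI)
      show "bounded_linear (\<lambda>h. h *\<^sub>R g x)" by (rule bounded_linear_scaleR_left)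
      fix e :: real assume e: "e > 0"
      obtain d1 where d1: "d1 > 0" "\<And>h. 0 < h \<Longrightarrow> h < d1 \<Longrightarrow> norm (integral {x..x + h} f /\<^sub>R h - f x) < e"
        using N1(2)[OF xN(1) e] by auto
      obtain d2 where d2: "d2 > 0" "\<And>h. 0 < h \<Longrightarrow> h < d2 \<Longrightarrow>
          norm (integral {-x..-x + h} (\<lambda>x. f (-x)) /\<^sub>R h - f x) < e"
        using N2(2)[OF xN(2) e] by auto
      have fx: "f x = g x" using x by (simp add: f_def)
      have *: "norm (I - h *\<^sub>R g x) \<le> e * h" if "h > 0" "norm (I /\<^sub>R h - f x) < e" for h I
      proof -
        have "I - h *\<^sub>R g x = h *\<^sub>R (I /\<^sub>R h - f x)" using that fx by (simp add: algebra_simps)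
        then have "norm (I - h *\<^sub>R g x) = h * norm (I /\<^sub>R h - f x)" using that by simp
        also have "\<dots> \<le> h * e" using that by (intro mult_left_mono) auto
        finally show ?thesis by (simp add: mult.commute)
      qed
      show "\<exists>d>0. \<forall>y. norm (y - x) < d \<longrightarrow> norm (G y - G x - (y - x) *\<^sub>R g x) \<le> e * norm (y - x)"
      proof (intro exI[of _ "Min {d1, d2, x - a, b - x}"] conjI allI impI)
        show "0 < Min {d1, d2, x - a, b - x}" using x d1 d2 by simp
        fix y assume y: "norm (y - x) < Min {d1, d2, x - a, b - x}"
        consider "y = x" | "y > x" | "y < x" by linarith
        then show "norm (G y - G x - (y - x) *\<^sub>R g x) \<le> e * norm (y - x)"
        proof cases
          case 2
          then have "G y - G x = integral {x..x + (y - x)} f" using y x by (subst Gdiff) auto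
          then show ?thesis using *[of "y - x" "G y - G x"] d1(2)[of "y - x"] 2 y by simp
        next
          case 3
          \<comment> \<open>A right difference quotient of the reflected function at
            \<open>-x\<close> is a left difference quotient of \<open>G\<close> at
            \<open>x\<close>.\<close>
          have "integral {-x..-x + (x - y)} (\<lambda>x. f (-x)) = integral {y..x} f"
            using Henstock_Kurzweil_Integration.integral_reflect_real[of "x" "y" f] by simp
          also have "\<dots> = G x - G y" using y x 3 by (subst Gdiff) auto
          finally have "norm (G x - G y - (x - y) *\<^sub>R g x) \<le> e * (x - y)"
            using *[of "x - y" "G x - G y"] d2(2)[of "x - y"] 3 y by simp
          moreover have "G y - G x - (y - x) *\<^sub>R g x = - (G x - G y - (x - y) *\<^sub>R g x)"
            by (simp add: algebra_simps)
          ultimately show ?thesis using 3 by (simp only: norm_minus_cancel) simp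
        qed simp
      qed
    qed
    then show "((\<lambda>x. integral {a..x} g) has_vector_derivative g x) (at x)" by (simp add: G_def)
  qed
qed

lemma abs_cont_on_subset:
  assumes "abs_cont_on S f" "T \<subseteq> S"
  shows "abs_cont_on T f"
  unfolding abs_cont_on_def
proof (intro allI impI)
  fix e :: real assume "e > 0"
  then obtain d where d: "d > 0" "\<And>D. \<lbrakk>finite D; \<And>a b. (a,b) \<in> D \<Longrightarrow> a \<le> b \<and> {a..b} \<subseteq> S;
        pairwise (\<lambda>(a,b) (c,d). {a<..<b} \<inter> {c<..<d} = {}) D; (\<Sum>(a,b)\<in>D. b - a) < d\<rbrakk>
       \<Longrightarrow> (\<Sum>(a,b)\<in>D. norm (f b - f a)) < e"
    using abs_cont_onD[OF assms(1)] by metis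
  show "\<exists>d>0. \<forall>D. finite D \<and> (\<forall>(a,b)\<in>D. a \<le> b \<and> {a..b} \<subseteq> T) \<and>
        pairwise (\<lambda>(a,b) (c,d). {a<..<b} \<inter> {c<..<d} = {}) D \<and>
        (\<Sum>(a,b)\<in>D. b - a) < d \<longrightarrow> (\<Sum>(a,b)\<in>D. norm (f b - f a)) < e"
    using d(1) assms(2) by (intro exI[of _ d] conjI allI impI d(2)) blast+
qed

section \<open>Gronwall's inequality for an integrable kernel\<close>

lemma integral_nonneg_always:
  fixes f :: "'a::euclidean_space \<Rightarrow> real"
  assumes "\<And>x. 0 \<le> f x"
  shows "0 \<le> integral S f"
  using assms by (cases "f integrable_on S") (auto simp: not_integrable_integral intro: integral_nonneg)

lemma exp_lipschitz:
  fixes u v M :: real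
  assumes "u \<le> M" "v \<le> M"
  shows "\<bar>exp v - exp u\<bar> \<le> exp M * \<bar>v - u\<bar>"
proof -
  have *: "exp y - exp x \<le> exp M * \<bar>y - x\<bar>" if "x \<le> M" "y \<le> M" for x y :: real
  proof -
    have "exp y - exp x = exp y * (1 - exp (x - y))" by (simp add: exp_diff algebra_simps)
    also have "\<dots> \<le> exp y * \<bar>y - x\<bar>"
    proof (intro mult_left_mono)
      show "1 - exp (x - y) \<le> \<bar>y - x\<bar>"
        using exp_ge_add_one_self[of "x - y"] abs_ge_self[of "y - x"] by linarith
    qed simp
    also have "\<dots> \<le> exp M * \<bar>y - x\<bar>" using that by (intro mult_right_mono) auto
    finally show ?thesis .
  qed
  show ?thesis using *[OF assms] *[OF assms(2,1)] by (auto simp: abs_if)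
qed

lemma abs_cont_on_exp:
  fixes f :: "real \<Rightarrow> real"
  assumes "abs_cont_on {a..b} f"
  shows "abs_cont_on {a..b} (\<lambda>x. exp (f x))"
proof -
  have "bounded (f ` {a..b})"
    using assms by (auto intro!: compact_imp_bounded compact_continuous_image abs_cont_on_imp_continuous_on)
  then obtain M where M: "\<And>x. x \<in> {a..b} \<Longrightarrow> \<bar>f x\<bar> \<le> M" unfolding bounded_iff by fastforce
  show ?thesis
  proof (rule abs_cont_on_lipschitz[OF assms])
    fix u v :: real assume "u \<le> v" "{u..v} \<subseteq> {a..b}"
    then have "\<bar>f u\<bar> \<le> M" "\<bar>f v\<bar> \<le> M" by (auto intro: M)
    then show "norm (exp (f v) - exp (f u)) \<le> exp M * norm (f v - f u)"
      using exp_lipschitz[of "f u" M "f v"] by auto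
  qed
qed

text \<open>The computation behind both the Gronwall bound and the contraction below: against the
  weight \<open>exp (2 K)\<close> the kernel integrates to less than half of the weight, so
  integration with \<open>k\<close> gains a factor 1/2.\<close>

lemma has_integral_exp_weight:
  fixes k :: "real \<Rightarrow> real"
  assumes k: "k absolutely_integrable_on {0..b}" and x: "x \<in> {0..b}"
  shows "((\<lambda>t. k t * exp (2 * integral {0..t} k)) has_integral (exp (2 * integral {0..x} k) - 1) / 2) {0..x}"
proof -
  let ?K = "\<lambda>t. integral {0..t} k"
  have kx: "k absolutely_integrable_on {0..x}"
    using k x by (auto intro: absolutely_integrable_on_subinterval)
  obtain N where N: "negligible N" "\<And>t. t \<in> {0<..<x} - N \<Longrightarrow> (?K has_vector_derivative k t) (at t)"
    using has_vector_derivative_indefinite_integral_AE[of k 0 x] kx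
      set_lebesgue_integral_eq_integral(1) by blast
  have "abs_cont_on {0..x} (\<lambda>t. exp (2 * ?K t))"
    by (intro abs_cont_on_exp abs_cont_on_linear[where L="\<lambda>t. 2 * t"] bounded_linear_mult_right abs_cont_on_indefinite_integral kx)
  then have "abs_cont_on {0..x} (\<lambda>t. exp (2 * ?K t) / 2)"
    by (intro abs_cont_on_linear[where L="\<lambda>t. t / 2"] bounded_linear_divide)
  then have "((\<lambda>t. k t * exp (2 * ?K t)) has_integral exp (2 * ?K x) / 2 - exp (2 * ?K 0) / 2) {0..x}"
  proof (rule fundamental_theorem_of_calculus_abs_cont[OF _ _ N(1), rotated])
    fix t assume "t \<in> {0<..<x} - N"
    then have "(?K has_real_derivative k t) (at t)"
      using N(2) by (simp add: has_real_derivative_iff_has_vector_derivative)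
    then have "((\<lambda>t. exp (2 * ?K t) / 2) has_real_derivative k t * exp (2 * ?K t)) (at t)"
      by (auto intro!: derivative_eq_intros)
    then show "((\<lambda>t. exp (2 * ?K t) / 2) has_vector_derivative k t * exp (2 * ?K t)) (at t)"
      by (simp add: has_real_derivative_iff_has_vector_derivative)
  qed (use x in auto)
  then show ?thesis by (simp add: diff_divide_distrib)
qed

text \<open>Proof by a weighted maximum: where \<open>u exp (-2 K)\<close> attains its maximum
  \<open>M\<close>, the integral term is at most \<open>M (exp (2 K x0) - 1) / 2\<close>. The
  inequality then bounds \<open>M (exp (2 K x0) + 1) / 2\<close> by \<open>c\<close>, hence
  \<open>M\<close> by \<open>c\<close>. The factor 2 in the exponent is the price for this
  shortcut.\<close>

lemma gronwall:
  fixes u k :: "real \<Rightarrow> real"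
  assumes k: "k absolutely_integrable_on {0..b}" "\<And>t. k t \<ge> 0"
    and u: "continuous_on {0..b} u" and c: "c \<ge> 0"
    and le: "\<And>x. x \<in> {0..b} \<Longrightarrow> u x \<le> c + integral {0..x} (\<lambda>t. k t * u t)"
    and int: "(\<lambda>t. k t * u t) integrable_on {0..b}"
    and x: "x \<in> {0..b}"
  shows "u x \<le> c * exp (2 * integral {0..x} k)"
proof -
  define K where "K = (\<lambda>t. integral {0..t} k)"
  have K0: "K t \<ge> 0" for t unfolding K_def by (intro integral_nonneg_always k(2)) 
  have "continuous_on {0..b} K"
    unfolding K_def using k(1) by (intro abs_cont_on_imp_continuous_on abs_cont_on_indefinite_integral)
  then have "continuous_on {0..b} (\<lambda>t. u t * exp (- (2 * K t)))"
    using u by (intro continuous_intros)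
  then obtain x0 where x0: "x0 \<in> {0..b}" "\<And>t. t \<in> {0..b} \<Longrightarrow> u t * exp (- (2 * K t)) \<le> u x0 * exp (- (2 * K x0))"
    using continuous_attains_sup[of "{0..b}" "\<lambda>t. u t * exp (- (2 * K t))"] x by auto
  define M where "M = u x0 * exp (- (2 * K x0))"
  have uM: "u t \<le> M * exp (2 * K t)" if "t \<in> {0..b}" for t
    using x0(2)[OF that] by (simp add: M_def exp_minus field_simps)
  have hi: "((\<lambda>t. k t * exp (2 * K t)) has_integral (exp (2 * K x0) - 1) / 2) {0..x0}"
    using has_integral_exp_weight[OF k(1) x0(1)] by (simp add: K_def)
  have Meq: "M * exp (2 * K x0) = u x0" by (simp add: M_def mult.assoc flip: exp_add)
  have "u x0 \<le> c + integral {0..x0} (\<lambda>t. k t * u t)" by (rule le[OF x0(1)])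
  also have "integral {0..x0} (\<lambda>t. k t * u t) \<le> integral {0..x0} (\<lambda>t. M * (k t * exp (2 * K t)))"
  proof (rule integral_le)
    show "(\<lambda>t. k t * u t) integrable_on {0..x0}"
      using int x0(1) by (auto intro: integrable_on_subinterval)
    show "(\<lambda>t. M * (k t * exp (2 * K t))) integrable_on {0..x0}"
      using has_integral_mult_right[OF hi] by blast
    fix t assume "t \<in> {0..x0}"
    then have "u t \<le> M * exp (2 * K t)" using x0(1) by (intro uM) auto
    then show "k t * u t \<le> M * (k t * exp (2 * K t))"
      using mult_left_mono[OF _ k(2)[of t]] by (metis mult.left_commute)
  qed
  also have "\<dots> = M * ((exp (2 * K x0) - 1) / 2)"
    using has_integral_mult_right[OF hi] by (rule integral_unique)
  finally have "u x0 \<le> c + M * ((exp (2 * K x0) - 1) / 2)" by (simp only: add_left_mono)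
  then have 1: "M * exp (2 * K x0) \<le> c + M * ((exp (2 * K x0) - 1) / 2)" by (simp only: Meq)
  have Mc: "M \<le> c"
  proof (rule ccontr)
    assume "\<not> M \<le> c"
    then have "M > c" "M > 0" using c by auto
    have "exp (2 * K x0) \<ge> 1" using K0 by simp
    then have "M * ((exp (2 * K x0) + 1) / 2) \<ge> M * 1" using \<open>M > 0\<close> by (intro mult_left_mono) auto
    with 1 \<open>M > c\<close> show False by (simp add: field_simps)
  qed
  then have "M * exp (2 * K x) \<le> c * exp (2 * K x)" by (intro mult_right_mono) auto
  with uM[OF x] show ?thesis unfolding K_def by (rule order_trans)
qed

section \<open>Linear differential systems with integrable coefficients\<close>

text \<open>Caratheodory setting: the coefficient is controlled by an integrable function only,
  without continuity or boundedness in \<open>x\<close>. Measurability is asked along continuous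
  functions, the only arguments that a solution supplies.\<close>

locale linear_ode =
  fixes b :: real and A :: "real \<Rightarrow> 'w::euclidean_space \<Rightarrow> 'w" and k :: "real \<Rightarrow> real"
  assumes b: "0 \<le> b"
    and linear_A: "linear (A x)"
    and A_bound: "norm (A x w) \<le> k x * norm w"
    and k_int: "k absolutely_integrable_on {0..b}"
    and k_nonneg: "0 \<le> k x"
    and A_meas: "continuous_on {0..b} y \<Longrightarrow> (\<lambda>x. A x (y x)) \<in> borel_measurable (lebesgue_on {0..b})"
begin

text \<open>The integral equation serves as definition because a fixed point delivers it and the
  Gronwall bound consumes it; \<open>is_sol_iff\<close> translates it into the almost-everywhere
  form.\<close>

definition is_sol :: "(real \<Rightarrow> 'w) \<Rightarrow> 'w \<Rightarrow> (real \<Rightarrow> 'w) \<Rightarrow> bool" where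
  "is_sol g w0 w \<longleftrightarrow> continuous_on {0..b} w \<and>
     (\<forall>x\<in>{0..b}. w x = w0 + integral {0..x} (\<lambda>t. A t (w t) + g t))"

lemma absolutely_integrable_A:
  assumes w: "continuous_on {0..b} w"
  shows "(\<lambda>x. A x (w x)) absolutely_integrable_on {0..b}"
proof -
  have "bounded (w ` {0..b})"
    using w by (auto intro!: compact_imp_bounded compact_continuous_image)
  then obtain M where M: "\<And>x. x \<in> {0..b} \<Longrightarrow> norm (w x) \<le> M" unfolding bounded_iff by fastforce
  show ?thesis
  proof (rule measurable_bounded_by_integrable_imp_absolutely_integrable[OF A_meas[OF w]])
    show "(\<lambda>x. k x * M) integrable_on {0..b}"
      using set_lebesgue_integral_eq_integral(1)[OF k_int] by (rule integrable_on_mult_left)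
    fix x assume "x \<in> {0..b}"
    then show "norm (A x (w x)) \<le> k x * M"
      using A_bound[of x "w x"] mult_left_mono[OF M k_nonneg] order_trans by blast
  qed auto
qed

lemma norm_integral_A_le:
  assumes w: "continuous_on {0..b} w" and x: "x \<in> {0..b}"
  shows "norm (integral {0..x} (\<lambda>t. A t (w t))) \<le> integral {0..x} (\<lambda>t. k t * norm (w t))"
    and "(\<lambda>t. k t * norm (w t)) integrable_on {0..b}"
proof -
  have wi: "(\<lambda>t. k t * norm (w t)) absolutely_integrable_on {0..b}"
  proof -
    have "(\<lambda>t. norm (w t) * k t) absolutely_integrable_on {0..b}"
    proof (rule absolutely_integrable_bounded_measurable_product_real)
      show "(\<lambda>t. norm (w t)) \<in> borel_measurable (lebesgue_on {0..b})"
        using w by (intro continuous_imp_measurable_on_sets_lebesgue continuous_intros) auto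
      show "bounded ((\<lambda>t. norm (w t)) ` {0..b})"
        using w by (auto intro!: compact_imp_bounded compact_continuous_image continuous_intros)
    qed (use k_int in auto)
    then show ?thesis by (simp add: mult.commute)
  qed
  then show "(\<lambda>t. k t * norm (w t)) integrable_on {0..b}" by (rule set_lebesgue_integral_eq_integral)
  have "(\<lambda>t. A t (w t)) integrable_on {0..x}"
    using set_lebesgue_integral_eq_integral(1)[OF absolutely_integrable_A[OF w]] x
    by (auto intro: integrable_on_subinterval)
  then show "norm (integral {0..x} (\<lambda>t. A t (w t))) \<le> integral {0..x} (\<lambda>t. k t * norm (w t))"
    using set_lebesgue_integral_eq_integral(1)[OF wi] x A_bound
    by (intro Henstock_Kurzweil_Integration.integral_norm_bound_integral) (auto intro: integrable_on_subinterval)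
qed

lemma integral_A_add:
  assumes "continuous_on {0..b} w" "g absolutely_integrable_on {0..b}" "x \<in> {0..b}"
  shows "integral {0..x} (\<lambda>t. A t (w t) + g t) = integral {0..x} (\<lambda>t. A t (w t)) + integral {0..x} g"
proof -
  have "(\<lambda>t. A t (w t)) integrable_on {0..x}" "g integrable_on {0..x}"
    using set_lebesgue_integral_eq_integral(1)[OF absolutely_integrable_A[OF assms(1)]]
      set_lebesgue_integral_eq_integral(1)[OF assms(2)] assms(3)
    by (auto intro: integrable_on_subinterval)
  then show ?thesis by (rule Henstock_Kurzweil_Integration.integral_add)
qed

lemma norm_integral_le:
  fixes g :: "real \<Rightarrow> 'w"
  assumes g: "g absolutely_integrable_on {0..b}" and x: "x \<in> {0..b}"
  shows "norm (integral {0..x} g) \<le> integral {0..b} (\<lambda>t. norm (g t))"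
proof -
  have gi: "g integrable_on {0..b}" "(\<lambda>t. norm (g t)) integrable_on {0..b}"
    using g unfolding absolutely_integrable_on_def by auto
  have sub: "g integrable_on {0..x}" "(\<lambda>t. norm (g t)) integrable_on {0..x}"
    using gi x by (auto intro: integrable_on_subinterval)
  have "norm (integral {0..x} g) \<le> integral {0..x} (\<lambda>t. norm (g t))"
    by (rule Henstock_Kurzweil_Integration.integral_norm_bound_integral[OF sub]) auto
  also have "\<dots> \<le> integral {0..b} (\<lambda>t. norm (g t))"
    using x sub gi by (intro integral_subset_le) auto
  finally show ?thesis .
qed

text \<open>A priori bound. Applied to differences of solutions it gives uniqueness as well as
  continuous dependence on initial values, force and spectral parameter.\<close>

lemma is_sol_norm_le:
  assumes w: "is_sol g w0 w" and g: "g absolutely_integrable_on {0..b}" and x: "x \<in> {0..b}"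
  shows "norm (w x) \<le> (norm w0 + integral {0..b} (\<lambda>t. norm (g t))) * exp (2 * integral {0..b} k)"
proof -
  let ?c = "norm w0 + integral {0..b} (\<lambda>t. norm (g t))"
  have cont: "continuous_on {0..b} w" and eq: "\<And>x. x \<in> {0..b} \<Longrightarrow> w x = w0 + integral {0..x} (\<lambda>t. A t (w t) + g t)"
    using w by (auto simp: is_sol_def)
  have c: "?c \<ge> 0" by (intro add_nonneg_nonneg integral_nonneg_always) auto
  have "norm (w x) \<le> ?c * exp (2 * integral {0..x} k)"
  proof (rule gronwall[OF k_int k_nonneg _ c _ _ x, where u="\<lambda>x. norm (w x)"])
    show "continuous_on {0..b} (\<lambda>x. norm (w x))" using cont by (rule continuous_on_norm)
    show "(\<lambda>t. k t * norm (w t)) integrable_on {0..b}" by (rule norm_integral_A_le(2)[OF cont x])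
    fix x assume x: "x \<in> {0..b}"
    have "w x = w0 + (integral {0..x} (\<lambda>t. A t (w t)) + integral {0..x} g)"
      using eq[OF x] integral_A_add[OF cont g x] by simp
    also have "norm \<dots> \<le> norm w0 + (norm (integral {0..x} (\<lambda>t. A t (w t))) + norm (integral {0..x} g))"
      by (meson add_left_mono norm_triangle_ineq order_trans)
    also have "\<dots> \<le> norm w0 + (integral {0..x} (\<lambda>t. k t * norm (w t)) + integral {0..b} (\<lambda>t. norm (g t)))"
      using norm_integral_A_le(1)[OF cont x] norm_integral_le[OF g x] by simp
    finally show "norm (w x) \<le> ?c + integral {0..x} (\<lambda>t. k t * norm (w t))" by simp
  qed
  also have "integral {0..x} k \<le> integral {0..b} k"
    using x k_nonneg set_lebesgue_integral_eq_integral(1)[OF k_int]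
    by (intro integral_subset_le) (auto intro: integrable_on_subinterval)
  then have "?c * exp (2 * integral {0..x} k) \<le> ?c * exp (2 * integral {0..b} k)"
    using c by (intro mult_left_mono) auto
  finally show ?thesis .
qed

lemma is_sol_diff:
  assumes w: "is_sol g w0 w" "is_sol h v0 v"
    and g: "g absolutely_integrable_on {0..b}" "h absolutely_integrable_on {0..b}"
  shows "is_sol (\<lambda>t. g t - h t) (w0 - v0) (\<lambda>x. w x - v x)"
  unfolding is_sol_def
proof (intro conjI ballI)
  have c: "continuous_on {0..b} w" "continuous_on {0..b} v" using w by (auto simp: is_sol_def)
  then show "continuous_on {0..b} (\<lambda>x. w x - v x)" by (rule continuous_on_diff)
  fix x assume x: "x \<in> {0..b}"
  have i: "(\<lambda>t. A t (w t) + g t) integrable_on {0..x}" "(\<lambda>t. A t (v t) + h t) integrable_on {0..x}"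
  proof -
    have "(\<lambda>t. A t (w t) + g t) integrable_on {0..b}" "(\<lambda>t. A t (v t) + h t) integrable_on {0..b}"
      by (intro set_lebesgue_integral_eq_integral(1) set_integral_add absolutely_integrable_A c g)+
    then show "(\<lambda>t. A t (w t) + g t) integrable_on {0..x}" "(\<lambda>t. A t (v t) + h t) integrable_on {0..x}"
      using x by (auto intro: integrable_on_subinterval)
  qed
  have "(\<lambda>t. A t (w t - v t) + (g t - h t)) = (\<lambda>t. (A t (w t) + g t) - (A t (v t) + h t))"
    by (simp add: linear_diff[OF linear_A] algebra_simps)
  then have "integral {0..x} (\<lambda>t. A t (w t - v t) + (g t - h t)) =
      integral {0..x} (\<lambda>t. A t (w t) + g t) - integral {0..x} (\<lambda>t. A t (v t) + h t)"
    using Henstock_Kurzweil_Integration.integral_diff[OF i] by simp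
  then show "w x - v x = w0 - v0 + integral {0..x} (\<lambda>t. A t (w t - v t) + (g t - h t))"
    using w x by (simp add: is_sol_def)
qed

lemma is_sol_unique:
  assumes "is_sol g w0 w" "is_sol g w0 v" "g absolutely_integrable_on {0..b}" "x \<in> {0..b}"
  shows "w x = v x"
proof -
  have "is_sol (\<lambda>t. 0) 0 (\<lambda>x. w x - v x)"
    using is_sol_diff[OF assms(1,2,3,3)] by simp
  from is_sol_norm_le[OF this _ assms(4)] show ?thesis by simp
qed

text \<open>Picard iteration with the weight \<open>exp (2 K)\<close> divided out. The weighted norm
  thereby becomes the ordinary sup norm of bounded continuous functions, and the integral operator
  contracts by 1/2 on the whole interval at once, so no gluing of local solutions occurs.\<close>

lemma is_sol_exists:
  assumes g: "g absolutely_integrable_on {0..b}"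
  shows "\<exists>w. is_sol g w0 w"
proof -
  define K where "K = (\<lambda>t. integral {0..t} k)"
  have K0: "K t \<ge> 0" for t unfolding K_def by (intro integral_nonneg_always k_nonneg) 
  have contK: "continuous_on {0..b} K"
    unfolding K_def using k_int by (intro abs_cont_on_imp_continuous_on abs_cont_on_indefinite_integral)
  \<comment> \<open>\<open>W\<close> restores the weight: the unknown \<open>z\<close> of the fixed
    point equation is the solution multiplied by \<open>exp (-2 K)\<close>.\<close>
  define W where "W = (\<lambda>(z::real \<Rightarrow>\<^sub>C 'w) t. exp (2 * K t) *\<^sub>R z t)"
  have contW: "continuous_on {0..b} (W z)" for z
    unfolding W_def by (intro continuous_intros contK) auto
  define h where "h = (\<lambda>z x. exp (- (2 * K x)) *\<^sub>R (w0 + integral {0..x} (\<lambda>t. A t (W z t) + g t)))"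
  have conth: "continuous_on (cbox 0 b) (h z)" for z
  proof -
    have "continuous_on {0..b} (\<lambda>x. integral {0..x} (\<lambda>t. A t (W z t) + g t))"
      by (intro abs_cont_on_imp_continuous_on abs_cont_on_indefinite_integral set_integral_add absolutely_integrable_A contW g)
    then show ?thesis unfolding h_def by (auto intro!: continuous_intros contK)
  qed
  \<comment> \<open>Bounded continuous functions live on the whole line; clamping extends a function
    from the interval by its boundary values.\<close>
  define T where "T = (\<lambda>z. Bcontfun (\<lambda>x. h z (clamp 0 b x)))"
  have clamp: "clamp 0 b x \<in> {0..b}" for x :: real using clamp_in_interval[of 0 b x] b by auto
  have T: "T z x = h z (clamp 0 b x)" for z x
    unfolding T_def
  proof (subst Bcontfun_inverse)
    have "bounded (h z ` cbox 0 b)"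
      using conth by (intro compact_imp_bounded compact_continuous_image) auto
    then obtain M where "\<And>x. x \<in> cbox 0 b \<Longrightarrow> norm (h z x) \<le> M" unfolding bounded_iff by fastforce
    then show "(\<lambda>x. h z (clamp 0 b x)) \<in> bcontfun"
      using clamp by (intro bcontfun_normI[of _ M] clamp_continuous_on conth) auto
  qed simp
  have "\<exists>!z. T z = z"
  proof (rule banach_fix_type[of "1/2"])
    show "\<forall>z y. dist (T z) (T y) \<le> 1 / 2 * dist z y"
    proof (intro allI dist_bound)
      fix z y :: "real \<Rightarrow>\<^sub>C 'w" and x0 :: real
      define x where "x = clamp 0 b x0"
      have x: "x \<in> {0..b}" using clamp by (simp add: x_def)
      have hw: "((\<lambda>t. dist z y * (k t * exp (2 * K t))) has_integral dist z y * ((exp (2 * K x) - 1) / 2)) {0..x}"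
        unfolding K_def by (intro has_integral_mult_right has_integral_exp_weight[OF k_int x])
      have cd: "continuous_on {0..b} (\<lambda>t. W z t - W y t)" by (intro continuous_intros contW)
      have "integral {0..x} (\<lambda>t. A t (W z t) + g t) - integral {0..x} (\<lambda>t. A t (W y t) + g t)
          = integral {0..x} (\<lambda>t. A t (W z t - W y t))"
      proof -
        have "(\<lambda>t. A t (W z t)) integrable_on {0..x}" "(\<lambda>t. A t (W y t)) integrable_on {0..x}"
          by (rule integrable_on_subinterval[OF set_lebesgue_integral_eq_integral(1)[OF absolutely_integrable_A[OF contW]]];
            use x in auto)+
        then show ?thesis
          using Henstock_Kurzweil_Integration.integral_diff[of "\<lambda>t. A t (W z t)" "{0..x}" "\<lambda>t. A t (W y t)"]
          by (simp add: integral_A_add[OF contW g x] linear_diff[OF linear_A])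
      qed
      then have "h z x - h y x = exp (- (2 * K x)) *\<^sub>R integral {0..x} (\<lambda>t. A t (W z t - W y t))"
        unfolding h_def by (simp only: scaleR_diff_right[symmetric] add_diff_cancel_left)
      then have "norm (h z x - h y x) \<le> exp (- (2 * K x)) * norm (integral {0..x} (\<lambda>t. A t (W z t - W y t)))"
        by simp
      also have "norm (integral {0..x} (\<lambda>t. A t (W z t - W y t))) \<le> integral {0..x} (\<lambda>t. k t * norm (W z t - W y t))"
        by (rule norm_integral_A_le(1)[OF cd x])
      also have "\<dots> \<le> integral {0..x} (\<lambda>t. dist z y * (k t * exp (2 * K t)))"
      proof (rule integral_le)
        show "(\<lambda>t. k t * norm (W z t - W y t)) integrable_on {0..x}"
          using norm_integral_A_le(2)[OF cd x] x by (auto intro: integrable_on_subinterval)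
        show "(\<lambda>t. dist z y * (k t * exp (2 * K t))) integrable_on {0..x}" using hw by blast
        fix t
        have "norm (W z t - W y t) = exp (2 * K t) * dist (z t) (y t)"
          by (simp add: W_def dist_norm flip: scaleR_diff_right)
        also have "\<dots> \<le> exp (2 * K t) * dist z y" by (intro mult_left_mono dist_bounded) auto
        finally have "k t * norm (W z t - W y t) \<le> k t * (exp (2 * K t) * dist z y)"
          by (intro mult_left_mono k_nonneg)
        then show "k t * norm (W z t - W y t) \<le> dist z y * (k t * exp (2 * K t))" by (simp add: mult_ac)
      qed
      also have "\<dots> = dist z y * ((exp (2 * K x) - 1) / 2)" using hw by (rule integral_unique)
      also have "exp (- (2 * K x)) * (dist z y * ((exp (2 * K x) - 1) / 2)) =
          dist z y * ((1 - exp (- (2 * K x))) / 2)" by (simp add: exp_minus field_simps)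
      also have "\<dots> \<le> dist z y * (1 / 2)" by (intro mult_left_mono) auto
      finally show "dist (T z x0) (T y x0) \<le> 1 / 2 * dist z y"
        by (simp add: T dist_norm x_def)
    qed
  qed auto
  then obtain z where z: "T z = z" by auto
  have "is_sol g w0 (W z)"
    unfolding is_sol_def
  proof (intro conjI contW ballI)
    fix x assume x: "x \<in> {0..b}"
    then have "z x = h z x" using T[of z x] z by simp
    then have "W z x = exp (2 * K x) *\<^sub>R h z x" unfolding W_def by simp
    then show "W z x = w0 + integral {0..x} (\<lambda>t. A t (W z t) + g t)"
      by (simp add: h_def exp_minus)
  qed
  then show ?thesis by blast
qed

text \<open>One direction is differentiability of indefinite integrals almost everywhere, the other
  the fundamental theorem. Absolute continuity is essential there, since derivatives almost
  everywhere alone do not determine a continuous function.\<close>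

lemma is_sol_iff:
  assumes g: "g absolutely_integrable_on {0..b}"
  shows "is_sol g w0 w \<longleftrightarrow> abs_cont_on {0..b} w \<and> w 0 = w0 \<and>
    (AE x in lebesgue_on {0<..<b}. (w has_vector_derivative A x (w x) + g x) (at x))"
proof (intro iffI conjI; (elim conjE)?)
  assume s: "is_sol g w0 w"
  then have cont: "continuous_on {0..b} w" and eq: "\<And>x. x \<in> {0..b} \<Longrightarrow> w x = w0 + integral {0..x} (\<lambda>t. A t (w t) + g t)"
    by (auto simp: is_sol_def)
  have abs: "(\<lambda>t. A t (w t) + g t) absolutely_integrable_on {0..b}"
    by (intro set_integral_add absolutely_integrable_A cont g)
  have "abs_cont_on {0..b} (\<lambda>x. w0 + integral {0..x} (\<lambda>t. A t (w t) + g t))"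
    by (intro abs_cont_on_add abs_cont_on_const abs_cont_on_indefinite_integral abs)
  then show "abs_cont_on {0..b} w"
    by (rule abs_cont_on_lipschitz[where C=1]) (use eq in \<open>auto simp: subset_iff\<close>)
  show "w 0 = w0" using eq[of 0] b by simp
  obtain N where N: "negligible N" "\<And>x. x \<in> {0<..<b} - N \<Longrightarrow>
      ((\<lambda>x. integral {0..x} (\<lambda>t. A t (w t) + g t)) has_vector_derivative A x (w x) + g x) (at x)"
    using has_vector_derivative_indefinite_integral_AE[OF set_lebesgue_integral_eq_integral(1)[OF abs]] by metis
  have "(w has_vector_derivative A x (w x) + g x) (at x)" if x: "x \<in> {0<..<b} - N" for x
  proof -
    have "((\<lambda>x. w0 + integral {0..x} (\<lambda>t. A t (w t) + g t)) has_vector_derivative 0 + (A x (w x) + g x)) (at x)"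
      by (intro has_vector_derivative_add N(2)[OF x]) simp
    then have "((\<lambda>x. w0 + integral {0..x} (\<lambda>t. A t (w t) + g t)) has_vector_derivative A x (w x) + g x) (at x)"
      by simp
    then show ?thesis
      by (rule has_vector_derivative_transform_within_open[where S="{0<..<b}"]) (use x eq in auto)
  qed
  then have "{x \<in> {0<..<b}. \<not> (w has_vector_derivative A x (w x) + g x) (at x)} \<subseteq> N" by blast
  then show "AE x in lebesgue_on {0<..<b}. (w has_vector_derivative A x (w x) + g x) (at x)"
    using N(1) negligible_subset by (subst AE_lebesgue_on_iff_negligible) auto
next
  assume ac: "abs_cont_on {0..b} w" and w0: "w 0 = w0"
    and ae: "AE x in lebesgue_on {0<..<b}. (w has_vector_derivative A x (w x) + g x) (at x)"
  have neg: "negligible {x \<in> {0<..<b}. \<not> (w has_vector_derivative A x (w x) + g x) (at x)}" (is "negligible ?N")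
    using ae by (subst (asm) AE_lebesgue_on_iff_negligible) auto
  show "is_sol g w0 w"
    unfolding is_sol_def
  proof (intro conjI ballI)
    show "continuous_on {0..b} w" by (rule abs_cont_on_imp_continuous_on[OF ac])
    fix x assume x: "x \<in> {0..b}"
    have "((\<lambda>t. A t (w t) + g t) has_integral (w x - w 0)) {0..x}"
    proof (rule fundamental_theorem_of_calculus_abs_cont[OF _ _ neg])
      show "abs_cont_on {0..x} w"
        by (rule abs_cont_on_subset[OF ac]) (use x in auto)
    qed (use x in auto)
    then show "w x = w0 + integral {0..x} (\<lambda>t. A t (w t) + g t)"
      using w0 by (simp add: integral_unique)
  qed
qed

end

section \<open>The Hilbert space \<open>L\<^sub>2\<close> modulo null functions\<close>

lemma norm_vec_sq: "(norm v)\<^sup>2 = (\<Sum>i\<in>UNIV. (cmod (v $ i))\<^sup>2)"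
  for v :: "complex^'m"
  by (simp add: norm_vec_def L2_set_def sum_nonneg)

lemma cinner_same: "cinner v v = of_real ((norm v)\<^sup>2)"
  by (simp add: cinner_def norm_vec_sq complex_norm_square del: of_real_power)

lemma cinner_commute: "cinner w v = cnj (cinner v w)"
  by (simp add: cinner_def mult.commute)

lemma cinner_add_left: "cinner (u + v) w = cinner u w + cinner v w"
  by (simp add: cinner_def algebra_simps sum.distrib)

lemma cinner_add_right: "cinner w (u + v) = cinner w u + cinner w v"
  by (simp add: cinner_def algebra_simps sum.distrib)

lemma cinner_scale_left: "cinner (c *s v) w = c * cinner v w"
  by (simp add: cinner_def sum_distrib_left mult.assoc)

lemma cinner_scale_right: "cinner w (c *s v) = cnj c * cinner w v"
  by (simp add: cinner_def sum_distrib_left mult_ac)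

lemma cinner_zero [simp]: "cinner 0 w = 0" "cinner w 0 = 0"
  by (simp_all add: cinner_def)

lemma cinner_minus_left: "cinner (- v) w = - cinner v w"
  by (simp add: cinner_def sum_negf)

lemma cinner_minus_right: "cinner w (- v) = - cinner w v"
  by (simp add: cinner_def sum_negf)

lemma cinner_diff_left: "cinner (u - v) w = cinner u w - cinner v w"
  by (simp add: cinner_def algebra_simps sum_subtractf)

lemma cinner_diff_right: "cinner w (u - v) = cinner w u - cinner w v"
  by (simp add: cinner_def algebra_simps sum_subtractf)

lemma norm_cinner_le: "cmod (cinner v w) \<le> norm v * norm w"
proof -
  have "cmod (cinner v w) \<le> (\<Sum>i\<in>UNIV. \<bar>cmod (v $ i)\<bar> * \<bar>cmod (w $ i)\<bar>)"
    unfolding cinner_def by (rule order_trans[OF norm_sum]) (simp add: norm_mult)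
  also have "\<dots> \<le> norm v * norm w"
    unfolding norm_vec_def by (rule L2_set_mult_ineq)
  finally show ?thesis .
qed

lemma bounded_bilinear_cinner: "bounded_bilinear (cinner :: complex^'m \<Rightarrow> complex^'m \<Rightarrow> complex)"
proof
  show "cinner (r *\<^sub>R a) b = r *\<^sub>R cinner a b" "cinner a (r *\<^sub>R b) = r *\<^sub>R cinner a b"
    for r and a b :: "complex^'m"
    by (simp_all add: cinner_def scaleR_sum_right)
  show "\<exists>K. \<forall>a b. cmod (cinner a b) \<le> norm (a::complex^'m) * norm b * K"
    using norm_cinner_le by (intro exI[of _ 1]) auto
qed (simp_all add: cinner_add_left cinner_add_right)

lemma finite_measure_leb_pi: "finite_measure leb_pi"
  by (rule finite_measure_lebesgue_on) auto

lemma integrable_leb_pi_const [simp]: "integrable leb_pi (\<lambda>x. c :: 'a::{banach,second_countable_topology})"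
  by (rule finite_measure.integrable_const[OF finite_measure_leb_pi])

lemma norm_add_sq_le: "(norm (a + b))\<^sup>2 \<le> 2 * (norm a)\<^sup>2 + 2 * (norm b)\<^sup>2"
proof -
  have "(norm (a + b))\<^sup>2 \<le> (norm a + norm b)\<^sup>2"
    by (intro power_mono norm_triangle_ineq) auto
  also have "\<dots> \<le> 2 * (norm a)\<^sup>2 + 2 * (norm b)\<^sup>2"
    using sum_squares_bound[of "norm a" "norm b"] by (simp add: power2_sum)
  finally show ?thesis .
qed

lemma norm_scale_vec: "norm (c *s v) = cmod c * norm v" for v :: "complex^'m"
proof -
  have "(norm (c *s v))\<^sup>2 = (cmod c * norm v)\<^sup>2"
    by (simp add: norm_vec_sq norm_mult power_mult_distrib sum_distrib_left)
  then show ?thesis by simp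
qed

lemma linear_vec_scale: "bounded_linear (\<lambda>v. c *s (v :: complex^'m))"
proof
  show "c *s (r *\<^sub>R v) = r *\<^sub>R (c *s v)" for r and v :: "complex^'m"
    by (simp add: vec_eq_iff)
  show "\<exists>K. \<forall>v::complex^'m. norm (c *s v) \<le> norm v * K"
    by (auto simp: norm_scale_vec mult.commute)
qed (simp add: vec.scale_right_distrib)

lemma L2_fun_add:
  assumes "L2_fun f" "L2_fun g"
  shows "L2_fun (f + g)"
  unfolding L2_fun_def
proof
  show m: "f + g \<in> borel_measurable leb_pi"
    using assms unfolding L2_fun_def plus_fun_def by (intro borel_measurable_add) auto
  show "integrable leb_pi (\<lambda>x. (norm ((f + g) x))\<^sup>2)"
  proof (rule Bochner_Integration.integrable_bound)
    show "integrable leb_pi (\<lambda>x. 2 * (norm (f x))\<^sup>2 + 2 * (norm (g x))\<^sup>2)"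
      using assms by (auto simp: L2_fun_def)
    show "(\<lambda>x. (norm ((f + g) x))\<^sup>2) \<in> borel_measurable leb_pi"
      using m by measurable
  qed (auto intro: norm_add_sq_le)
qed

lemma L2_fun_linear:
  assumes "bounded_linear L" "L2_fun f"
  shows "L2_fun (\<lambda>x. L (f x))"
proof -
  interpret bounded_linear L by fact
  obtain K where K: "\<And>x. norm (L x) \<le> norm x * K" using bounded by auto
  have cont: "continuous_on UNIV L" by (simp add: linear_continuous_on assms(1))
  have m: "(\<lambda>x. L (f x)) \<in> borel_measurable leb_pi"
    using assms(2) borel_measurable_continuous_onI[OF cont] unfolding L2_fun_def
    by (auto intro: measurable_compose)
  have "integrable leb_pi (\<lambda>x. (norm (L (f x)))\<^sup>2)"
  proof (rule Bochner_Integration.integrable_bound)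
    show "integrable leb_pi (\<lambda>x. K\<^sup>2 * (norm (f x))\<^sup>2)"
      using assms(2) by (auto simp: L2_fun_def)
    show "(\<lambda>x. (norm (L (f x)))\<^sup>2) \<in> borel_measurable leb_pi"
      using m by measurable
    have "(norm (L (f x)))\<^sup>2 \<le> (norm (f x) * K)\<^sup>2" for x by (intro power_mono K) auto
    then show "AE x in leb_pi. norm ((norm (L (f x)))\<^sup>2) \<le> norm (K\<^sup>2 * (norm (f x))\<^sup>2)"
      by (simp add: power_mult_distrib mult.commute)
  qed
  with m show ?thesis by (simp add: L2_fun_def)
qed

lemma L2_fun_scale: "L2_fun f \<Longrightarrow> L2_fun (fun_scale c f)"
  unfolding fun_scale_def by (rule L2_fun_linear[OF linear_vec_scale])

lemma L2_fun_zero: "L2_fun 0"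
  by (simp add: L2_fun_def zero_fun_def)

lemma L2_fun_diff: "L2_fun f \<Longrightarrow> L2_fun g \<Longrightarrow> L2_fun (f - g)"
proof -
  assume "L2_fun f" "L2_fun g"
  then have "L2_fun (f + (\<lambda>x. - g x))"
    by (intro L2_fun_add L2_fun_linear[of uminus]) (auto intro: bounded_linear_minus bounded_linear_ident)
  then show ?thesis by (simp add: plus_fun_def fun_diff_def)
qed

lemma L2_fun_sum: "(\<And>k. k \<in> S \<Longrightarrow> L2_fun (f k)) \<Longrightarrow> L2_fun (\<Sum>k\<in>S. f k)"
  by (induction S rule: infinite_finite_induct) (auto intro: L2_fun_add L2_fun_zero)

lemmas L2_fun_intros = L2_fun_add L2_fun_scale L2_fun_zero L2_fun_diff L2_fun_sum

lemma L2_inner_integrable: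
  assumes "L2_fun f" "L2_fun g"
  shows "integrable leb_pi (\<lambda>x. cinner (f x) (g x))"
proof (rule Bochner_Integration.integrable_bound)
  show "integrable leb_pi (\<lambda>x. (norm (f x))\<^sup>2 + (norm (g x))\<^sup>2)"
    using assms by (auto simp: L2_fun_def)
  have "continuous_on UNIV (\<lambda>p::(complex^'a)\<times>(complex^'a). cinner (fst p) (snd p))"
    by (intro bounded_bilinear.continuous_on[OF bounded_bilinear_cinner] continuous_intros)
  then show "(\<lambda>x. cinner (f x) (g x)) \<in> borel_measurable leb_pi"
    using assms borel_measurable_continuous_Pair[of f leb_pi g cinner] by (auto simp: L2_fun_def case_prod_beta)
  have "cmod (cinner (f x) (g x)) \<le> (norm (f x))\<^sup>2 + (norm (g x))\<^sup>2" for x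
  proof -
    have "2 * (norm (f x) * norm (g x)) \<le> (norm (f x))\<^sup>2 + (norm (g x))\<^sup>2"
      using sum_squares_bound[of "norm (f x)" "norm (g x)"] by (simp add: mult.assoc)
    moreover have "0 \<le> norm (f x) * norm (g x)" by simp
    ultimately show ?thesis using norm_cinner_le[of "f x" "g x"] by linarith
  qed
  then show "AE x in leb_pi. norm (cinner (f x) (g x)) \<le> norm ((norm (f x))\<^sup>2 + (norm (g x))\<^sup>2)" by simp
qed

lemma L2_inner_commute: "L2_inner g f = cnj (L2_inner f g)"
  unfolding L2_inner_def by (subst cinner_commute) simp

lemma L2_inner_add_left:
  "L2_fun f \<Longrightarrow> L2_fun g \<Longrightarrow> L2_fun h \<Longrightarrow> L2_inner (f + g) h = L2_inner f h + L2_inner g h"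
  unfolding L2_inner_def by (simp add: cinner_add_left L2_inner_integrable)

lemma L2_inner_diff_left:
  "L2_fun f \<Longrightarrow> L2_fun g \<Longrightarrow> L2_fun h \<Longrightarrow> L2_inner (f - g) h = L2_inner f h - L2_inner g h"
  unfolding L2_inner_def by (simp add: cinner_diff_left L2_inner_integrable)

lemma L2_inner_scale_left: "L2_inner (fun_scale c f) h = c * L2_inner f h"
  unfolding L2_inner_def fun_scale_def by (simp add: cinner_scale_left)

lemma L2_inner_scale_right: "L2_inner h (fun_scale c f) = cnj c * L2_inner h f"
  unfolding L2_inner_def fun_scale_def by (simp add: cinner_scale_right)

lemma L2_inner_zero [simp]: "L2_inner 0 h = 0" "L2_inner h 0 = 0"
  unfolding L2_inner_def by simp_all

lemma L2_inner_sum_left: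
  assumes "\<And>k. k \<in> S \<Longrightarrow> L2_fun (f k)" "L2_fun h"
  shows "L2_inner (\<Sum>k\<in>S. f k) h = (\<Sum>k\<in>S. L2_inner (f k) h)"
  using assms(1)
  by (induction S rule: infinite_finite_induct) (auto simp: L2_inner_add_left L2_fun_sum assms(2))

lemma L2_inner_sum_right:
  assumes "\<And>k. k \<in> S \<Longrightarrow> L2_fun (f k)" "L2_fun h"
  shows "L2_inner h (\<Sum>k\<in>S. f k) = (\<Sum>k\<in>S. L2_inner h (f k))"
proof -
  have "L2_inner h (\<Sum>k\<in>S. f k) = cnj (\<Sum>k\<in>S. L2_inner (f k) h)"
    using L2_inner_sum_left[of S f h] assms by (subst L2_inner_commute) simp
  also have "\<dots> = (\<Sum>k\<in>S. L2_inner h (f k))"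
    unfolding cnj_sum by (intro sum.cong refl L2_inner_commute[symmetric])
  finally show ?thesis .
qed

lemma L2_norm_nonneg [simp]: "0 \<le> L2_norm f"
  unfolding L2_norm_def by (intro real_sqrt_ge_zero integral_nonneg_AE) auto

lemma L2_norm_sq: "(L2_norm f)\<^sup>2 = (LINT x|leb_pi. (norm (f x))\<^sup>2)"
  unfolding L2_norm_def by (intro real_sqrt_pow2 integral_nonneg_AE) auto

lemma L2_inner_same: "L2_inner f f = of_real ((L2_norm f)\<^sup>2)"
  unfolding L2_norm_sq L2_inner_def by (simp add: cinner_same flip: of_real_power)

lemma L2_norm_add_sq:
  assumes "L2_fun f" "L2_fun g"
  shows "(L2_norm (f + g))\<^sup>2 = (L2_norm f)\<^sup>2 + 2 * Re (L2_inner f g) + (L2_norm g)\<^sup>2"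
proof -
  have "L2_inner (f + g) (f + g) = L2_inner f (f + g) + L2_inner g (f + g)"
    by (intro L2_inner_add_left L2_fun_intros assms)
  also have "L2_inner f (f + g) = cnj (L2_inner f f + L2_inner g f)"
    using assms by (subst L2_inner_commute) (simp add: L2_inner_add_left)
  also have "L2_inner g (f + g) = cnj (L2_inner f g + L2_inner g g)"
    using assms by (subst L2_inner_commute) (simp add: L2_inner_add_left)
  finally have "complex_of_real ((L2_norm (f + g))\<^sup>2) =
      cnj (L2_inner f f + L2_inner g f) + cnj (L2_inner f g + L2_inner g g)"
    unfolding L2_inner_same .
  then have "Re (complex_of_real ((L2_norm (f + g))\<^sup>2)) =
      Re (cnj (L2_inner f f + L2_inner g f) + cnj (L2_inner f g + L2_inner g g))" by simp
  then show ?thesis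
    by (simp add: L2_inner_same L2_inner_commute[of g f] del: of_real_power)
qed

lemma L2_norm_scale: "L2_norm (fun_scale c f) = cmod c * L2_norm f"
proof -
  have "complex_of_real ((L2_norm (fun_scale c f))\<^sup>2) = of_real ((cmod c * L2_norm f)\<^sup>2)"
    unfolding L2_inner_same[symmetric] L2_inner_scale_left L2_inner_scale_right
    by (simp add: L2_inner_same power_mult_distrib complex_norm_square[of c] mult_ac flip: of_real_power)
  then have "(L2_norm (fun_scale c f))\<^sup>2 = (cmod c * L2_norm f)\<^sup>2" by (simp only: of_real_eq_iff)
  then show ?thesis by simp
qed

lemma L2_norm_zero [simp]: "L2_norm 0 = 0"
  by (simp add: L2_norm_def)

text \<open>The optimal weight is \<open>s = b / a\<close>. Both numbers are shifted by a small
  \<open>d\<close> so that the quotient exists and is positive even if one of them vanishes.\<close>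

lemma le_mult_from_weighted:
  fixes X a b :: real
  assumes "a \<ge> 0" "b \<ge> 0" "\<And>s. s > 0 \<Longrightarrow> 2 * X \<le> s * a\<^sup>2 + b\<^sup>2 / s"
  shows "X \<le> a * b"
proof (rule field_le_epsilon)
  fix e :: real assume e: "e > 0"
  \<comment> \<open>Chosen so that the excess \<open>d (a + b + d)\<close> of the shifted product
    over \<open>a b\<close> stays below \<open>e\<close>.\<close>
  define d where "d = min 1 (e / (a + b + 1))"
  have d: "d > 0" "d \<le> 1" "d * (a + b + 1) \<le> e"
  proof -
    show "d > 0" "d \<le> 1" using e assms by (auto simp: d_def)
    have "d \<le> e / (a + b + 1)" by (simp add: d_def)
    then show "d * (a + b + 1) \<le> e" using assms(1,2) by (simp add: pos_le_divide_eq)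
  qed
  have pos: "a + d > 0" "b + d > 0" using assms d by linarith+
  define s where "s = (b + d) / (a + d)"
  have s: "s > 0" using pos by (simp add: s_def)
  have "s * a\<^sup>2 \<le> s * (a + d)\<^sup>2" using s assms(1) d by (intro mult_left_mono power_mono) auto
  also have "\<dots> = (b + d) * (a + d)" using pos by (simp add: s_def power2_eq_square)
  finally have 1: "s * a\<^sup>2 \<le> (b + d) * (a + d)" .
  have "b\<^sup>2 / s \<le> (b + d)\<^sup>2 / s" using s assms(2) d by (intro divide_right_mono power_mono) auto
  also have "\<dots> = (b + d) * (a + d)" using pos by (simp add: s_def power2_eq_square)
  finally have 2: "b\<^sup>2 / s \<le> (b + d) * (a + d)" .
  have "2 * X \<le> s * a\<^sup>2 + b\<^sup>2 / s" by (rule assms(3)[OF s])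
  with 1 2 have "X \<le> (b + d) * (a + d)" by linarith
  also have "\<dots> = a * b + d * (a + b + d)" by (simp add: algebra_simps)
  also have "d * (a + b + d) \<le> d * (a + b + 1)" using d by (intro mult_left_mono) auto
  finally show "X \<le> a * b + e" using d by linarith
qed

text \<open>The pointwise weighted inequality is integrated for every weight. This avoids
  normalizing the functions, whose seminorms may be 0.\<close>

lemma L2_Cauchy_Schwarz:
  assumes f: "L2_fun f" and g: "L2_fun g"
  shows "cmod (L2_inner f g) \<le> L2_norm f * L2_norm g"
proof (rule le_mult_from_weighted)
  fix s :: real assume s: "s > 0"
  have fi: "integrable leb_pi (\<lambda>x. (norm (f x))\<^sup>2)" and gi: "integrable leb_pi (\<lambda>x. (norm (g x))\<^sup>2)"
    using f g by (auto simp: L2_fun_def)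
  have "2 * cmod (L2_inner f g) \<le> 2 * (LINT x|leb_pi. cmod (cinner (f x) (g x)))"
    unfolding L2_inner_def by (intro mult_left_mono integral_norm_bound) auto
  also have "\<dots> = (LINT x|leb_pi. 2 * cmod (cinner (f x) (g x)))" by simp
  also have "\<dots> \<le> (LINT x|leb_pi. s * (norm (f x))\<^sup>2 + (norm (g x))\<^sup>2 / s)"
  proof (rule integral_mono)
    show "integrable leb_pi (\<lambda>x. 2 * cmod (cinner (f x) (g x)))"
      using L2_inner_integrable[OF f g] by auto
    show "integrable leb_pi (\<lambda>x. s * (norm (f x))\<^sup>2 + (norm (g x))\<^sup>2 / s)" using fi gi by auto
    fix x
    have "2 * (norm (f x) * norm (g x)) \<le> s * (norm (f x))\<^sup>2 + (norm (g x))\<^sup>2 / s"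
    proof -
      have "0 \<le> (s * norm (f x) - norm (g x))\<^sup>2 / s" using s by simp
      also have "\<dots> = s * (norm (f x))\<^sup>2 + (norm (g x))\<^sup>2 / s - 2 * (norm (f x) * norm (g x))"
        using s by (simp add: field_simps power2_eq_square)
      finally show ?thesis by simp
    qed
    then show "2 * cmod (cinner (f x) (g x)) \<le> s * (norm (f x))\<^sup>2 + (norm (g x))\<^sup>2 / s"
      using norm_cinner_le[of "f x" "g x"] by linarith
  qed
  also have "\<dots> = s * (L2_norm f)\<^sup>2 + (L2_norm g)\<^sup>2 / s"
    unfolding L2_norm_sq using fi gi by simp
  finally show "2 * cmod (L2_inner f g) \<le> s * (L2_norm f)\<^sup>2 + (L2_norm g)\<^sup>2 / s" .
qed auto

lemma L2_norm_triangle: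
  assumes "L2_fun f" "L2_fun g"
  shows "L2_norm (f + g) \<le> L2_norm f + L2_norm g"
proof (rule power2_le_imp_le)
  have "Re (L2_inner f g) \<le> L2_norm f * L2_norm g"
    by (rule order_trans[OF complex_Re_le_cmod L2_Cauchy_Schwarz[OF assms]])
  then show "(L2_norm (f + g))\<^sup>2 \<le> (L2_norm f + L2_norm g)\<^sup>2"
    unfolding L2_norm_add_sq[OF assms] by (simp add: power2_sum)
qed simp

lemma L2_norm_minus: "L2_norm (- f) = L2_norm f"
  by (simp add: L2_norm_def)

lemma L2_norm_minus_commute: "L2_norm (f - g) = L2_norm (g - f)"
  by (subst L2_norm_minus[symmetric]) (simp only: minus_diff_eq)

lemma L2_norm_triangle_diff:
  assumes "L2_fun f" "L2_fun g" "L2_fun h"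
  shows "L2_norm (f - h) \<le> L2_norm (f - g) + L2_norm (g - h)"
proof -
  have "L2_norm ((f - g) + (g - h)) \<le> L2_norm (f - g) + L2_norm (g - h)"
    by (rule L2_norm_triangle[OF L2_fun_diff[OF assms(1,2)] L2_fun_diff[OF assms(2,3)]])
  moreover have "(f - g) + (g - h) = f - h" by simp
  ultimately show ?thesis by (simp only:)
qed

lemma L2_norm_diff_le:
  assumes "L2_fun f" "L2_fun g"
  shows "\<bar>L2_norm f - L2_norm g\<bar> \<le> L2_norm (f - g)"
proof -
  have "L2_norm f - L2_norm g \<le> L2_norm (f - g)" if "L2_fun f" "L2_fun g"
    for f g :: "real \<Rightarrow> complex^'a"
  proof -
    have "L2_norm ((f - g) + g) \<le> L2_norm (f - g) + L2_norm g"
      by (rule L2_norm_triangle[OF L2_fun_diff[OF that] that(2)])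
    moreover have "(f - g) + g = f" by simp
    ultimately show ?thesis by (simp only:)
  qed
  from this[OF assms] this[OF assms(2,1)] L2_norm_minus_commute[of f g] show ?thesis
    by linarith
qed

lemma L2_eq_iff_norm:
  assumes "L2_fun f" "L2_fun g"
  shows "L2_eq f g \<longleftrightarrow> L2_norm (f - g) = 0"
proof -
  have "L2_fun (f - g)" by (rule L2_fun_diff[OF assms])
  then have "integrable leb_pi (\<lambda>x. (norm ((f - g) x))\<^sup>2)" by (simp add: L2_fun_def)
  then have "(LINT x|leb_pi. (norm ((f - g) x))\<^sup>2) = 0 \<longleftrightarrow> (AE x in leb_pi. (norm ((f - g) x))\<^sup>2 = 0)"
    by (rule integral_nonneg_eq_0_iff_AE) auto
  then show ?thesis unfolding L2_norm_def L2_eq_def by simp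
qed

text \<open>Riesz-Fischer: along a subsequence with increments below \<open>2^-k\<close> the
  increments are summable in \<open>L\<^sub>1\<close>, which gives a limit almost everywhere.
  Fatou's lemma then turns pointwise convergence into convergence of the whole sequence in
  norm.\<close>

lemma L2_complete:
  fixes f :: "nat \<Rightarrow> real \<Rightarrow> complex^'m"
  assumes f: "\<And>n. L2_fun (f n)"
    and cauchy: "\<And>e. e > 0 \<Longrightarrow> \<exists>N. \<forall>m\<ge>N. \<forall>n\<ge>N. L2_norm (f m - f n) < e"
  obtains g where "L2_fun g" "(\<lambda>n. L2_norm (f n - g)) \<longlonglongrightarrow> 0"
proof -
  have "\<exists>r :: nat \<Rightarrow> nat. \<forall>k. (\<forall>m\<ge>r k. \<forall>n\<ge>r k. L2_norm (f m - f n) < (1/2)^k) \<and> r k < r (Suc k)"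
  proof (rule dependent_nat_choice)
    show "\<exists>x. \<forall>m\<ge>x. \<forall>n\<ge>x. L2_norm (f m - f n) < (1/2)^0" using cauchy[of 1] by simp
    fix x k
    obtain N where "\<forall>m\<ge>N. \<forall>n\<ge>N. L2_norm (f m - f n) < (1/2)^Suc k"
      using cauchy[of "(1/2)^Suc k"] by auto
    then show "\<exists>y. (\<forall>m\<ge>y. \<forall>n\<ge>y. L2_norm (f m - f n) < (1/2)^Suc k) \<and> x < y"
      by (intro exI[of _ "max N (Suc x)"]) auto
  qed
  then obtain r where r: "\<And>k m n. m \<ge> r k \<Longrightarrow> n \<ge> r k \<Longrightarrow> L2_norm (f m - f n) < (1/2)^k" "\<And>k. r k < r (Suc k)"
    by blast
  have smr: "strict_mono r" using r(2) by (rule strict_monoI_Suc)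
  define h where "h = (\<lambda>k. f (r (Suc k)) - f (r k))"
  have hL: "L2_fun (h k)" for k unfolding h_def by (intro L2_fun_intros f)
  have hn: "L2_norm (h k) < (1/2)^k" for k
    unfolding h_def using smr by (intro r(1)) (auto simp: strict_mono_less_eq)
  have meas_f [measurable]: "f n \<in> borel_measurable leb_pi" for n using f by (auto simp: L2_fun_def)
  have meas_h [measurable]: "h n \<in> borel_measurable leb_pi" for n using hL by (auto simp: L2_fun_def)
  have h2: "integrable leb_pi (\<lambda>x. (norm (h k x))\<^sup>2)" for k using hL[of k] by (auto simp: L2_fun_def)
  \<comment> \<open>The weight \<open>2^k\<close> balances the squared norm, at most
    \<open>4^-k\<close> after integration, against the constant term, so that the integrals of
    \<open>norm (h k x)\<close> decay geometrically.\<close>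
  have wle: "norm (h k x) \<le> 2^k * (norm (h k x))\<^sup>2 + (1/2)^k" for k x
  proof -
    have "2 * norm (h k x) * ((1/2)^k) \<le> (norm (h k x))\<^sup>2 + ((1/2)^k)\<^sup>2"
      by (rule sum_squares_bound)
    then have "2^k * (2 * norm (h k x) * ((1/2)^k)) \<le> 2^k * ((norm (h k x))\<^sup>2 + ((1/2)^k)\<^sup>2)"
      by (rule mult_left_mono) simp
    then have "2 * norm (h k x) \<le> 2^k * (norm (h k x))\<^sup>2 + (1/2)^k"
      by (simp add: power_divide algebra_simps power2_eq_square)
    then show ?thesis using norm_ge_zero[of "h k x"] by linarith
  qed
  have hint: "integrable leb_pi (\<lambda>x. norm (h k x))" for k
    by (rule Bochner_Integration.integrable_bound[of _ "\<lambda>x. 2^k * (norm (h k x))\<^sup>2 + (1/2)^k"])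
      (use h2[of k] wle[of k] in \<open>auto intro!: AE_I2 order_trans[OF wle]\<close>)
  have hI: "(LINT x|leb_pi. norm (h k x)) \<le> (1 + pi) * (1/2)^k" for k
  proof -
    have "(LINT x|leb_pi. norm (h k x)) \<le> (LINT x|leb_pi. 2^k * (norm (h k x))\<^sup>2 + (1/2)^k)"
      using h2[of k] by (intro integral_mono hint wle) auto
    also have "\<dots> = 2^k * (L2_norm (h k))\<^sup>2 + (1/2)^k * pi"
      using h2[of k] by (simp add: L2_norm_sq measure_restrict_space mult.commute)
    also have "2^k * (L2_norm (h k))\<^sup>2 \<le> 2^k * ((1/2)^k)\<^sup>2"
      using hn[of k] by (intro mult_left_mono power_mono) auto
    also have "\<dots> = (1/2 :: real)^k" by (simp add: power2_eq_square power_divide)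
    finally show ?thesis by (simp add: algebra_simps)
  qed
  have "(\<integral>\<^sup>+x. (\<Sum>k. ennreal (norm (h k x))) \<partial>leb_pi) = (\<Sum>k. \<integral>\<^sup>+x. ennreal (norm (h k x)) \<partial>leb_pi)"
    by (rule nn_integral_suminf) measurable
  also have "\<dots> = (\<Sum>k. ennreal (LINT x|leb_pi. norm (h k x)))"
    by (subst nn_integral_eq_integral[OF hint]) auto
  also have "\<dots> \<noteq> top"
  proof (rule ennreal_suminf_neq_top)
    show "summable (\<lambda>k. LINT x|leb_pi. norm (h k x))"
      by (rule summable_comparison_test'[of "\<lambda>k. (1 + pi) * (1/2)^k" 0])
        (use hI in \<open>auto intro!: summable_mult summable_geometric integral_nonneg_AE\<close>)
  qed (auto intro: integral_nonneg_AE)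
  finally have "AE x in leb_pi. (\<Sum>k. ennreal (norm (h k x))) \<noteq> \<infinity>"
    by (intro nn_integral_PInf_AE) auto
  then have conv: "AE x in leb_pi. (\<lambda>k. f (r k) x) \<longlonglongrightarrow> lim (\<lambda>k. f (r k) x)"
  proof eventually_elim
    case (elim x)
    then have "summable (\<lambda>k. norm (h k x))" by (intro summable_suminf_not_top) auto
    then have "summable (\<lambda>k. h k x)" by (rule summable_norm_cancel)
    then have "convergent (\<lambda>n. \<Sum>k<n. h k x)" by (simp add: summable_iff_convergent)
    moreover have "(\<Sum>k<n. h k x) = f (r n) x - f (r 0) x" for n
      unfolding h_def using sum_lessThan_telescope[of "\<lambda>k. f (r k) x" n] by simp
    ultimately have "convergent (\<lambda>n. f (r n) x - f (r 0) x)" by simp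
    then have "convergent (\<lambda>n. (f (r n) x - f (r 0) x) + f (r 0) x)"
      by (intro convergent_add convergent_const)
    then show ?case by (simp add: convergent_LIMSEQ_iff)
  qed
  define g where "g = (\<lambda>x. lim (\<lambda>k. f (r k) x))"
  have meas_g [measurable]: "g \<in> borel_measurable leb_pi" unfolding g_def by measurable
  \<comment> \<open>Fatou's lemma in the index \<open>j\<close>, with \<open>n\<close> kept fixed.
    The bound is a nonnegative integral, so membership of \<open>f n - g\<close> in the space
    follows from it.\<close>
  have main: "(\<integral>\<^sup>+x. ennreal ((norm (f n x - g x))\<^sup>2) \<partial>leb_pi) \<le> ennreal (((1/2)^k)\<^sup>2)" if n: "n \<ge> r k" for n k
  proof -
    have "(\<integral>\<^sup>+x. ennreal ((norm (f n x - g x))\<^sup>2) \<partial>leb_pi) =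
        (\<integral>\<^sup>+x. liminf (\<lambda>j. ennreal ((norm (f n x - f (r j) x))\<^sup>2)) \<partial>leb_pi)"
    proof (rule nn_integral_cong_AE)
      show "AE x in leb_pi. ennreal ((norm (f n x - g x))\<^sup>2) =
          liminf (\<lambda>j. ennreal ((norm (f n x - f (r j) x))\<^sup>2))"
        using conv
      proof eventually_elim
        case (elim x)
        then have "(\<lambda>j. ennreal ((norm (f n x - f (r j) x))\<^sup>2)) \<longlonglongrightarrow> ennreal ((norm (f n x - g x))\<^sup>2)"
          unfolding g_def by (intro tendsto_intros) auto
        then show ?case by (intro lim_imp_Liminf[symmetric]) auto
      qed
    qed
    also have "\<dots> \<le> liminf (\<lambda>j. \<integral>\<^sup>+x. ennreal ((norm (f n x - f (r j) x))\<^sup>2) \<partial>leb_pi)"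
      by (rule nn_integral_liminf) measurable
    also have "\<dots> \<le> limsup (\<lambda>j. \<integral>\<^sup>+x. ennreal ((norm (f n x - f (r j) x))\<^sup>2) \<partial>leb_pi)"
      by (rule Liminf_le_Limsup) auto
    also have "\<dots> \<le> ennreal (((1/2)^k)\<^sup>2)"
    proof (rule Limsup_bounded, rule eventually_sequentiallyI[of k])
      fix j assume j: "j \<ge> k"
      have L: "L2_fun (f n - f (r j))" by (intro L2_fun_intros f)
      have "(\<integral>\<^sup>+x. ennreal ((norm (f n x - f (r j) x))\<^sup>2) \<partial>leb_pi) = ennreal ((L2_norm (f n - f (r j)))\<^sup>2)"
        unfolding L2_norm_sq using L by (subst nn_integral_eq_integral) (auto simp: L2_fun_def)
      also have "\<dots> \<le> ennreal (((1/2)^k)\<^sup>2)"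
      proof (intro ennreal_leI power_mono)
        have "r k \<le> r j" using smr j by (simp add: strict_mono_less_eq)
        then show "L2_norm (f n - f (r j)) \<le> (1/2)^k" using r(1)[of k n "r j"] n by simp
      qed simp
      finally show "(\<integral>\<^sup>+x. ennreal ((norm (f n x - f (r j) x))\<^sup>2) \<partial>leb_pi) \<le> ennreal (((1/2)^k)\<^sup>2)" .
    qed
    finally show ?thesis .
  qed
  have dL: "L2_fun (f n - g)" if "n \<ge> r 0" for n
    unfolding L2_fun_def
  proof
    show "f n - g \<in> borel_measurable leb_pi" unfolding fun_diff_def by measurable
    show "integrable leb_pi (\<lambda>x. (norm ((f n - g) x))\<^sup>2)"
    proof (rule integrableI_nonneg)
      show "(\<integral>\<^sup>+x. ennreal ((norm ((f n - g) x))\<^sup>2) \<partial>leb_pi) < \<infinity>"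
        using main[OF that] by (simp add: order_le_less_trans)
    qed auto
  qed
  have gL: "L2_fun g"
    using L2_fun_diff[OF f[of "r 0"] dL[of "r 0"]] by simp
  show ?thesis
  proof (rule that[OF gL])
    show "(\<lambda>n. L2_norm (f n - g)) \<longlonglongrightarrow> 0"
    proof (rule LIMSEQ_I)
      fix e :: real assume "e > 0"
      then obtain k where k: "(1/2)^k < e" using real_arch_pow_inv[of e "1/2"] by auto
      have "L2_norm (f n - g) < e" if n: "n \<ge> r k" for n
      proof -
        have "n \<ge> r 0" using n smr by (meson le0 order_trans strict_mono_less_eq)
        then have L: "L2_fun (f n - g)" by (rule dL)
        have "ennreal ((L2_norm (f n - g))\<^sup>2) \<le> ennreal (((1/2)^k)\<^sup>2)"
          unfolding L2_norm_sq using main[OF n] L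
          by (subst nn_integral_eq_integral[symmetric]) (auto simp: L2_fun_def)
        then have "(L2_norm (f n - g))\<^sup>2 \<le> ((1/2)^k)\<^sup>2" by (simp add: ennreal_le_iff)
        then have "L2_norm (f n - g) \<le> (1/2)^k" by (rule power2_le_imp_le) simp
        with k show ?thesis by simp
      qed
      then show "\<exists>no. \<forall>n\<ge>no. norm (L2_norm (f n - g) - 0) < e" by auto
    qed
  qed
qed

lemma sum_fun_apply: "(\<Sum>k\<in>S. g k) x = (\<Sum>k\<in>S. g k x)"
  by (induction S rule: infinite_finite_induct) (auto simp: zero_fun_def plus_fun_def)

interpretation fun_scale: vector_space "fun_scale :: complex \<Rightarrow> (real \<Rightarrow> complex^'m) \<Rightarrow> (real \<Rightarrow> complex^'m)"
  by (rule vector_space_fun_scale)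

lemma L2_limit_unique:
  assumes "\<And>n. L2_fun (t n)" "L2_fun g" "L2_fun h"
    and "(\<lambda>n. L2_norm (t n - g)) \<longlonglongrightarrow> 0" "(\<lambda>n. L2_norm (t n - h)) \<longlonglongrightarrow> 0"
  shows "L2_norm (g - h) = 0"
proof -
  have "(\<lambda>n. L2_norm (t n - g) + L2_norm (t n - h)) \<longlonglongrightarrow> 0 + 0"
    by (intro tendsto_add assms)
  moreover have "L2_norm (g - h) \<le> L2_norm (t n - g) + L2_norm (t n - h)" for n
    using L2_norm_triangle_diff[OF assms(2,1,3), of n] L2_norm_minus_commute[of g "t n"] by simp
  ultimately have "L2_norm (g - h) \<le> 0 + 0" by (intro LIMSEQ_le_const) auto
  then show ?thesis using L2_norm_nonneg[of "g - h"] by linarith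
qed

lemma L2_norm_tendsto:
  assumes "\<And>n. L2_fun (t n)" "L2_fun g" "(\<lambda>n. L2_norm (t n - g)) \<longlonglongrightarrow> 0"
  shows "(\<lambda>n. L2_norm (t n)) \<longlonglongrightarrow> L2_norm g"
proof -
  have "(\<lambda>n. L2_norm (t n) - L2_norm g) \<longlonglongrightarrow> 0"
    by (rule Lim_null_comparison[OF _ assms(3)]) (use L2_norm_diff_le[OF assms(1,2)] in auto)
  then show ?thesis by (rule LIM_zero_cancel)
qed

lemma L2_inner_tendsto:
  assumes "\<And>n. L2_fun (t n)" "L2_fun g" "L2_fun h" "(\<lambda>n. L2_norm (t n - g)) \<longlonglongrightarrow> 0"
  shows "(\<lambda>n. L2_inner (t n) h) \<longlonglongrightarrow> L2_inner g h"
proof -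
  have "(\<lambda>n. L2_inner (t n) h - L2_inner g h) \<longlonglongrightarrow> 0"
  proof (rule Lim_null_comparison)
    show "(\<lambda>n. L2_norm (t n - g) * L2_norm h) \<longlonglongrightarrow> 0"
      by (intro tendsto_mult_left_zero assms)
    have "norm (L2_inner (t n) h - L2_inner g h) \<le> L2_norm (t n - g) * L2_norm h" for n
      using L2_Cauchy_Schwarz[OF L2_fun_diff[OF assms(1)[of n] assms(2)] assms(3)]
      by (simp add: L2_inner_diff_left assms)
    then show "\<forall>\<^sub>F n in sequentially. norm (L2_inner (t n) h - L2_inner g h) \<le> L2_norm (t n - g) * L2_norm h"
      by simp
  qed
  then show ?thesis by (rule LIM_zero_cancel)
qed

text \<open>The upper bound for partial sums also controls blocks of the series, so summability of
  the squared coefficients makes the partial sums Cauchy.\<close>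

lemma L2_series_converges:
  fixes G :: "nat \<Rightarrow> real \<Rightarrow> complex^'m"
  assumes G: "\<And>k. L2_fun (G k)"
    and upper: "\<And>a n. (L2_norm (\<Sum>k<n. fun_scale (a k) (G k)))\<^sup>2 \<le> C * (\<Sum>k<n. (cmod (a k))\<^sup>2)"
    and a: "summable (\<lambda>k. (cmod (a k))\<^sup>2)"
  obtains g where "L2_fun g" "(\<lambda>n. L2_norm ((\<Sum>k<n. fun_scale (a k) (G k)) - g)) \<longlonglongrightarrow> 0"
proof -
  let ?D = "\<lambda>n. \<Sum>k<n. fun_scale (a k) (G k)"
  have DL: "L2_fun (?D n)" for n by (intro L2_fun_sum L2_fun_scale G)
  have diff: "(L2_norm (?D n - ?D m))\<^sup>2 \<le> \<bar>C\<bar> * (\<Sum>k=m..<n. (cmod (a k))\<^sup>2)" if "m \<le> n" for m n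
  proof -
    \<comment> \<open>Coefficients below \<open>m\<close> are set to 0, so that a block from
      \<open>m\<close> to \<open>n\<close> is itself an initial sum to which \<open>upper\<close>
      applies.\<close>
    let ?b = "\<lambda>k. if k < m then 0 else a k"
    have split: "{..<n} = {..<m} \<union> {m..<n}" using that by auto
    have 1: "?D n - ?D m = (\<Sum>k=m..<n. fun_scale (a k) (G k))"
      unfolding split by (subst sum.union_disjoint) auto
    have 2: "(\<Sum>k<n. fun_scale (?b k) (G k)) = (\<Sum>k=m..<n. fun_scale (a k) (G k))"
      unfolding split by (subst sum.union_disjoint) auto
    have 3: "(\<Sum>k<n. (cmod (?b k))\<^sup>2) = (\<Sum>k=m..<n. (cmod (a k))\<^sup>2)"
      unfolding split by (subst sum.union_disjoint) auto
    have "(L2_norm (?D n - ?D m))\<^sup>2 \<le> C * (\<Sum>k=m..<n. (cmod (a k))\<^sup>2)"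
      using upper[where a="?b" and n=n] unfolding 1 2 3 .
    also have "\<dots> \<le> \<bar>C\<bar> * (\<Sum>k=m..<n. (cmod (a k))\<^sup>2)"
      by (intro mult_right_mono sum_nonneg) auto
    finally show ?thesis .
  qed
  have "\<exists>N. \<forall>m\<ge>N. \<forall>n\<ge>N. L2_norm (?D m - ?D n) < e" if e: "e > 0" for e
  proof -
    obtain N where N: "\<And>m n. m \<ge> N \<Longrightarrow> norm (\<Sum>k=m..<n. (cmod (a k))\<^sup>2) < e\<^sup>2 / (\<bar>C\<bar> + 1)"
      using a[unfolded summable_Cauchy, rule_format, of "e\<^sup>2 / (\<bar>C\<bar> + 1)"] e by auto
    have *: "L2_norm (?D n - ?D m) < e" if "m \<ge> N" "m \<le> n" for m n
    proof (rule power2_less_imp_less)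
      let ?s = "\<Sum>k=m..<n. (cmod (a k))\<^sup>2"
      have s: "0 \<le> ?s" by (intro sum_nonneg) auto
      have "(L2_norm (?D n - ?D m))\<^sup>2 \<le> \<bar>C\<bar> * ?s" by (rule diff[OF that(2)])
      also have "\<dots> \<le> (\<bar>C\<bar> + 1) * ?s" using s by (intro mult_right_mono) auto
      also have "\<dots> < (\<bar>C\<bar> + 1) * (e\<^sup>2 / (\<bar>C\<bar> + 1))"
        using N[OF that(1), of n] s by (intro mult_strict_left_mono) auto
      finally show "(L2_norm (?D n - ?D m))\<^sup>2 < e\<^sup>2" by simp
    qed (use e in auto)
    show ?thesis
    proof (intro exI[of _ N] allI impI)
      fix m n assume "N \<le> m" "N \<le> n"
      then show "L2_norm (?D m - ?D n) < e"
        using *[of n m] *[of m n] L2_norm_minus_commute[of "?D m" "?D n"] by (cases "n \<le> m") auto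
    qed
  qed
  then show ?thesis using L2_complete[of ?D] DL that by blast
qed

section \<open>Riesz bases\<close>

text \<open>The classical characterization of a Riesz basis: two-sided bounds for finite sums,
  uniform in \<open>n\<close>, together with totality. Indexing by \<open>nat\<close> lets
  Gram-Schmidt recurse and lets initial segments exhaust the family.\<close>

locale riesz_system =
  fixes F :: "nat \<Rightarrow> real \<Rightarrow> complex^'m" and c C :: real
  assumes F_L2: "L2_fun (F n)" and c_pos: "0 < c"
    and lower: "c * (\<Sum>k<n. (cmod (a k))\<^sup>2) \<le> (L2_norm (\<Sum>k<n. fun_scale (a k) (F k)))\<^sup>2"
    and upper: "(L2_norm (\<Sum>k<n. fun_scale (a k) (F k)))\<^sup>2 \<le> C * (\<Sum>k<n. (cmod (a k))\<^sup>2)"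
    and total: "L2_fun f \<Longrightarrow> (\<And>n. L2_inner f (F n) = 0) \<Longrightarrow> L2_norm f = 0"
begin

text \<open>Gram-Schmidt applied to \<open>F\<close>. It provides the orthonormal basis that is to
  be mapped to \<open>F\<close>; its totality is inherited because every \<open>F n\<close> lies in
  the span of the \<open>e k\<close>.\<close>

fun e :: "nat \<Rightarrow> real \<Rightarrow> complex^'m" where
  "e n = (let g = F n - (\<Sum>k<n. fun_scale (L2_inner (F n) (e k)) (e k))
    in fun_scale (of_real (1 / L2_norm g)) g)"

declare e.simps [simp del]

definition g where "g n = F n - (\<Sum>k<n. fun_scale (L2_inner (F n) (e k)) (e k))"

lemma e_eq: "e n = fun_scale (of_real (1 / L2_norm (g n))) (g n)"
  by (subst e.simps) (simp add: g_def Let_def)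

definition spanF :: "nat \<Rightarrow> (real \<Rightarrow> complex^'m) \<Rightarrow> bool" where
  "spanF n f \<longleftrightarrow> (\<exists>a. f = (\<Sum>k<n. fun_scale (a k) (F k)))"

lemma spanF_zero: "spanF n 0"
  unfolding spanF_def by (intro exI[of _ "\<lambda>_. 0"]) simp

lemma spanF_add: "spanF n f \<Longrightarrow> spanF n h \<Longrightarrow> spanF n (f + h)"
  unfolding spanF_def
proof (elim exE)
  fix a b assume "f = (\<Sum>k<n. fun_scale (a k) (F k))" "h = (\<Sum>k<n. fun_scale (b k) (F k))"
  then show "\<exists>a. f + h = (\<Sum>k<n. fun_scale (a k) (F k))"
    by (intro exI[of _ "\<lambda>k. a k + b k"]) (simp add: fun_scale.scale_left_distrib sum.distrib)
qed

lemma spanF_scale: "spanF n f \<Longrightarrow> spanF n (fun_scale s f)"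
  unfolding spanF_def
proof (elim exE)
  fix a assume "f = (\<Sum>k<n. fun_scale (a k) (F k))"
  then show "\<exists>a. fun_scale s f = (\<Sum>k<n. fun_scale (a k) (F k))"
    by (intro exI[of _ "\<lambda>k. s * a k"]) (simp add: fun_scale.scale_sum_right)
qed

lemma spanF_sum: "(\<And>k. k \<in> S \<Longrightarrow> spanF n (f k)) \<Longrightarrow> spanF n (\<Sum>k\<in>S. f k)"
  by (induction S rule: infinite_finite_induct) (auto intro: spanF_zero spanF_add)

lemma spanF_mono:
  assumes "spanF n f" "n \<le> m"
  shows "spanF m f"
proof -
  obtain a where a: "f = (\<Sum>k<n. fun_scale (a k) (F k))" using assms(1) by (auto simp: spanF_def)
  have "f = (\<Sum>k<m. fun_scale (if k < n then a k else 0) (F k))"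
    unfolding a using assms(2) by (intro sum.mono_neutral_cong_left) auto
  then show ?thesis unfolding spanF_def by (rule exI[of _ "\<lambda>k. if k < n then a k else 0"])
qed

text \<open>The normalization never divides by 0: \<open>F n\<close> enters \<open>g n\<close> with
  coefficient 1, so \<open>lower\<close> bounds the squared norm of \<open>g n\<close> below by
  \<open>c\<close>.\<close>

lemma g_eq:
  assumes "\<And>k. k < n \<Longrightarrow> spanF (Suc k) (e k)"
  shows "spanF (Suc n) (g n) \<and> L2_norm (g n) > 0"
proof -
  have "spanF n (\<Sum>k<n. fun_scale (L2_inner (F n) (e k)) (e k))"
    by (intro spanF_sum spanF_scale spanF_mono[OF assms]) auto
  then obtain a where a: "(\<Sum>k<n. fun_scale (L2_inner (F n) (e k)) (e k)) = (\<Sum>k<n. fun_scale (a k) (F k))"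
    unfolding spanF_def by blast
  define b where "b = (\<lambda>k. if k < n then - a k else 1)"
  have gb: "g n = (\<Sum>k<Suc n. fun_scale (b k) (F k))"
    unfolding g_def a b_def by (simp add: fun_scale.scale_minus_left sum_negf)
  have "c * 1 \<le> c * (\<Sum>k<Suc n. (cmod (b k))\<^sup>2)"
    using c_pos by (intro mult_left_mono) (auto simp: b_def intro: sum_nonneg)
  also have "\<dots> \<le> (L2_norm (g n))\<^sup>2" unfolding gb by (rule lower)
  finally have "L2_norm (g n) \<noteq> 0" using c_pos by auto
  then have "L2_norm (g n) > 0" using L2_norm_nonneg[of "g n"] by linarith
  with gb show ?thesis unfolding spanF_def by blast
qed

lemma e_spanF: "spanF (Suc n) (e n)"
proof (induction n rule: less_induct)
  case (less n)
  then show ?case unfolding e_eq[of n] using g_eq[of n] by (intro spanF_scale) blast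
qed

lemma g_pos: "L2_norm (g n) > 0" using g_eq e_spanF by blast

lemma spanF_L2: "spanF n f \<Longrightarrow> L2_fun f"
  unfolding spanF_def by (auto intro!: L2_fun_sum L2_fun_scale F_L2)

lemma e_L2: "L2_fun (e n)" by (rule spanF_L2[OF e_spanF])

lemma e_norm: "L2_norm (e n) = 1"
  unfolding e_eq L2_norm_scale using g_pos[of n] by (simp add: norm_divide)

lemma e_orth_less: "m < n \<Longrightarrow> L2_inner (e n) (e m) = 0"
proof (induction n arbitrary: m rule: less_induct)
  case (less n)
  have orth: "L2_inner (e k) (e m) = (if k = m then 1 else 0)" if "k < n" for k
  proof -
    consider "k = m" | "m < k" | "k < m" by linarith
    then show ?thesis
    proof cases
      case 1 then show ?thesis by (simp add: L2_inner_same e_norm)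
    next
      case 2 then show ?thesis using less.IH[OF that] by simp
    next
      case 3
      then have "L2_inner (e m) (e k) = 0" using less.IH[OF less.prems] by simp
      then show ?thesis using 3 by (subst L2_inner_commute) simp
    qed
  qed
  have "L2_inner (g n) (e m) = L2_inner (F n) (e m) - (\<Sum>k<n. L2_inner (F n) (e k) * L2_inner (e k) (e m))"
    unfolding g_def
    by (simp add: L2_inner_diff_left L2_inner_sum_left L2_inner_scale_left F_L2 e_L2 L2_fun_sum L2_fun_scale)
  also have "(\<Sum>k<n. L2_inner (F n) (e k) * L2_inner (e k) (e m)) = (\<Sum>k<n. if k = m then L2_inner (F n) (e k) else 0)"
    by (intro sum.cong refl) (simp add: orth)
  also have "\<dots> = L2_inner (F n) (e m)" using less.prems by simp
  finally have "L2_inner (g n) (e m) = 0" by simp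
  then show ?case by (subst e_eq) (simp add: L2_inner_scale_left)
qed

lemma e_orthonormal: "L2_inner (e n) (e m) = (if n = m then 1 else 0)"
proof -
  consider "n = m" | "m < n" | "n < m" by linarith
  then show ?thesis
  proof cases
    case 3
    then show ?thesis using e_orth_less[OF 3] by (subst L2_inner_commute) simp
  qed (auto simp: e_orth_less L2_inner_same e_norm)
qed

lemma F_in_span_e: "F n = fun_scale (of_real (L2_norm (g n))) (e n) + (\<Sum>k<n. fun_scale (L2_inner (F n) (e k)) (e k))"
proof -
  have "fun_scale (of_real (L2_norm (g n))) (e n) = g n"
    unfolding e_eq using g_pos[of n] by simp
  then show ?thesis by (simp add: g_def)
qed

lemma norm_sum_e: "(L2_norm (\<Sum>k<n. fun_scale (a k) (e k)))\<^sup>2 = (\<Sum>k<n. (cmod (a k))\<^sup>2)"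
proof -
  let ?s = "\<Sum>k<n. fun_scale (a k) (e k)"
  have sL: "L2_fun ?s" by (intro L2_fun_sum L2_fun_scale e_L2)
  have in_s: "L2_inner (e j) ?s = cnj (a j)" if "j < n" for j
  proof -
    have "L2_inner (e j) ?s = (\<Sum>k<n. cnj (a k) * L2_inner (e j) (e k))"
      by (simp add: L2_inner_sum_right L2_inner_scale_right e_L2 L2_fun_scale)
    also have "\<dots> = (\<Sum>k<n. if k = j then cnj (a k) else 0)"
      by (intro sum.cong refl) (simp add: e_orthonormal)
    finally show ?thesis using that by simp
  qed
  have "complex_of_real ((L2_norm ?s)\<^sup>2) = L2_inner ?s ?s" by (simp only: L2_inner_same)
  also have "\<dots> = (\<Sum>j<n. a j * L2_inner (e j) ?s)"
    using sL by (subst L2_inner_sum_left) (auto simp: L2_inner_scale_left e_L2 L2_fun_scale)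
  also have "\<dots> = (\<Sum>j<n. of_real ((cmod (a j))\<^sup>2))"
    by (intro sum.cong refl) (simp add: in_s complex_norm_square del: of_real_power)
  also have "\<dots> = of_real (\<Sum>j<n. (cmod (a j))\<^sup>2)" by simp
  finally show ?thesis by (simp only: of_real_eq_iff)
qed

text \<open>\<open>S f\<close> are the Fourier sums of \<open>f\<close>; in \<open>T f\<close> each
  \<open>e k\<close> is replaced by \<open>F k\<close>, so the limit of \<open>T f\<close> is where
  an operator taking \<open>e k\<close> to \<open>F k\<close> must send \<open>f\<close>.\<close>

definition S where "S f n = (\<Sum>k<n. fun_scale (L2_inner f (e k)) (e k))"
definition T where "T f n = (\<Sum>k<n. fun_scale (L2_inner f (e k)) (F k))"

lemma S_L2: "L2_fun (S f n)" unfolding S_def by (intro L2_fun_sum L2_fun_scale e_L2)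
lemma T_L2: "L2_fun (T f n)" unfolding T_def by (intro L2_fun_sum L2_fun_scale F_L2)

lemma inner_S_e: "L2_inner (S f n) (e j) = (if j < n then L2_inner f (e j) else 0)"
proof -
  have "L2_inner (S f n) (e j) = (\<Sum>k<n. L2_inner f (e k) * L2_inner (e k) (e j))"
    unfolding S_def by (simp add: L2_inner_sum_left L2_inner_scale_left e_L2 L2_fun_scale)
  also have "\<dots> = (\<Sum>k<n. if k = j then L2_inner f (e k) else 0)"
    by (intro sum.cong refl) (simp add: e_orthonormal)
  finally show ?thesis by simp
qed

lemma pythagoras:
  assumes f: "L2_fun f"
  shows "(L2_norm f)\<^sup>2 = (L2_norm (f - S f n))\<^sup>2 + (\<Sum>k<n. (cmod (L2_inner f (e k)))\<^sup>2)"
proof -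
  have L: "L2_fun (f - S f n)" by (intro L2_fun_diff f S_L2)
  have "L2_inner (f - S f n) (e k) = 0" if "k < n" for k
    using that by (simp add: L2_inner_diff_left f S_L2 e_L2 inner_S_e)
  then have "L2_inner (f - S f n) (S f n) = 0"
    by (subst (2) S_def) (simp add: L2_inner_sum_right L2_inner_scale_right L e_L2 L2_fun_scale)
  then have "(L2_norm ((f - S f n) + S f n))\<^sup>2 = (L2_norm (f - S f n))\<^sup>2 + (L2_norm (S f n))\<^sup>2"
    by (subst L2_norm_add_sq[OF L S_L2]) simp
  moreover have "(f - S f n) + S f n = f" by simp
  moreover have "(L2_norm (S f n))\<^sup>2 = (\<Sum>k<n. (cmod (L2_inner f (e k)))\<^sup>2)"
    unfolding S_def by (rule norm_sum_e)
  ultimately show ?thesis by simp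
qed

lemma bessel_summable:
  assumes f: "L2_fun f"
  shows "summable (\<lambda>k. (cmod (L2_inner f (e k)))\<^sup>2)"
proof (rule summableI_nonneg_bounded)
  show "(\<Sum>k<n. (cmod (L2_inner f (e k)))\<^sup>2) \<le> (L2_norm f)\<^sup>2" for n
    using pythagoras[OF f, of n] by simp
qed simp

text \<open>By Bessel's inequality and completeness the sums have some limit \<open>h\<close>. The
  difference \<open>f - h\<close> is orthogonal to all \<open>e j\<close>, hence to all
  \<open>F n\<close>, and \<open>total\<close> identifies \<open>h\<close> with \<open>f\<close> up
  to a null function.\<close>

lemma S_tendsto:
  assumes f: "L2_fun f"
  shows "(\<lambda>n. L2_norm (S f n - f)) \<longlonglongrightarrow> 0"
proof -
  obtain h where h: "L2_fun h" "(\<lambda>n. L2_norm (S f n - h)) \<longlonglongrightarrow> 0"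
    unfolding S_def
    by (rule L2_series_converges[of e 1 "\<lambda>k. L2_inner f (e k)"])
      (auto simp: e_L2 norm_sum_e bessel_summable[OF f])
  have fh: "L2_fun (f - h)" by (intro L2_fun_diff f h)
  have he: "L2_inner h (e j) = L2_inner f (e j)" for j
  proof (rule LIMSEQ_unique)
    show "(\<lambda>n. L2_inner (S f n) (e j)) \<longlonglongrightarrow> L2_inner h (e j)"
      by (rule L2_inner_tendsto[OF S_L2 h(1) e_L2 h(2)])
    show "(\<lambda>n. L2_inner (S f n) (e j)) \<longlonglongrightarrow> L2_inner f (e j)"
      by (rule tendsto_eventually, rule eventually_sequentiallyI[of "Suc j"]) (simp add: inner_S_e)
  qed
  have e0: "L2_inner (f - h) (e j) = 0" for j
    by (simp add: L2_inner_diff_left f h e_L2 he)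
  have "L2_inner (f - h) (F n) = 0" for n
    by (subst F_in_span_e, subst L2_inner_commute, subst L2_inner_add_left)
      (auto simp: L2_inner_sum_left L2_inner_scale_left e_L2 L2_fun_scale L2_fun_sum fh
        L2_inner_commute[of "e _" "f - h"] e0)
  then have "L2_norm (f - h) = 0" by (rule total[OF fh])
  then have *: "L2_norm (S f n - f) \<le> L2_norm (S f n - h)" for n
    using L2_norm_triangle_diff[OF S_L2 h(1) f, of f n] L2_norm_minus_commute[of f h] by simp
  show ?thesis
    by (rule Lim_null_comparison[OF _ h(2)]) (use * in auto)
qed

lemma parseval:
  assumes f: "L2_fun f"
  shows "(\<lambda>n. \<Sum>k<n. (cmod (L2_inner f (e k)))\<^sup>2) \<longlonglongrightarrow> (L2_norm f)\<^sup>2"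
proof -
  have "(\<lambda>n. (L2_norm f)\<^sup>2 - (L2_norm (S f n - f))\<^sup>2) \<longlonglongrightarrow> (L2_norm f)\<^sup>2 - 0\<^sup>2"
    by (intro tendsto_intros S_tendsto f)
  moreover have "(L2_norm f)\<^sup>2 - (L2_norm (S f n - f))\<^sup>2 = (\<Sum>k<n. (cmod (L2_inner f (e k)))\<^sup>2)" for n
    using pythagoras[OF f, of n] L2_norm_minus_commute[of f "S f n"] by simp
  ultimately show ?thesis by simp
qed

text \<open>\<open>A\<close> maps \<open>e n\<close> to \<open>F n\<close> and \<open>B\<close> is its inverse, both only up to null functions.\<close>

definition A where "A f = (SOME h. L2_fun h \<and> (\<lambda>n. L2_norm (T f n - h)) \<longlonglongrightarrow> 0)"

lemma A:
  assumes f: "L2_fun f"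
  shows "L2_fun (A f)" "(\<lambda>n. L2_norm (T f n - A f)) \<longlonglongrightarrow> 0"
proof -
  have "\<exists>h. L2_fun h \<and> (\<lambda>n. L2_norm (T f n - h)) \<longlonglongrightarrow> 0"
    unfolding T_def
    by (rule L2_series_converges[of F C "\<lambda>k. L2_inner f (e k)"])
      (use F_L2 upper bessel_summable[OF f] in auto)
  from someI_ex[OF this] show "L2_fun (A f)" "(\<lambda>n. L2_norm (T f n - A f)) \<longlonglongrightarrow> 0"
    unfolding A_def by auto
qed

lemma A_bounds:
  assumes f: "L2_fun f"
  shows "c * (L2_norm f)\<^sup>2 \<le> (L2_norm (A f))\<^sup>2" "(L2_norm (A f))\<^sup>2 \<le> C * (L2_norm f)\<^sup>2"
proof -
  have T: "(\<lambda>n. (L2_norm (T f n))\<^sup>2) \<longlonglongrightarrow> (L2_norm (A f))\<^sup>2"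
    by (intro tendsto_power L2_norm_tendsto T_L2 A f)
  have 1: "(\<lambda>n. s * (\<Sum>k<n. (cmod (L2_inner f (e k)))\<^sup>2)) \<longlonglongrightarrow> s * (L2_norm f)\<^sup>2" for s
    by (intro tendsto_mult tendsto_const parseval f)
  show "c * (L2_norm f)\<^sup>2 \<le> (L2_norm (A f))\<^sup>2"
    by (rule LIMSEQ_le[OF 1 T]) (auto simp: T_def lower)
  show "(L2_norm (A f))\<^sup>2 \<le> C * (L2_norm f)\<^sup>2"
    by (rule LIMSEQ_le[OF T 1]) (auto simp: T_def upper)
qed

text \<open>\<open>A f\<close> is a chosen limit, determined up to null functions, so linearity is
  stated in the seminorm. It is inherited from the sums \<open>T f n\<close>, which are linear in
  \<open>f\<close> exactly.\<close>

lemma A_lin: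
  assumes f: "L2_fun f" and h: "L2_fun h"
  shows "L2_norm (A (f + fun_scale s h) - (A f + fun_scale s (A h))) = 0"
proof -
  have fh: "L2_fun (f + fun_scale s h)" by (intro L2_fun_add L2_fun_scale f h)
  show ?thesis
  proof (rule L2_limit_unique[OF T_L2 A(1)[OF fh] _ A(2)[OF fh]])
    show "L2_fun (A f + fun_scale s (A h))" by (intro L2_fun_add L2_fun_scale A f h)
    have T: "T (f + fun_scale s h) n = T f n + fun_scale s (T h n)" for n
      unfolding T_def
      by (simp add: L2_inner_add_left L2_inner_scale_left f h e_L2 L2_fun_scale
          fun_scale.scale_left_distrib sum.distrib fun_scale.scale_sum_right)
    show "(\<lambda>n. L2_norm (T (f + fun_scale s h) n - (A f + fun_scale s (A h)))) \<longlonglongrightarrow> 0"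
    proof (rule Lim_null_comparison)
      show "(\<lambda>n. L2_norm (T f n - A f) + cmod s * L2_norm (T h n - A h)) \<longlonglongrightarrow> 0"
        using tendsto_add[OF A(2)[OF f] tendsto_mult_right_zero[OF A(2)[OF h], of "cmod s"]] by simp
      have "L2_norm (T (f + fun_scale s h) n - (A f + fun_scale s (A h))) \<le>
          L2_norm (T f n - A f) + cmod s * L2_norm (T h n - A h)" for n
      proof -
        have "T (f + fun_scale s h) n - (A f + fun_scale s (A h)) = (T f n - A f) + fun_scale s (T h n - A h)"
          unfolding T by (simp add: fun_scale.scale_right_diff_distrib algebra_simps)
        moreover have "L2_norm ((T f n - A f) + fun_scale s (T h n - A h)) \<le>
            L2_norm (T f n - A f) + L2_norm (fun_scale s (T h n - A h))"
          by (intro L2_norm_triangle L2_fun_diff L2_fun_scale T_L2 A f h)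
        ultimately show ?thesis by (simp only: L2_norm_scale)
      qed
      then show "\<forall>\<^sub>F n in sequentially. norm (L2_norm (T (f + fun_scale s h) n - (A f + fun_scale s (A h)))) \<le>
          L2_norm (T f n - A f) + cmod s * L2_norm (T h n - A h)" by simp
    qed
  qed
qed

lemma L2_norm_eq_null:
  assumes "L2_fun u" "L2_fun v" "L2_norm (u - v) = 0"
  shows "L2_norm u = L2_norm v"
  using L2_norm_diff_le[OF assms(1,2)] assms(3) by simp

lemma A_diff_norm:
  assumes f: "L2_fun f" and h: "L2_fun h"
  shows "L2_norm (A f - A h) = L2_norm (A (f - h))"
proof -
  have "f + fun_scale (-1) h = f - h" "A f + fun_scale (-1) (A h) = A f - A h"
    by (simp_all add: fun_scale_def fun_eq_iff plus_fun_def)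
  then have "L2_norm (A (f - h) - (A f - A h)) = 0" using A_lin[OF f h, of "-1"] by simp
  then show ?thesis
    by (intro L2_norm_eq_null[symmetric]) (auto intro!: A L2_fun_diff f h)
qed

lemma A_finite:
  shows "L2_norm (A (\<Sum>k<n. fun_scale (a k) (e k)) - (\<Sum>k<n. fun_scale (a k) (F k))) = 0"
proof -
  let ?t = "\<Sum>k<n. fun_scale (a k) (e k)"
  have t: "L2_fun ?t" by (intro L2_fun_sum L2_fun_scale e_L2)
  have te: "L2_inner ?t (e j) = (if j < n then a j else 0)" for j
  proof -
    have "L2_inner ?t (e j) = (\<Sum>k<n. a k * L2_inner (e k) (e j))"
      by (simp add: L2_inner_sum_left L2_inner_scale_left e_L2 L2_fun_scale)
    also have "\<dots> = (\<Sum>k<n. if k = j then a k else 0)"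
      by (intro sum.cong refl) (simp add: e_orthonormal)
    finally show ?thesis by simp
  qed
  have T: "T ?t m = (\<Sum>k<n. fun_scale (a k) (F k))" if "m \<ge> n" for m
    unfolding T_def te using that by (intro sum.mono_neutral_cong_right) auto
  have "(\<lambda>m. L2_norm (T ?t m - (\<Sum>k<n. fun_scale (a k) (F k)))) \<longlonglongrightarrow> 0"
    by (rule tendsto_eventually, rule eventually_sequentiallyI[of n]) (simp add: T)
  then show ?thesis
    by (intro L2_limit_unique[OF T_L2 A(1)[OF t] _ A(2)[OF t]]) (auto intro!: L2_fun_sum L2_fun_scale F_L2)
qed

lemma A_e: "L2_norm (A (e p) - F p) = 0"
proof -
  have "(\<Sum>k<Suc p. fun_scale (if k = p then 1 else 0) (f k)) = f p" for f :: "nat \<Rightarrow> real \<Rightarrow> complex^'m"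
    by simp
  then show ?thesis using A_finite[where n="Suc p" and a="\<lambda>k. if k = p then 1 else 0"] by simp
qed

lemma approx_F:
  assumes f: "L2_fun f" and eps: "\<epsilon> > 0"
  shows "\<exists>n a. L2_norm (f - (\<Sum>k<n. fun_scale (a k) (F k))) < \<epsilon>"
proof -
  have "\<forall>\<^sub>F n in sequentially. L2_norm (S f n - f) < \<epsilon>"
    using S_tendsto[OF f] eps by (rule order_tendstoD)
  then obtain n where n: "L2_norm (S f n - f) < \<epsilon>" by (meson eventually_sequentially order_refl)
  have "spanF n (S f n)"
    unfolding S_def by (intro spanF_sum spanF_scale spanF_mono[OF e_spanF]) auto
  then show ?thesis using n unfolding spanF_def L2_norm_minus_commute[of _ f] by metis
qed

text \<open>The range is dense because it contains all finite sums of the \<open>F k\<close> up to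
  null functions. It is closed because the lower bound for \<open>A\<close> makes preimages of a
  convergent sequence Cauchy.\<close>

lemma A_surj:
  assumes f: "L2_fun f"
  shows "\<exists>t. L2_fun t \<and> L2_norm (A t - f) = 0"
proof -
  have "\<exists>t. L2_fun t \<and> L2_norm (A t - f) < 1 / real (Suc j)" for j
  proof -
    obtain n a where na: "L2_norm (f - (\<Sum>k<n. fun_scale (a k) (F k))) < 1 / real (Suc j)"
      using approx_F[OF f, of "1 / real (Suc j)"] by auto
    let ?t = "\<Sum>k<n. fun_scale (a k) (e k)" and ?u = "\<Sum>k<n. fun_scale (a k) (F k)"
    have t: "L2_fun ?t" and u: "L2_fun ?u" by (auto intro!: L2_fun_sum L2_fun_scale e_L2 F_L2)
    have "L2_norm (A ?t - f) \<le> L2_norm (A ?t - ?u) + L2_norm (?u - f)"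
      by (intro L2_norm_triangle_diff A t u f)
    then show ?thesis using na t A_finite[where n=n and a=a] L2_norm_minus_commute[of f ?u] by auto
  qed
  then obtain t where t: "\<And>j. L2_fun (t j)" "\<And>j. L2_norm (A (t j) - f) < 1 / real (Suc j)" by metis
  have At: "(\<lambda>j. L2_norm (A (t j) - f)) \<longlonglongrightarrow> 0"
    by (rule Lim_null_comparison[OF _ LIMSEQ_Suc[OF lim_inverse_n']])
      (use t(2) in \<open>auto intro!: always_eventually less_imp_le\<close>)
  obtain h where h: "L2_fun h" "(\<lambda>j. L2_norm (t j - h)) \<longlonglongrightarrow> 0"
  proof (rule L2_complete[of t])
    fix d :: real assume d: "d > 0"
    have "\<forall>\<^sub>F j in sequentially. L2_norm (A (t j) - f) < sqrt c * d / 2"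
      using At c_pos d by (intro order_tendstoD(2)[of _ 0]) auto
    then obtain N where N: "\<And>j. j \<ge> N \<Longrightarrow> L2_norm (A (t j) - f) < sqrt c * d / 2"
      by (auto simp: eventually_sequentially)
    have "L2_norm (t m - t n) < d" if "m \<ge> N" "n \<ge> N" for m n
    proof -
      have td: "L2_fun (t m - t n)" by (intro L2_fun_diff t)
      have "L2_norm (A (t m) - A (t n)) \<le> L2_norm (A (t m) - f) + L2_norm (f - A (t n))"
        by (intro L2_norm_triangle_diff A t f)
      then have "L2_norm (A (t m) - A (t n)) < sqrt c * d"
        using N[OF that(1)] N[OF that(2)] L2_norm_minus_commute[of f "A (t n)"] by simp
      then have a: "L2_norm (A (t m - t n)) < sqrt c * d" by (simp add: A_diff_norm t)
      have "(sqrt c * L2_norm (t m - t n))\<^sup>2 \<le> (L2_norm (A (t m - t n)))\<^sup>2"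
        using A_bounds(1)[OF td] c_pos by (simp add: power_mult_distrib)
      then have "sqrt c * L2_norm (t m - t n) \<le> L2_norm (A (t m - t n))"
        by (rule power2_le_imp_le) simp
      with a have "sqrt c * L2_norm (t m - t n) < sqrt c * d" by simp
      then show ?thesis using c_pos by simp
    qed
    then show "\<exists>N. \<forall>m\<ge>N. \<forall>n\<ge>N. L2_norm (t m - t n) < d" by blast
  qed (use t in auto)
  have "(\<lambda>j. L2_norm (A (t j) - A h)) \<longlonglongrightarrow> 0"
  proof (rule Lim_null_comparison)
    show "(\<lambda>j. sqrt \<bar>C\<bar> * L2_norm (t j - h)) \<longlonglongrightarrow> 0" by (intro tendsto_mult_right_zero h)
    have "L2_norm (A (t j) - A h) \<le> sqrt \<bar>C\<bar> * L2_norm (t j - h)" for j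
    proof (rule power2_le_imp_le)
      have "(L2_norm (A (t j) - A h))\<^sup>2 \<le> C * (L2_norm (t j - h))\<^sup>2"
        using A_bounds(2)[of "t j - h"] by (simp add: A_diff_norm t h L2_fun_diff)
      also have "\<dots> \<le> \<bar>C\<bar> * (L2_norm (t j - h))\<^sup>2" by (intro mult_right_mono) auto
      finally show "(L2_norm (A (t j) - A h))\<^sup>2 \<le> (sqrt \<bar>C\<bar> * L2_norm (t j - h))\<^sup>2"
        by (simp add: power_mult_distrib)
    qed simp
    then show "\<forall>\<^sub>F j in sequentially. norm (L2_norm (A (t j) - A h)) \<le> sqrt \<bar>C\<bar> * L2_norm (t j - h)" by simp
  qed
  then have "L2_norm (A h - f) = 0"
    by (intro L2_limit_unique[OF _ _ f _ At]) (auto intro: A t h)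
  with h show ?thesis by blast
qed

lemma A_inj:
  assumes "L2_fun f" "L2_fun h" "L2_norm (A f - A h) = 0"
  shows "L2_norm (f - h) = 0"
proof -
  have "c * (L2_norm (f - h))\<^sup>2 \<le> 0"
    using A_bounds(1)[OF L2_fun_diff[OF assms(1,2)]] assms by (simp add: A_diff_norm[symmetric])
  then show ?thesis using c_pos by (simp add: mult_le_0_iff)
qed

definition B where "B f = (SOME t. L2_fun t \<and> L2_norm (A t - f) = 0)"

lemma B:
  assumes "L2_fun f"
  shows "L2_fun (B f)" "L2_norm (A (B f) - f) = 0"
  using someI_ex[OF A_surj[OF assms]] unfolding B_def by auto

lemma bounded_operator_L2I:
  assumes L: "\<And>f. L2_fun f \<Longrightarrow> L2_fun (P f)"
    and lin: "\<And>f h s. L2_fun f \<Longrightarrow> L2_fun h \<Longrightarrow> L2_norm (P (f + fun_scale s h) - (P f + fun_scale s (P h))) = 0"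
    and bd: "\<And>f. L2_fun f \<Longrightarrow> (L2_norm (P f))\<^sup>2 \<le> K * (L2_norm f)\<^sup>2"
  shows "bounded_operator_L2 P"
  unfolding bounded_operator_L2_def
proof (intro conjI allI impI)
  have bd': "L2_norm (P f) \<le> sqrt \<bar>K\<bar> * L2_norm f" if "L2_fun f" for f
  proof (rule power2_le_imp_le)
    have "(L2_norm (P f))\<^sup>2 \<le> K * (L2_norm f)\<^sup>2" by (rule bd[OF that])
    also have "\<dots> \<le> \<bar>K\<bar> * (L2_norm f)\<^sup>2" by (intro mult_right_mono) auto
    finally show "(L2_norm (P f))\<^sup>2 \<le> (sqrt \<bar>K\<bar> * L2_norm f)\<^sup>2" by (simp add: power_mult_distrib)
  qed simp
  then show "\<exists>C. \<forall>f. L2_fun f \<longrightarrow> L2_norm (P f) \<le> C * L2_norm f" by blast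
  show "L2_fun (P f)" if "L2_fun f" for f by (rule L[OF that])
  show "L2_eq (P (\<lambda>x. f x + h x)) (\<lambda>x. P f x + P h x)" if f: "L2_fun f" and h: "L2_fun h" for f h
  proof -
    have "L2_eq (P (f + fun_scale 1 h)) (P f + fun_scale 1 (P h))"
      using lin[OF f h, of 1] f h L by (subst L2_eq_iff_norm) (auto intro!: L2_fun_add L2_fun_scale)
    then show ?thesis by (simp add: plus_fun_def)
  qed
  show "L2_eq (P (\<lambda>x. s *s f x)) (\<lambda>x. s *s P f x)" if f: "L2_fun f" for s f
  proof -
    \<comment> \<open>Homogeneity is read off from the combined linearity with first argument 0,
      whose image is so far only known to be a null function.\<close>
    have P0: "L2_norm (P 0) = 0" using bd'[OF L2_fun_zero] L2_norm_nonneg[of "P 0"] by simp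
    have "L2_norm (P (fun_scale s f) - (P 0 + fun_scale s (P f))) = 0"
      using lin[OF L2_fun_zero f, of s] by simp
    moreover have "L2_norm ((P 0 + fun_scale s (P f)) - fun_scale s (P f)) = 0" using P0 by simp
    moreover have "L2_norm (P (fun_scale s f) - fun_scale s (P f)) \<le>
        L2_norm (P (fun_scale s f) - (P 0 + fun_scale s (P f))) + L2_norm ((P 0 + fun_scale s (P f)) - fun_scale s (P f))"
      by (intro L2_norm_triangle_diff L L2_fun_add L2_fun_scale L2_fun_zero f)
    ultimately have "L2_norm (P (fun_scale s f) - fun_scale s (P f)) = 0"
      using L2_norm_nonneg[of "P (fun_scale s f) - fun_scale s (P f)"] by linarith
    then have "L2_eq (P (fun_scale s f)) (fun_scale s (P f))"
      using f by (subst L2_eq_iff_norm) (auto intro!: L L2_fun_scale)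
    then show ?thesis by (simp add: fun_scale_def)
  qed
qed

text \<open>\<open>B\<close> selects preimages, so its linearity is tested after applying
  \<open>A\<close>, which is linear and injective up to null functions.\<close>

lemma B_lin:
  assumes f: "L2_fun f" and h: "L2_fun h"
  shows "L2_norm (B (f + fun_scale s h) - (B f + fun_scale s (B h))) = 0"
proof (rule A_inj)
  have fh: "L2_fun (f + fun_scale s h)" by (intro L2_fun_add L2_fun_scale f h)
  show 1: "L2_fun (B (f + fun_scale s h))" by (rule B[OF fh])
  show 2: "L2_fun (B f + fun_scale s (B h))" by (intro L2_fun_add L2_fun_scale B f h)
  let ?u = "A (B f) + fun_scale s (A (B h))" and ?v = "f + fun_scale s h"
  have u: "L2_fun ?u" by (intro L2_fun_add L2_fun_scale A B f h)
  have "?u - ?v = (A (B f) - f) + fun_scale s (A (B h) - h)"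
    by (simp add: fun_scale.scale_right_diff_distrib algebra_simps)
  then have "L2_norm (?u - ?v) \<le> L2_norm (A (B f) - f) + L2_norm (fun_scale s (A (B h) - h))"
    by (simp only:) (intro L2_norm_triangle L2_fun_diff L2_fun_scale A B f h)
  then have "L2_norm (?u - ?v) \<le> 0" by (simp add: L2_norm_scale B f h)
  moreover have "L2_norm (A (B ?v) - A (B f + fun_scale s (B h))) \<le>
      L2_norm (A (B ?v) - ?v) + (L2_norm (?v - ?u) + L2_norm (?u - A (B f + fun_scale s (B h))))"
    using L2_norm_triangle_diff[OF A(1)[OF 1] fh A(1)[OF 2]] L2_norm_triangle_diff[OF fh u A(1)[OF 2]] by linarith
  moreover have "L2_norm (?u - A (B f + fun_scale s (B h))) = 0"
    using A_lin[OF B(1)[OF f] B(1)[OF h], of s] by (subst L2_norm_minus_commute)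
  moreover have "L2_norm (A (B ?v) - ?v) = 0" by (rule B(2)[OF fh])
  ultimately show "L2_norm (A (B ?v) - A (B f + fun_scale s (B h))) = 0"
    using L2_norm_nonneg[of "A (B ?v) - A (B f + fun_scale s (B h))"] L2_norm_minus_commute[of ?u ?v] by linarith
qed

lemma complete_lessThanI:
  fixes G :: "nat \<Rightarrow> real \<Rightarrow> complex^'m"
  assumes "\<And>p. L2_fun (G p)"
    and "\<And>f \<epsilon>. L2_fun f \<Longrightarrow> \<epsilon> > 0 \<Longrightarrow> \<exists>n a. L2_norm (f - (\<Sum>k<n. fun_scale (a k) (G k))) < \<epsilon>"
  shows "complete_in_L2 (UNIV :: nat set) G"
  unfolding complete_in_L2_def
proof (intro conjI ballI allI impI assms(1))
  fix f :: "real \<Rightarrow> complex^'m" and \<epsilon> :: real assume "L2_fun f" "\<epsilon> > 0"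
  then obtain n a where "L2_norm (f - (\<Sum>k<n. fun_scale (a k) (G k))) < \<epsilon>" using assms(2) by blast
  moreover have "f - (\<Sum>k<n. fun_scale (a k) (G k)) = (\<lambda>x. f x - (\<Sum>p\<in>{..<n}. a p *s G p x))"
    by (simp add: fun_eq_iff sum_fun_apply fun_scale_def)
  ultimately show "\<exists>S c. finite S \<and> S \<subseteq> UNIV \<and> L2_norm (\<lambda>x. f x - (\<Sum>p\<in>S. c p *s G p x)) < \<epsilon>"
    by (intro exI[of _ "{..<n}"] exI[of _ a]) auto
qed

theorem complete_and_Riesz: "complete_in_L2 UNIV F \<and> Riesz_basis_L2 UNIV F"
proof
  show "complete_in_L2 UNIV F" by (rule complete_lessThanI[OF F_L2 approx_F])
  have ce: "complete_in_L2 UNIV e"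
  proof (rule complete_lessThanI[where G=e, OF e_L2])
    fix f :: "real \<Rightarrow> complex^'m" and \<epsilon> :: real assume f: "L2_fun f" and eps: "\<epsilon> > 0"
    have "\<forall>\<^sub>F n in sequentially. L2_norm (S f n - f) < \<epsilon>"
      using S_tendsto[OF f] eps by (rule order_tendstoD)
    then obtain n where "L2_norm (S f n - f) < \<epsilon>" by (meson eventually_sequentially order_refl)
    then have "L2_norm (f - S f n) < \<epsilon>" by (simp only: L2_norm_minus_commute[of f])
    then show "\<exists>n a. L2_norm (f - (\<Sum>k<n. fun_scale (a k) (e k))) < \<epsilon>"
      unfolding S_def by (intro exI[of _ n] exI[of _ "\<lambda>k. L2_inner f (e k)"])
  qed
  show "Riesz_basis_L2 UNIV F"
    unfolding Riesz_basis_L2_def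
  proof (intro conjI ballI F_L2, rule exI[of _ e], rule exI[of _ A], rule exI[of _ B], intro conjI ballI allI impI)
    show "orthonormal_basis_L2 UNIV e"
      unfolding orthonormal_basis_L2_def using ce e_orthonormal by blast
    show "bounded_operator_L2 A" by (rule bounded_operator_L2I[OF A(1) A_lin A_bounds(2)])
    show "bounded_operator_L2 B"
    proof (rule bounded_operator_L2I[OF B(1) B_lin])
      fix f :: "real \<Rightarrow> complex^'m" assume f: "L2_fun f"
      have "c * (L2_norm (B f))\<^sup>2 \<le> (L2_norm (A (B f)))\<^sup>2" by (rule A_bounds(1)[OF B(1)[OF f]])
      also have "L2_norm (A (B f)) = L2_norm f" by (intro L2_norm_eq_null A B f)
      finally show "(L2_norm (B f))\<^sup>2 \<le> (1 / c) * (L2_norm f)\<^sup>2" using c_pos by (simp add: field_simps)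
    qed
    fix f :: "real \<Rightarrow> complex^'m" assume f: "L2_fun f"
    show "L2_eq (A (B f)) f" using f by (subst L2_eq_iff_norm) (auto intro: A(1) B)
    have "L2_norm (B (A f) - f) = 0" by (rule A_inj[OF B(1)[OF A(1)[OF f]] f B(2)[OF A(1)[OF f]]])
    then show "L2_eq (B (A f)) f" using f by (subst L2_eq_iff_norm) (auto intro: A(1) B(1))
  next
    show "L2_eq (A (e p)) (F p)" for p using A_e by (subst L2_eq_iff_norm) (auto intro: A(1) e_L2 F_L2)
  qed
qed

end

text \<open>Completeness and the Riesz property refer to arbitrary finite subsets and not to an
  order, so any enumeration of the index set transports them.\<close>

lemma Riesz_basis_L2_reindex:
  assumes b: "bij_betw b (UNIV :: nat set) J"
    and "complete_in_L2 UNIV (\<lambda>n. F (b n))" "Riesz_basis_L2 UNIV (\<lambda>n. F (b n))"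
  shows "complete_in_L2 J F \<and> Riesz_basis_L2 J F"
proof -
  define i where "i = inv_into UNIV b"
  have bi: "b (i p) = p" if "p \<in> J" for p
    using b that unfolding i_def by (simp add: bij_betw_inv_into_right)
  have ib: "i (b n) = n" for n
    using b unfolding i_def by (simp add: bij_betw_inv_into_left)
  have bJ: "b n \<in> J" for n using b by (auto simp: bij_betw_def)
  have complete: "complete_in_L2 J G" if cG: "complete_in_L2 UNIV (\<lambda>n. G (b n))" for G :: "'a \<Rightarrow> real \<Rightarrow> complex^'b"
    unfolding complete_in_L2_def
  proof (intro conjI ballI allI impI)
    show "L2_fun (G p)" if "p \<in> J" for p
      using \<open>complete_in_L2 UNIV (\<lambda>n. G (b n))\<close> bi[OF that] unfolding complete_in_L2_def by (metis UNIV_I)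
    fix f :: "real \<Rightarrow> complex^'b" and \<epsilon> :: real assume "L2_fun f" "\<epsilon> > 0"
    then obtain S c where S: "finite S" "L2_norm (\<lambda>x. f x - (\<Sum>n\<in>S. c n *s G (b n) x)) < \<epsilon>"
      using cG[unfolded complete_in_L2_def, THEN conjunct2, rule_format, of f \<epsilon>] by auto
    have inj: "inj_on b S" using b by (meson bij_betw_def inj_on_subset subset_UNIV)
    have "(\<Sum>p\<in>b ` S. c (i p) *s G p x) = (\<Sum>n\<in>S. c n *s G (b n) x)" for x
      by (subst sum.reindex[OF inj]) (simp add: ib)
    then show "\<exists>S c. finite S \<and> S \<subseteq> J \<and> L2_norm (\<lambda>x. f x - (\<Sum>p\<in>S. c p *s G p x)) < \<epsilon>"
      using S bJ by (intro exI[of _ "b ` S"] exI[of _ "\<lambda>p. c (i p)"]) auto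
  qed
  obtain e A B where R: "orthonormal_basis_L2 UNIV e" "bounded_operator_L2 A" "bounded_operator_L2 B"
    "\<forall>f. L2_fun f \<longrightarrow> L2_eq (B (A f)) f \<and> L2_eq (A (B f)) f" "\<And>n. L2_eq (A (e n)) (F (b n))"
    "\<And>n. L2_fun (F (b n))"
    using assms(3) unfolding Riesz_basis_L2_def by auto
  have "orthonormal_basis_L2 J (\<lambda>p. e (i p))"
    unfolding orthonormal_basis_L2_def
  proof (intro conjI complete ballI)
    show "complete_in_L2 UNIV (\<lambda>n. e (i (b n)))" using R(1) by (simp add: ib orthonormal_basis_L2_def)
    fix p q assume "p \<in> J" "q \<in> J"
    then have "i p = i q \<longleftrightarrow> p = q" using bi by metis
    then show "L2_inner (e (i p)) (e (i q)) = (if p = q then 1 else 0)"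
      using R(1) by (simp add: orthonormal_basis_L2_def)
  qed
  moreover have "L2_fun (F p)" "L2_eq (A (e (i p))) (F p)" if "p \<in> J" for p
    using R(5,6)[of "i p"] bi[OF that] by auto
  ultimately show ?thesis
    using complete[OF assms(2)] R(2-4) unfolding Riesz_basis_L2_def by blast
qed

section \<open>The Sturm--Liouville system\<close>

text \<open>\<open>linear_ode\<close> uses the real structure of the state space. Multiplication by
  a complex number enters as a real-linear map that commutes with the system.\<close>

lemma (in linear_ode) is_sol_linear:
  assumes L: "bounded_linear L" "\<And>t v. L (A t v) = A t (L v)"
    and w: "is_sol g w0 w" and g: "g absolutely_integrable_on {0..b}"
  shows "is_sol (\<lambda>t. L (g t)) (L w0) (\<lambda>x. L (w x))"
  unfolding is_sol_def
proof (intro conjI ballI)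
  have c: "continuous_on {0..b} w" using w by (auto simp: is_sol_def)
  then show "continuous_on {0..b} (\<lambda>x. L (w x))"
    by (rule bounded_linear.continuous_on[OF L(1)])
  fix x assume x: "x \<in> {0..b}"
  have "(\<lambda>t. A t (w t) + g t) integrable_on {0..b}"
    by (intro set_lebesgue_integral_eq_integral(1) set_integral_add absolutely_integrable_A c g)
  then have i: "(\<lambda>t. A t (w t) + g t) integrable_on {0..x}"
    using x by (auto intro: integrable_on_subinterval)
  have "L (w x) = L (w0 + integral {0..x} (\<lambda>t. A t (w t) + g t))" using w x by (simp add: is_sol_def)
  also have "\<dots> = L w0 + integral {0..x} (\<lambda>t. L (A t (w t) + g t))"
    using integral_linear[OF i L(1)] by (simp add: bounded_linear.linear[OF L(1)] linear_add comp_def)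
  also have "(\<lambda>t. L (A t (w t) + g t)) = (\<lambda>t. A t (L (w t)) + L (g t))"
    by (simp add: bounded_linear.linear[OF L(1)] linear_add L(2))
  finally show "L (w x) = L w0 + integral {0..x} (\<lambda>t. A t (L (w t)) + L (g t))" .
qed

lemma borel_measurable_Ioo_Icc:
  fixes f :: "real \<Rightarrow> 'v::euclidean_space"
  assumes "f \<in> borel_measurable (lebesgue_on {a<..<b})"
  shows "f \<in> borel_measurable (lebesgue_on {a..b})"
proof -
  have "f measurable_on {a<..<b}" using assms by (simp add: measurable_on_iff_borel_measurable)
  then have "f measurable_on {a..b}"
  proof (rule measurable_on_spike_set)
    have "({a<..<b} - {a..b}) \<union> ({a..b} - {a<..<b}) \<subseteq> {a, b}" by auto
    then show "negligible (({a<..<b} - {a..b}) \<union> ({a..b} - {a<..<b}))"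
      by (rule negligible_subset[rotated]) simp
  qed
  then show ?thesis by (simp add: measurable_on_iff_borel_measurable)
qed

lemma integrable_leb_pi_iff:
  fixes f :: "real \<Rightarrow> 'v::euclidean_space"
  shows "integrable leb_pi f \<longleftrightarrow> f absolutely_integrable_on {0..pi}"
proof -
  have "integrable leb_pi f \<longleftrightarrow> f absolutely_integrable_on {0<..<pi}"
    unfolding set_integrable_def by (subst integrable_restrict_space) auto
  also have "\<dots> \<longleftrightarrow> f absolutely_integrable_on {0..pi}"
    using absolutely_integrable_on_Icc_iff_Ioo by blast
  finally show ?thesis .
qed

lemma lebesgue_integral_leb_pi:
  fixes f :: "real \<Rightarrow> 'v::euclidean_space"
  assumes "integrable leb_pi f"
  shows "(LINT x|leb_pi. f x) = integral {0..pi} f"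
proof -
  have "(LINT x|leb_pi. f x) = integral {0<..<pi} f"
    using assms by (intro lebesgue_integral_eq_integral) auto
  then show ?thesis by (simp add: integral_open_interval_real)
qed

lemma L2_fun_integrable:
  assumes "L2_fun f"
  shows "integrable leb_pi f" "integrable leb_pi (\<lambda>x. norm (f x))"
proof -
  have *: "norm (f x) \<le> 1 + (norm (f x))\<^sup>2" for x
  proof -
    have "2 * norm (f x) \<le> (norm (f x))\<^sup>2 + 1" using sum_squares_bound[of "norm (f x)" 1] by simp
    then show ?thesis using norm_ge_zero[of "f x"] by linarith
  qed
  show "integrable leb_pi f"
    by (rule Bochner_Integration.integrable_bound[of _ "\<lambda>x. 1 + (norm (f x))\<^sup>2"])
      (use assms * in \<open>auto simp: L2_fun_def abs_of_nonneg\<close>)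
  then show "integrable leb_pi (\<lambda>x. norm (f x))" by (rule integrable_norm)
qed

lemma L2_fun_continuous:
  fixes f :: "real \<Rightarrow> 'v::euclidean_space"
  assumes "continuous_on {0..pi} f"
  shows "L2_fun f"
proof -
  have c: "continuous_on {0<..<pi} f" by (rule continuous_on_subset[OF assms]) auto
  have "(\<lambda>x. (norm (f x))\<^sup>2) absolutely_integrable_on {0..pi}"
    by (intro absolutely_integrable_continuous_real continuous_intros assms)
  then show ?thesis
    unfolding L2_fun_def integrable_leb_pi_iff
    using continuous_imp_measurable_on_sets_lebesgue[OF c] by simp
qed

lemma L2_norm_le_sup:
  assumes "continuous_on {0..pi} f" "\<And>x. x \<in> {0..pi} \<Longrightarrow> norm (f x) \<le> M"
  shows "L2_norm f \<le> sqrt pi * M"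
proof -
  have M: "M \<ge> 0" using assms(2)[of 0] by (auto intro: order_trans[OF norm_ge_zero])
  have "(LINT x|leb_pi. (norm (f x))\<^sup>2) \<le> (LINT x|leb_pi. M\<^sup>2)"
    using L2_fun_continuous[OF assms(1)] assms(2)
    by (intro integral_mono) (auto simp: L2_fun_def intro!: power_mono)
  then have "(L2_norm f)\<^sup>2 \<le> (sqrt pi * M)\<^sup>2"
    by (simp add: L2_norm_sq measure_restrict_space power_mult_distrib)
  then show ?thesis by (rule power2_le_imp_le) (use M in auto)
qed

lemma L2_norm_tendsto_uniform:
  assumes u: "uniform_limit {0..pi} f g sequentially"
    and c: "\<And>n. continuous_on {0..pi} (f n)"
  shows "(\<lambda>n. L2_norm (f n - g)) \<longlonglongrightarrow> 0"
proof (rule LIMSEQ_I)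
  have cg: "continuous_on {0..pi} g"
    by (rule uniform_limit_theorem[OF _ u]) (auto simp: c)
  fix r :: real assume r: "r > 0"
  have "\<forall>\<^sub>F n in sequentially. \<forall>x\<in>{0..pi}. dist (f n x) (g x) < r / (2 * sqrt pi)"
    using u r by (intro uniform_limitD) auto
  then obtain N where N: "\<And>n x. n \<ge> N \<Longrightarrow> x \<in> {0..pi} \<Longrightarrow> dist (f n x) (g x) < r / (2 * sqrt pi)"
    unfolding eventually_sequentially by blast
  have "L2_norm (f n - g) < r" if "n \<ge> N" for n
  proof -
    have "L2_norm (f n - g) \<le> sqrt pi * (r / (2 * sqrt pi))"
    proof (rule L2_norm_le_sup)
      show "continuous_on {0..pi} (f n - g)"
        unfolding fun_diff_def by (intro continuous_on_diff c cg)
      show "norm ((f n - g) x) \<le> r / (2 * sqrt pi)" if "x \<in> {0..pi}" for x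
        using N[OF \<open>n \<ge> N\<close> that] by (simp add: dist_norm)
    qed
    also have "\<dots> = r / 2" by simp
    finally show ?thesis using r by simp
  qed
  then show "\<exists>N. \<forall>n\<ge>N. norm (L2_norm (f n - g) - 0) < r" by auto
qed

section \<open>Matrix action and self-adjoint boundary conditions\<close>

lemma bounded_bilinear_matrix_vector_mult:
  "bounded_bilinear ((*v) :: complex^'m^'m \<Rightarrow> complex^'m \<Rightarrow> complex^'m)"
proof (rule bilinear_conv_bounded_bilinear[THEN iffD1])
  have "linear (\<lambda>v. A *v v)" for A :: "complex^'m^'m"
    by (rule linearI) (simp add: matrix_vector_right_distrib, simp add: matrix_vector_mult_def scaleR_sum_right vec_eq_iff)
  moreover have "linear (\<lambda>A. A *v v)" for v :: "complex^'m"
    by (rule linearI) (simp add: matrix_vector_mult_add_rdistrib, simp add: matrix_vector_mult_def scaleR_sum_right vec_eq_iff)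
  ultimately show "bilinear ((*v) :: complex^'m^'m \<Rightarrow> complex^'m \<Rightarrow> complex^'m)" unfolding bilinear_def by blast
qed

lemmas matvec_bounded_linear = bounded_bilinear.bounded_linear_right[OF bounded_bilinear_matrix_vector_mult]

lemma cinner_adjoint: "cinner (A *v v) w = cinner v (dagger A *v w)"
proof -
  have "cinner (A *v v) w = (\<Sum>i\<in>UNIV. \<Sum>j\<in>UNIV. A $ i $ j * v $ j * cnj (w $ i))"
    unfolding cinner_def matrix_vector_mult_def by (simp add: sum_distrib_right)
  also have "\<dots> = (\<Sum>j\<in>UNIV. \<Sum>i\<in>UNIV. A $ i $ j * v $ j * cnj (w $ i))" by (rule sum.swap)
  also have "\<dots> = cinner v (dagger A *v w)"
    unfolding cinner_def matrix_vector_mult_def dagger_def by (simp add: sum_distrib_left mult_ac)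
  finally show ?thesis .
qed

lemma cinner_hermitian: "A = dagger A \<Longrightarrow> cinner (A *v v) w = cinner v (A *v w)"
  by (subst cinner_adjoint) simp

lemma orth_compl_mult_vec: "orth_compl T *v v = v - T *v v"
  by (simp add: orth_compl_def matrix_vector_mult_diff_rdistrib)

lemma mat_mult_vec: "mat c *v v = c *s v" for v :: "complex^'m"
  by (simp add: mat_def matrix_vector_mult_def vec_eq_iff if_distrib[of "\<lambda>x. x * _"] cong: if_cong)

locale boundary_condition =
  fixes T H :: "complex^'m^'m"
  assumes T_herm: "T = dagger T" and T_idem: "T ** T = T"
    and H_herm: "H = dagger H" and H_T: "H = T ** H ** T"
begin

lemma TT: "T *v (T *v v) = T *v v" by (simp add: T_idem matrix_vector_mul_assoc)
lemma TH: "T *v (H *v v) = H *v v"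
  by (subst (1 2) H_T) (simp add: matrix_vector_mul_assoc[symmetric] TT)
lemma HT: "H *v (T *v v) = H *v v"
  by (subst (1 2) H_T) (simp add: matrix_vector_mul_assoc[symmetric] TT)
lemma T_adj: "cinner (T *v v) w = cinner v (T *v w)" by (rule cinner_hermitian[OF T_herm])
lemma H_adj: "cinner (H *v v) w = cinner v (H *v w)" by (rule cinner_hermitian[OF H_herm])

lemma boundary_form_zeroD:
  assumes "boundary_form (*v) T H y y1 = 0"
  shows "T *v y = y" "T *v y1 = H *v y"
proof -
  have 0: "T *v (y1 - H *v y) - (y - T *v y) = 0"
    using assms by (simp add: boundary_form_def orth_compl_mult_vec)
  have "T *v (T *v (y1 - H *v y) - (y - T *v y)) = 0" unfolding 0 by simp
  then have 1: "T *v (y1 - H *v y) = 0" by (simp add: matrix_vector_mult_diff_distrib TT)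
  then show "T *v y = y" using 0 by simp
  show "T *v y1 = H *v y" using 1 by (simp add: matrix_vector_mult_diff_distrib TH)
qed

text \<open>Self-adjointness of the boundary condition: under it the Lagrange bracket reduces to
  \<open>cinner y (H v) - cinner (H y) v\<close>, which is 0 for Hermitian \<open>H\<close>.\<close>

lemma bracket_zero:
  assumes "boundary_form (*v) T H y y1 = 0" "boundary_form (*v) T H v v1 = 0"
  shows "cinner y v1 - cinner y1 v = 0"
proof -
  note y = boundary_form_zeroD[OF assms(1)] and v = boundary_form_zeroD[OF assms(2)]
  have "cinner y v1 = cinner y (H *v v)" by (metis y(1) T_adj v(2))
  moreover have "cinner y1 v = cinner (H *v y) v" by (metis v(1) T_adj y(2))
  ultimately show ?thesis by (simp add: H_adj)
qed

text \<open>Inverse of the linear map that takes a pair of endpoint values to its two boundary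
  expressions: \<open>a\<close> is recovered by \<open>init_dual\<close>, \<open>c\<close> by
  \<open>boundary_form_init\<close>. For \<open>c = 0\<close> these are the initial data of
  \<open>\<phi>(\<cdot>,z) a\<close>.\<close>

definition init :: "complex^'m \<Rightarrow> complex^'m \<Rightarrow> (complex^'m) \<times> (complex^'m)" where
  "init a c = (T *v a - orth_compl T *v c, (orth_compl T + H) *v a + T *v c)"

text \<open>The change of coordinates \<open>init\<close> is symplectic, so in Green's formula the
  endpoint 0 contributes only the standard bracket of the boundary data \<open>a\<close> and
  \<open>c\<close>.\<close>

lemma bracket_init:
  "cinner (fst (init a c)) (snd (init a' c')) - cinner (snd (init a c)) (fst (init a' c')) = cinner a c' - cinner c a'"
proof -
  have [simp]: "cinner (T *v u) (H *v w) = cinner u (H *v w)" "cinner (H *v u) (T *v w) = cinner u (H *v w)"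
    "cinner (T *v u) (T *v w) = cinner u (T *v w)" for u w
    by (simp_all add: T_adj TH TT) (metis HT H_adj)
  have [simp]: "cinner (T *v u) w = cinner u (T *v w)" "cinner (H *v u) w = cinner u (H *v w)" for u w
    by (rule T_adj H_adj)+
  show ?thesis
    by (simp add: init_def orth_compl_mult_vec matrix_vector_mult_add_rdistrib cinner_add_left cinner_add_right
        cinner_diff_left cinner_diff_right TT TH HT matrix_vector_mult_diff_distrib matrix_vector_right_distrib algebra_simps)
qed

lemma boundary_form_init: "boundary_form (*v) T H (fst (init a c)) (snd (init a c)) = c"
  by (simp add: boundary_form_def init_def orth_compl_mult_vec matrix_vector_mult_add_rdistrib TT TH HT
      matrix_vector_mult_diff_distrib matrix_vector_right_distrib algebra_simps)

lemma init_dual: "T *v fst (init a c) + orth_compl T *v snd (init a c) = a"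
  by (simp add: init_def orth_compl_mult_vec matrix_vector_mult_add_rdistrib TT TH HT
      matrix_vector_mult_diff_distrib matrix_vector_right_distrib algebra_simps)

lemma init_of_values:
  "init (T *v y + orth_compl T *v y1) (boundary_form (*v) T H y y1) = (y, y1)"
  by (simp add: boundary_form_def init_def orth_compl_mult_vec matrix_vector_mult_add_rdistrib TT TH HT
      matrix_vector_mult_diff_distrib matrix_vector_right_distrib algebra_simps)

end

section \<open>The first-order system and Lagrange's identity\<close>

definition pair_scale :: "complex \<Rightarrow> (complex^'m) \<times> (complex^'m) \<Rightarrow> (complex^'m) \<times> (complex^'m)" where
  "pair_scale r w = (r *s fst w, r *s snd w)"

lemma bounded_linear_pair_scale: "bounded_linear (pair_scale r)"
  unfolding pair_scale_def
  by (intro bounded_linear_Pair bounded_linear_compose[OF linear_vec_scale] bounded_linear_fst bounded_linear_snd)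

locale sturm_liouville =
  bc1: boundary_condition T1 H1 + bc2: boundary_condition T2 H2
  for T1 H1 T2 H2 :: "complex^'m^'m" +
  fixes \<sigma> :: "real \<Rightarrow> complex^'m^'m"
  assumes \<sigma>_L2: "L2_fun \<sigma>" and \<sigma>_herm: "AE x in leb_pi. \<sigma> x = dagger (\<sigma> x)"
begin

definition sys :: "complex \<Rightarrow> real \<Rightarrow> (complex^'m) \<times> (complex^'m) \<Rightarrow> (complex^'m) \<times> (complex^'m)" where
  "sys z x w = (\<sigma> x *v fst w + snd w, - (\<sigma> x *v snd w) - \<sigma> x *v (\<sigma> x *v fst w) - z *s fst w)"

definition mult_bound :: real where
  "mult_bound = (SOME K. K > 0 \<and> (\<forall>A v. norm ((A :: complex^'m^'m) *v (v :: complex^'m)) \<le> norm A * norm v * K))"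

lemma mult_bound: "mult_bound > 0" "norm ((A :: complex^'m^'m) *v (v :: complex^'m)) \<le> norm A * norm v * mult_bound"
proof -
  have "\<exists>K. K > 0 \<and> (\<forall>A v. norm ((A :: complex^'m^'m) *v (v :: complex^'m)) \<le> norm A * norm v * K)"
    using bounded_bilinear.pos_bounded[OF bounded_bilinear_matrix_vector_mult] by blast
  from someI_ex[OF this] show "mult_bound > 0" "norm (A *v v) \<le> norm A * norm v * mult_bound"
    unfolding mult_bound_def by auto
qed

text \<open>Integrable bound for the part of the system that contains \<open>\<sigma>\<close>; its
  quadratic term is where square integrability of \<open>\<sigma>\<close> is used. The same function
  bounds the growth rate of the energy, independently of the spectral parameter.\<close>

definition ks :: "real \<Rightarrow> real" where "ks x = 2 * (mult_bound * norm (\<sigma> x)) + (mult_bound * norm (\<sigma> x))\<^sup>2"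

lemma ks_int: "ks absolutely_integrable_on {0..pi}"
  unfolding ks_def integrable_leb_pi_iff[symmetric]
  using \<sigma>_L2 L2_fun_integrable[OF \<sigma>_L2]
  by (auto simp: L2_fun_def power_mult_distrib)

lemma ks_nonneg: "0 \<le> ks x" using mult_bound(1) by (simp add: ks_def)

definition k :: "complex \<Rightarrow> real \<Rightarrow> real" where "k z x = ks x + (1 + cmod z)"

lemma k_int: "k z absolutely_integrable_on {0..pi}"
  unfolding k_def by (intro set_integral_add ks_int absolutely_integrable_on_const) auto

lemma integral_k: "integral {0..pi} (k z) = integral {0..pi} ks + pi * (1 + cmod z)"
  unfolding k_def using set_lebesgue_integral_eq_integral(1)[OF ks_int]
  by (subst Henstock_Kurzweil_Integration.integral_add) auto

lemma measurable_\<sigma>_vec: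
  fixes y :: "real \<Rightarrow> complex^'m"
  assumes "y \<in> borel_measurable (lebesgue_on {0..pi})"
  shows "(\<lambda>x. \<sigma> x *v y x) \<in> borel_measurable (lebesgue_on {0..pi})"
proof (rule borel_measurable_bilinear[where h="(*v)" and f=\<sigma> and g=y])
  show "\<sigma> \<in> borel_measurable (lebesgue_on {0..pi})"
    using \<sigma>_L2 by (intro borel_measurable_Ioo_Icc) (simp add: L2_fun_def)
  show "bilinear ((*v) :: complex^'m^'m \<Rightarrow> complex^'m \<Rightarrow> complex^'m)"
    using bounded_bilinear_matrix_vector_mult by (simp add: bilinear_conv_bounded_bilinear)
qed (use assms in auto)

lemma ode: "linear_ode pi (sys z) (k z)"
proof (rule linear_ode.intro)
  show "0 \<le> pi" by simp
  show "k z absolutely_integrable_on {0..pi}" by (rule k_int)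
  show "0 \<le> k z x" for x using ks_nonneg by (simp add: k_def)
  show "linear (sys z x)" for x
    unfolding sys_def
    by (rule linearI)
      (auto simp: matrix_vector_right_distrib vec.scale_right_distrib linear_cmul[OF bounded_linear.linear[OF matvec_bounded_linear]]
        linear_cmul[OF bounded_linear.linear[OF linear_vec_scale]] algebra_simps)
  show "norm (sys z x w) \<le> k z x * norm w" for x w
  proof -
    let ?s = "mult_bound * norm (\<sigma> x)"
    have s: "?s \<ge> 0" using mult_bound(1) by simp
    have n: "norm (fst w) \<le> norm w" "norm (snd w) \<le> norm w" by (cases w; simp add: norm_Pair real_le_rsqrt)+
    have sv: "norm (\<sigma> x *v v) \<le> ?s * r" if "norm v \<le> r" for v r
    proof -
      have "norm (\<sigma> x *v v) \<le> ?s * norm v" using mult_bound(2)[of "\<sigma> x" v] by (simp add: mult_ac)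
      also have "\<dots> \<le> ?s * r" by (rule mult_left_mono[OF that s])
      finally show ?thesis .
    qed
    have "norm (sys z x w) \<le> norm (fst (sys z x w)) + norm (snd (sys z x w))"
      by (metis norm_Pair_le prod.collapse)
    also have "norm (fst (sys z x w)) \<le> ?s * norm w + norm w"
      unfolding sys_def fst_conv by (intro norm_triangle_le add_mono sv n)
    also have "norm (snd (sys z x w)) \<le> ?s * norm w + ?s * (?s * norm w) + cmod z * norm w"
      unfolding sys_def snd_conv
      by (intro norm_triangle_le_diff add_mono sv n)
        (auto simp: norm_scale_vec intro!: mult_left_mono sv n)
    finally show ?thesis by (simp add: k_def ks_def power2_eq_square algebra_simps)
  qed
  fix y :: "real \<Rightarrow> (complex^'m) \<times> (complex^'m)" assume y: "continuous_on {0..pi} y"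
  have m: "(\<lambda>x. fst (y x)) \<in> borel_measurable (lebesgue_on {0..pi})"
    "(\<lambda>x. snd (y x)) \<in> borel_measurable (lebesgue_on {0..pi})"
    using y by (auto intro!: continuous_imp_measurable_on_sets_lebesgue continuous_intros)
  have "(\<lambda>x. z *s fst (y x)) \<in> borel_measurable (lebesgue_on {0..pi})"
    using y by (auto intro!: continuous_imp_measurable_on_sets_lebesgue continuous_intros
        bounded_linear.continuous_on[OF linear_vec_scale])
  then show "(\<lambda>x. sys z x (y x)) \<in> borel_measurable (lebesgue_on {0..pi})"
    unfolding sys_def
    by (intro borel_measurable_Pair borel_measurable_add borel_measurable_diff borel_measurable_uminus measurable_\<sigma>_vec m)
qed

abbreviation "sol z \<equiv> linear_ode.is_sol pi (sys z)"

text \<open>The sign matches \<open>\<ell>Y = zY + f\<close>, because \<open>\<ell>\<close> contains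
  minus the derivative of the second component.\<close>

definition force :: "(real \<Rightarrow> complex^'m) \<Rightarrow> real \<Rightarrow> (complex^'m) \<times> (complex^'m)" where
  "force f t = (0, - f t)"

lemma force_int: "L2_fun f \<Longrightarrow> force f absolutely_integrable_on {0..pi}"
proof -
  assume "L2_fun f"
  then have "integrable leb_pi f" by (rule L2_fun_integrable)
  then have "integrable leb_pi (\<lambda>t. (\<lambda>v. (0 :: complex^'m, - v)) (f t))"
    by (intro integrable_bounded_linear[of "\<lambda>v. (0 :: complex^'m, - v)"] bounded_linear_Pair bounded_linear_zero
        bounded_linear_minus bounded_linear_ident)
  then show ?thesis unfolding integrable_leb_pi_iff force_def .
qed

lemma sol_unfold:
  assumes "L2_fun f"
  shows "sol z (force f) p w \<longleftrightarrow> abs_cont_on {0..pi} (\<lambda>x. fst (w x)) \<and> abs_cont_on {0..pi} (\<lambda>x. snd (w x)) \<and> w 0 = p \<and>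
     (AE x in leb_pi. ((\<lambda>x. fst (w x)) has_vector_derivative \<sigma> x *v fst (w x) + snd (w x)) (at x)) \<and>
     (AE x in leb_pi. ((\<lambda>x. snd (w x)) has_vector_derivative
        - (\<sigma> x *v snd (w x)) - \<sigma> x *v (\<sigma> x *v fst (w x)) - z *s fst (w x) - f x) (at x))"
proof -
  have 1: "abs_cont_on {0..pi} w \<longleftrightarrow> abs_cont_on {0..pi} (\<lambda>x. fst (w x)) \<and> abs_cont_on {0..pi} (\<lambda>x. snd (w x))"
  proof (intro iffI conjI; (elim conjE)?)
    assume a: "abs_cont_on {0..pi} (\<lambda>x. fst (w x))" "abs_cont_on {0..pi} (\<lambda>x. snd (w x))"
    show "abs_cont_on {0..pi} w"
      by (rule abs_cont_on_dominated[OF a, of _ 1])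
        (metis fst_diff mult_1 norm_Pair_le prod.collapse snd_diff)
  qed (auto intro: abs_cont_on_linear bounded_linear_fst bounded_linear_snd)
  have 2: "(w has_vector_derivative d) (at x) \<longleftrightarrow>
      ((\<lambda>x. fst (w x)) has_vector_derivative fst d) (at x) \<and> ((\<lambda>x. snd (w x)) has_vector_derivative snd d) (at x)" for d x
  proof (intro iffI conjI; (elim conjE)?)
    assume "((\<lambda>x. fst (w x)) has_vector_derivative fst d) (at x)" "((\<lambda>x. snd (w x)) has_vector_derivative snd d) (at x)"
    then have "((\<lambda>x. (fst (w x), snd (w x))) has_vector_derivative (fst d, snd d)) (at x)"
      by (rule has_vector_derivative_Pair)
    then show "(w has_vector_derivative d) (at x)" by simp
  qed (auto intro: bounded_linear.has_vector_derivative bounded_linear_fst bounded_linear_snd)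
  show ?thesis
    unfolding linear_ode.is_sol_iff[OF ode force_int[OF assms]] 1 2
    by (simp add: sys_def force_def)
qed

lemma sol_iff_solution:
  "sol z (force 0) (y0, u0) (\<lambda>x. (y x, u x)) \<longleftrightarrow> solution (*v) \<sigma> z y u \<and> y 0 = y0 \<and> u 0 = u0"
proof -
  have 1: "(\<exists>Y'. (y has_vector_derivative Y') (at x) \<and> u x = Y' - \<sigma> x *v y x) \<longleftrightarrow>
      (y has_vector_derivative \<sigma> x *v y x + u x) (at x)" for x
    by (auto simp: algebra_simps)
  have 2: "(\<exists>d. (u has_vector_derivative d) (at x) \<and> - d - \<sigma> x *v u x - (\<sigma> x ** \<sigma> x) *v y x = mat z *v y x) \<longleftrightarrow>
      (u has_vector_derivative - (\<sigma> x *v u x) - \<sigma> x *v (\<sigma> x *v y x) - z *s y x - 0) (at x)" for x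
  proof -
    have "- d - \<sigma> x *v u x - (\<sigma> x ** \<sigma> x) *v y x = mat z *v y x \<longleftrightarrow>
        d = - (\<sigma> x *v u x) - \<sigma> x *v (\<sigma> x *v y x) - z *s y x" for d
      unfolding mat_mult_vec matrix_vector_mul_assoc[symmetric]
    proof
      assume h: "- d - \<sigma> x *v u x - \<sigma> x *v (\<sigma> x *v y x) = z *s y x"
      show "d = - (\<sigma> x *v u x) - \<sigma> x *v (\<sigma> x *v y x) - z *s y x"
        unfolding h[symmetric] by simp
    qed simp
    then show ?thesis by simp
  qed
  show ?thesis
    unfolding sol_unfold[OF L2_fun_zero] solution_def quasi_derivative_def fst_conv snd_conv 1 2
    by auto
qed

lemma sol_exists: "L2_fun f \<Longrightarrow> \<exists>w. sol z (force f) p w"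
  by (rule linear_ode.is_sol_exists[OF ode force_int])

lemma sol_unique: "L2_fun f \<Longrightarrow> sol z (force f) p w \<Longrightarrow> sol z (force f) p v \<Longrightarrow> x \<in> {0..pi} \<Longrightarrow> w x = v x"
  by (rule linear_ode.is_sol_unique[OF ode _ _ force_int])

lemma sol_lin:
  assumes f: "L2_fun f" "L2_fun g" and w: "sol z (force f) p w" "sol z (force g) q v"
  shows "sol z (force (f + fun_scale r g)) (p + pair_scale r q) (\<lambda>x. w x + pair_scale r (v x))"
proof -
  \<comment> \<open>The multiple \<open>-r\<close> is prepared because the sum is then formed with
    \<open>is_sol_diff\<close>.\<close>
  have "sol z (\<lambda>t. pair_scale (-r) (force g t)) (pair_scale (-r) q) (\<lambda>x. pair_scale (-r) (v x))"
  proof (rule linear_ode.is_sol_linear[OF ode bounded_linear_pair_scale _ w(2) force_int[OF f(2)]])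
    show "pair_scale (-r) (sys z t u) = sys z t (pair_scale (-r) u)" for t u
      by (simp add: pair_scale_def sys_def vector_scalar_commute vec.scale_right_distrib
          vec.scale_right_diff_distrib vec.scale_minus_left vec.neg mult.commute matrix_vector_right_distrib)
  qed
  then have v: "sol z (force (fun_scale (-r) g)) (pair_scale (-r) q) (\<lambda>x. pair_scale (-r) (v x))"
    by (simp add: force_def[abs_def] pair_scale_def fun_scale_def)
  have "sol z (\<lambda>t. force f t - force (fun_scale (-r) g) t) (p - pair_scale (-r) q) (\<lambda>x. w x - pair_scale (-r) (v x))"
    by (intro linear_ode.is_sol_diff[OF ode w(1) v] force_int f L2_fun_scale)
  moreover have "(\<lambda>t. force f t - force (fun_scale (-r) g) t) = force (f + fun_scale r g)"
    by (simp add: force_def fun_eq_iff fun_scale_def plus_fun_def vec.scale_minus_left)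
  moreover have "p - pair_scale (-r) q = p + pair_scale r q" for p q :: "(complex^'m) \<times> (complex^'m)"
    by (simp add: pair_scale_def prod_eq_iff vec.scale_minus_left)
  ultimately show ?thesis by simp
qed

text \<open>A change of the spectral parameter is absorbed into the force. Continuity in the
  parameter thus becomes continuity in the force, which the a priori bound provides.\<close>

lemma sol_shift:
  assumes w: "sol z (force f) p w" and "continuous_on {0..pi} (\<lambda>x. fst (w x))"
  shows "sol \<zeta> (force (f + fun_scale (z - \<zeta>) (\<lambda>x. fst (w x)))) p w"
proof -
  have "sys z t (w t) + force f t = sys \<zeta> t (w t) + force (f + fun_scale (z - \<zeta>) (\<lambda>x. fst (w x))) t" for t
    by (simp add: sys_def force_def fun_scale_def plus_fun_def vec.scale_left_diff_distrib)
  then show ?thesis using w by (simp add: linear_ode.is_sol_def[OF ode])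
qed

lemma sol_continuous:
  assumes "sol z (force f) p w"
  shows "continuous_on {0..pi} w" "continuous_on {0..pi} (\<lambda>x. fst (w x))" "L2_fun (\<lambda>x. fst (w x))"
proof -
  show c: "continuous_on {0..pi} w" using assms by (simp add: linear_ode.is_sol_def[OF ode])
  then show "continuous_on {0..pi} (\<lambda>x. fst (w x))" by (rule continuous_on_fst)
  then show "L2_fun (\<lambda>x. fst (w x))" by (rule L2_fun_continuous)
qed

text \<open>In the derivative of the bracket all terms with \<open>\<sigma>\<close> cancel since
  \<open>\<sigma>\<close> is Hermitian, and the products of the two second components cancel as
  well. What remains is integrable and the fundamental theorem applies.\<close>

lemma lagrange_identity:
  assumes f: "L2_fun f" and g: "L2_fun g" and w: "sol z (force f) p w" and v: "sol \<zeta> (force g) q v"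
  defines "br \<equiv> \<lambda>x. cinner (fst (w x)) (snd (v x)) - cinner (snd (w x)) (fst (v x))"
  shows "br pi - br 0 = (z - cnj \<zeta>) * L2_inner (\<lambda>x. fst (w x)) (\<lambda>x. fst (v x)) +
     L2_inner f (\<lambda>x. fst (v x)) - L2_inner (\<lambda>x. fst (w x)) g"
proof -
  note W = w[unfolded sol_unfold[OF f]] and V = v[unfolded sol_unfold[OF g]]
  let ?y = "\<lambda>x. fst (w x)" and ?y1 = "\<lambda>x. snd (w x)" and ?v = "\<lambda>x. fst (v x)" and ?v1 = "\<lambda>x. snd (v x)"
  let ?h = "\<lambda>x. (z - cnj \<zeta>) * cinner (?y x) (?v x) + cinner (f x) (?v x) - cinner (?y x) (g x)"
  have "AE x in leb_pi. (br has_vector_derivative ?h x) (at x)"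
    using W[THEN conjunct2, THEN conjunct2, THEN conjunct2, THEN conjunct1]
      W[THEN conjunct2, THEN conjunct2, THEN conjunct2, THEN conjunct2]
      V[THEN conjunct2, THEN conjunct2, THEN conjunct2, THEN conjunct1]
      V[THEN conjunct2, THEN conjunct2, THEN conjunct2, THEN conjunct2] \<sigma>_herm
  proof eventually_elim
    case (elim x)
    let ?dy = "\<sigma> x *v ?y x + ?y1 x" and ?dy1 = "- (\<sigma> x *v ?y1 x) - \<sigma> x *v (\<sigma> x *v ?y x) - z *s ?y x - f x"
    let ?dv = "\<sigma> x *v ?v x + ?v1 x" and ?dv1 = "- (\<sigma> x *v ?v1 x) - \<sigma> x *v (\<sigma> x *v ?v x) - \<zeta> *s ?v x - g x"
    have "(br has_vector_derivative (cinner (?y x) ?dv1 + cinner ?dy (?v1 x)) - (cinner (?y1 x) ?dv + cinner ?dy1 (?v x))) (at x)"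
      unfolding br_def
      by (intro has_vector_derivative_diff bounded_bilinear.has_vector_derivative[OF bounded_bilinear_cinner] elim)
    moreover have [simp]: "cinner (\<sigma> x *v u) u' = cinner u (\<sigma> x *v u')" for u u'
      by (rule cinner_hermitian[OF elim(5)])
    have "(cinner (?y x) ?dv1 + cinner ?dy (?v1 x)) - (cinner (?y1 x) ?dv + cinner ?dy1 (?v x)) = ?h x"
      by (simp add: cinner_add_left cinner_add_right cinner_diff_left cinner_diff_right cinner_minus_left
          cinner_minus_right cinner_scale_left cinner_scale_right algebra_simps)
    ultimately show ?case by simp
  qed
  then have N: "negligible {x \<in> {0<..<pi}. \<not> (br has_vector_derivative ?h x) (at x)}" (is "negligible ?N")
    by (subst (asm) AE_lebesgue_on_iff_negligible) auto
  have ac: "abs_cont_on {0..pi} br"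
  proof -
    have ac: "abs_cont_on {0..pi} ?y" "abs_cont_on {0..pi} ?y1" "abs_cont_on {0..pi} ?v" "abs_cont_on {0..pi} ?v1"
      using W V by blast+
    have "abs_cont_on {0..pi} (\<lambda>x. cinner (?y x) (?v1 x) + - cinner (?y1 x) (?v x))"
      by (rule abs_cont_on_add[OF abs_cont_on_bilinear[OF bounded_bilinear_cinner ac(1,4)]
            abs_cont_on_linear[OF bounded_linear_minus[OF bounded_linear_ident]
              abs_cont_on_bilinear[OF bounded_bilinear_cinner ac(2,3)]]])
    then show ?thesis by (simp add: br_def)
  qed
  have "(?h has_integral br pi - br 0) {0..pi}"
    by (rule fundamental_theorem_of_calculus_abs_cont[OF _ ac N]) auto
  then have "br pi - br 0 = integral {0..pi} ?h" by (simp add: integral_unique)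
  also have "\<dots> = (LINT x|leb_pi. ?h x)"
    using L2_inner_integrable[OF sol_continuous(3)[OF w] sol_continuous(3)[OF v]]
      L2_inner_integrable[OF f sol_continuous(3)[OF v]] L2_inner_integrable[OF sol_continuous(3)[OF w] g]
    by (intro lebesgue_integral_leb_pi[symmetric]) auto
  also have "\<dots> = (z - cnj \<zeta>) * L2_inner ?y ?v + L2_inner f ?v - L2_inner ?y g"
    unfolding L2_inner_def
    using L2_inner_integrable[OF sol_continuous(3)[OF w] sol_continuous(3)[OF v]]
      L2_inner_integrable[OF f sol_continuous(3)[OF v]] L2_inner_integrable[OF sol_continuous(3)[OF w] g]
    by simp
  finally show ?thesis .
qed

end

text \<open>\<open>P\<close> characterizes the possible cluster points; if it admits only one, a
  bounded sequence converges to it. Subsequences are given by index maps tending to infinity,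
  without monotonicity, so that they compose freely.\<close>

lemma bounded_unique_cluster:
  fixes a :: "nat \<Rightarrow> 'a::heine_borel"
  assumes bdd: "bounded (range a)"
    and cl: "\<And>r l. filterlim r at_top sequentially \<Longrightarrow> (\<lambda>n. a (r n)) \<longlonglongrightarrow> l \<Longrightarrow> P l"
    and un: "\<And>l l'. P l \<Longrightarrow> P l' \<Longrightarrow> l = l'"
  shows "\<exists>l. P l \<and> a \<longlonglongrightarrow> l"
proof -
  have sub: "\<exists>r l. filterlim r at_top sequentially \<and> (\<lambda>n. a (q (r n))) \<longlonglongrightarrow> l" for q :: "nat \<Rightarrow> nat"
  proof -
    have "bounded (range (\<lambda>n. a (q n)))" by (rule bounded_subset[OF bdd]) auto
    then obtain l r where "strict_mono r" "((\<lambda>n. a (q n)) \<circ> r) \<longlonglongrightarrow> l"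
      using bounded_imp_convergent_subsequence by blast
    then show ?thesis using filterlim_subseq[of r] by (auto simp: comp_def)
  qed
  obtain r l where rl: "filterlim r at_top sequentially" "(\<lambda>n. a (r n)) \<longlonglongrightarrow> l"
    using sub[of id] by auto
  have "a \<longlonglongrightarrow> l"
  proof (rule ccontr)
    assume "\<not> a \<longlonglongrightarrow> l"
    then obtain e where e: "e > 0" "\<forall>N. \<exists>n\<ge>N. \<not> dist (a n) l < e" unfolding lim_sequentially by blast
    then obtain q where q: "\<And>N. q N \<ge> N" "\<And>N. \<not> dist (a (q N)) l < e" by metis
    have qt: "filterlim q at_top sequentially"
      by (rule filterlim_at_top_mono[OF filterlim_ident]) (use q(1) in auto)
    obtain r' l' where r': "filterlim r' at_top sequentially" "(\<lambda>n. a (q (r' n))) \<longlonglongrightarrow> l'"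
      using sub by blast
    have "P l'" by (rule cl[OF filterlim_compose[OF qt r'(1)]]) (use r'(2) in simp)
    moreover have "P l" by (rule cl[OF rl])
    ultimately have "l' = l" by (rule un)
    then have "\<forall>\<^sub>F n in sequentially. dist (a (q (r' n))) l < e"
      using r'(2) e(1) by (auto simp: tendsto_iff)
    then obtain n where "dist (a (q (r' n))) l < e" by (meson eventually_sequentially order_refl)
    then show False using q(2) by blast
  qed
  moreover have "P l" by (rule cl[OF rl])
  ultimately show ?thesis by blast
qed

lemma continuous_AE_zero:
  fixes f :: "real \<Rightarrow> 'a::real_normed_vector"
  assumes c: "continuous_on {0..pi} f" and ae: "AE x in leb_pi. f x = 0" and x: "x \<in> {0..pi}"
  shows "f x = 0"
proof -
  let ?N = "{x \<in> {0<..<pi}. f x \<noteq> 0}"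
  have "continuous_on {0<..<pi} f" by (rule continuous_on_subset[OF c]) auto
  then have "open ({0<..<pi} \<inter> f -` (- {0}))" by (rule continuous_open_preimage) auto
  moreover have "{0<..<pi} \<inter> f -` (- {0}) = ?N" by auto
  moreover have "negligible ?N" using ae by (subst (asm) AE_lebesgue_on_iff_negligible) auto
  ultimately have "?N = {}" using open_not_negligible by metis
  then have z: "f t = 0" if "t \<in> {0<..<pi}" for t using that by blast
  have cl: "closure {0<..<pi} = {0..pi}" by simp
  show ?thesis
    by (rule continuous_constant_on_closure[of "{0<..<pi}" f 0 x]) (use c x z in \<open>auto simp: cl\<close>)
qed

section \<open>Matrix solutions and their columns\<close>

lemma abs_cont_on_sum:
  "(\<And>j. j \<in> S \<Longrightarrow> abs_cont_on I (f j)) \<Longrightarrow> abs_cont_on I (\<lambda>x. \<Sum>j\<in>S. f j x)"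
  by (induction S rule: infinite_finite_induct) (auto intro: abs_cont_on_add abs_cont_on_const)

text \<open>Embeds a vector as the column \<open>j\<close>. A matrix function becomes a finite sum
  of such embeddings, so derivatives and products pass through by linearity.\<close>

definition column_matrix :: "'m \<Rightarrow> complex^'m \<Rightarrow> complex^'m^'m" where
  "column_matrix j v = (\<chi> i k. if k = j then v $ i else 0)"

lemma bounded_linear_column_matrix: "bounded_linear (column_matrix j)"
proof -
  have "linear (column_matrix j)"
    by (rule linearI) (auto simp: column_matrix_def vec_eq_iff)
  then show ?thesis by (simp add: linear_conv_bounded_linear)
qed

lemma matrix_mult_column_matrix: "A ** column_matrix j v = column_matrix j (A *v v)"
  by (simp add: column_matrix_def matrix_matrix_mult_def matrix_vector_mult_def vec_eq_iff)

lemma sum_column_matrix_column: "(\<Sum>j\<in>UNIV. column_matrix j (column j A)) = A"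
  by (simp add: column_matrix_def vec_eq_iff column_def)

lemma matrix_mult_sum: "A ** (\<Sum>j\<in>S. B j) = (\<Sum>j\<in>S. A ** B j)" for A :: "complex^'m^'m"
  by (induction S rule: infinite_finite_induct) (auto simp: matrix_add_ldistrib)

lemma matvec_bounded_linear_left: "bounded_linear (\<lambda>A :: complex^'m^'m. A *v v)"
  by (rule bounded_bilinear.bounded_linear_left[OF bounded_bilinear_matrix_vector_mult])

lemma solution_matrix_vec:
  fixes Y :: "real \<Rightarrow> complex^'m^'m"
  assumes "solution (**) \<sigma> \<mu> Y Y1"
  shows "solution (*v) \<sigma> \<mu> (\<lambda>x. Y x *v v) (\<lambda>x. Y1 x *v v)"
  unfolding solution_def quasi_derivative_def
proof (intro conjI)
  note a = assms[unfolded solution_def quasi_derivative_def]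
  show "abs_cont_on {0..pi} (\<lambda>x. Y x *v v)" "abs_cont_on {0..pi} (\<lambda>x. Y1 x *v v)"
    using a by (auto intro: abs_cont_on_linear[OF matvec_bounded_linear_left])
  show "AE x in leb_pi. \<exists>Y'. ((\<lambda>x. Y x *v v) has_vector_derivative Y') (at x) \<and> Y1 x *v v = Y' - \<sigma> x *v (Y x *v v)"
    using a[THEN conjunct2, THEN conjunct2, THEN conjunct1]
  proof eventually_elim
    case (elim x)
    then obtain Y' where Y': "(Y has_vector_derivative Y') (at x)" "Y1 x = Y' - \<sigma> x ** Y x" by blast
    show ?case
      by (rule exI[of _ "Y' *v v"])
        (auto intro!: bounded_linear.has_vector_derivative[OF matvec_bounded_linear_left Y'(1)]
          simp: Y'(2) matrix_vector_mult_diff_rdistrib matrix_vector_mul_assoc)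
  qed
  show "AE x in leb_pi. \<exists>Y1'. ((\<lambda>x. Y1 x *v v) has_vector_derivative Y1') (at x) \<and>
      - Y1' - \<sigma> x *v (Y1 x *v v) - (\<sigma> x ** \<sigma> x) *v (Y x *v v) = mat \<mu> *v (Y x *v v)"
    using a[THEN conjunct2, THEN conjunct2, THEN conjunct2]
  proof eventually_elim
    case (elim x)
    then obtain D where D: "(Y1 has_vector_derivative D) (at x)"
      "- D - \<sigma> x ** Y1 x - \<sigma> x ** \<sigma> x ** Y x = mat \<mu> ** Y x" by blast
    have "(- D - \<sigma> x ** Y1 x - \<sigma> x ** \<sigma> x ** Y x) *v v = (mat \<mu> ** Y x) *v v" by (simp only: D)
    moreover have "(- D) *v v = - (D *v v)"
      using linear_neg[OF bounded_linear.linear[OF matvec_bounded_linear_left]] by blast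
    ultimately show ?case
      by (intro exI[of _ "D *v v"] conjI bounded_linear.has_vector_derivative[OF matvec_bounded_linear_left D(1)])
        (simp add: matrix_vector_mult_diff_rdistrib matrix_vector_mul_assoc)
  qed
qed

text \<open>Supplies witnesses for the matrix solutions that \<open>phi\<close> and the Weyl
  solution select by choice; their existence is proved for vectors.\<close>

lemma solution_of_columns:
  fixes y u :: "'m::finite \<Rightarrow> real \<Rightarrow> complex^'m"
  assumes s: "\<And>j. solution (*v) \<sigma> \<mu> (y j) (u j)"
  shows "solution (**) \<sigma> \<mu> (\<lambda>x. \<Sum>j\<in>UNIV. column_matrix j (y j x)) (\<lambda>x. \<Sum>j\<in>UNIV. column_matrix j (u j x))"
  unfolding solution_def quasi_derivative_def
proof (intro conjI)
  note a = s[unfolded solution_def quasi_derivative_def]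
  show "abs_cont_on {0..pi} (\<lambda>x. \<Sum>j\<in>UNIV. column_matrix j (y j x))"
    "abs_cont_on {0..pi} (\<lambda>x. \<Sum>j\<in>UNIV. column_matrix j (u j x))"
    using a by (auto intro!: abs_cont_on_sum abs_cont_on_linear[OF bounded_linear_column_matrix])
  have lin: "linear (column_matrix j)" for j :: 'm
    by (rule bounded_linear.linear[OF bounded_linear_column_matrix])
  have "AE x in leb_pi. \<forall>j\<in>UNIV. \<exists>Y'. (y j has_vector_derivative Y') (at x) \<and> u j x = Y' - \<sigma> x *v y j x"
    using a by (intro eventually_ball_finite) auto
  then show "AE x in leb_pi. \<exists>Y'. ((\<lambda>x. \<Sum>j\<in>UNIV. column_matrix j (y j x)) has_vector_derivative Y') (at x) \<and>
      (\<Sum>j\<in>UNIV. column_matrix j (u j x)) = Y' - \<sigma> x ** (\<Sum>j\<in>UNIV. column_matrix j (y j x))"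
  proof eventually_elim
    case (elim x)
    then obtain d where d: "\<And>j. (y j has_vector_derivative d j) (at x)" "\<And>j. u j x = d j - \<sigma> x *v y j x"
      using bchoice[OF elim] by blast
    show ?case
      by (rule exI[of _ "\<Sum>j\<in>UNIV. column_matrix j (d j)"])
        (auto intro!: has_vector_derivative_sum bounded_linear.has_vector_derivative[OF bounded_linear_column_matrix] d(1)
          simp: d(2) linear_diff[OF lin] sum_subtractf matrix_mult_sum matrix_mult_column_matrix)
  qed
  have "AE x in leb_pi. \<forall>j\<in>UNIV. \<exists>Y1'. (u j has_vector_derivative Y1') (at x) \<and>
      - Y1' - \<sigma> x *v u j x - (\<sigma> x ** \<sigma> x) *v y j x = mat \<mu> *v y j x"
    using a by (intro eventually_ball_finite) auto
  then show "AE x in leb_pi. \<exists>Y1'. ((\<lambda>x. \<Sum>j\<in>UNIV. column_matrix j (u j x)) has_vector_derivative Y1') (at x) \<and>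
      - Y1' - \<sigma> x ** (\<Sum>j\<in>UNIV. column_matrix j (u j x)) - \<sigma> x ** \<sigma> x ** (\<Sum>j\<in>UNIV. column_matrix j (y j x)) =
      mat \<mu> ** (\<Sum>j\<in>UNIV. column_matrix j (y j x))"
  proof eventually_elim
    case (elim x)
    then obtain d where d: "\<And>j. (u j has_vector_derivative d j) (at x)"
      "\<And>j. - d j - \<sigma> x *v u j x - (\<sigma> x ** \<sigma> x) *v y j x = mat \<mu> *v y j x"
      using bchoice[OF elim] by blast
    have "- (\<Sum>j\<in>UNIV. column_matrix j (d j)) - \<sigma> x ** (\<Sum>j\<in>UNIV. column_matrix j (u j x)) -
        \<sigma> x ** \<sigma> x ** (\<Sum>j\<in>UNIV. column_matrix j (y j x)) =
        (\<Sum>j\<in>UNIV. column_matrix j (- d j - \<sigma> x *v u j x - (\<sigma> x ** \<sigma> x) *v y j x))"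
      by (simp add: linear_diff[OF lin] linear_neg[OF lin] sum_subtractf sum_negf matrix_mult_sum matrix_mult_column_matrix)
    also have "\<dots> = mat \<mu> ** (\<Sum>j\<in>UNIV. column_matrix j (y j x))"
      by (simp add: d(2) matrix_mult_sum matrix_mult_column_matrix)
    finally show ?case
      by (intro exI[of _ "\<Sum>j\<in>UNIV. column_matrix j (d j)"] conjI has_vector_derivative_sum
          bounded_linear.has_vector_derivative[OF bounded_linear_column_matrix] d(1))
  qed
qed

section \<open>Solutions parametrized by boundary data at 0\<close>

context sturm_liouville
begin

text \<open>\<open>U f z a c s\<close> is the solution of \<open>\<ell>Y = zY + s f\<close> with \<open>V\<^sub>1\<^sup>\<bottom>(Y) = a\<close> and \<open>V\<^sub>1(Y) = c\<close>,
  paired with its quasi-derivative; \<open>phi_vec z a\<close> is \<open>\<phi>(\<cdot>,z) a\<close>.\<close>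

definition U :: "(real \<Rightarrow> complex^'m) \<Rightarrow> complex \<Rightarrow> complex^'m \<Rightarrow> complex^'m \<Rightarrow> complex \<Rightarrow> real \<Rightarrow> (complex^'m) \<times> (complex^'m)" where
  "U f z a c s = (SOME w. sol z (force (fun_scale s f)) (bc1.init a c) w)"

lemma U: "L2_fun f \<Longrightarrow> sol z (force (fun_scale s f)) (bc1.init a c) (U f z a c s)"
  unfolding U_def by (rule someI_ex[OF sol_exists[OF L2_fun_scale]])

abbreviation "y f z a c s \<equiv> (\<lambda>x. fst (U f z a c s x))"

definition phi_vec :: "complex \<Rightarrow> complex^'m \<Rightarrow> real \<Rightarrow> (complex^'m) \<times> (complex^'m)" where
  "phi_vec z a = U 0 z a 0 0"

lemma U_no_force: "U f z a 0 0 = phi_vec z a"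
  by (simp add: U_def phi_vec_def)

lemma phi_vec: "sol z (force 0) (bc1.init a 0) (phi_vec z a)"
  using U[OF L2_fun_zero, of z 0 a 0] by (simp add: phi_vec_def)

lemma U_L2: "L2_fun f \<Longrightarrow> L2_fun (y f z a c s)"
  by (rule sol_continuous(3)[OF U])

lemma phi_vec_L2: "L2_fun (\<lambda>x. fst (phi_vec z a x))"
  by (rule sol_continuous(3)[OF phi_vec])

lemma U_at_0: "L2_fun f \<Longrightarrow> U f z a c s 0 = bc1.init a c"
  using U[of f z s a c] by (simp add: sol_unfold[OF L2_fun_scale])

lemma init_lin: "bc1.init (a + r *s a') (c + r *s c') = bc1.init a c + pair_scale r (bc1.init a' c')"
  by (simp add: bc1.init_def pair_scale_def matrix_vector_right_distrib vector_scalar_commute vec.scale_right_distrib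
      vec.scale_right_diff_distrib algebra_simps)

lemma U_lin:
  assumes f: "L2_fun f" and x: "x \<in> {0..pi}"
  shows "U f z (a + r *s a') (c + r *s c') (s + r * s') x = U f z a c s x + pair_scale r (U f z a' c' s' x)"
proof (rule sol_unique[OF _ _ _ x])
  show "L2_fun (fun_scale (s + r * s') f)" by (rule L2_fun_scale[OF f])
  show "sol z (force (fun_scale (s + r * s') f)) (bc1.init (a + r *s a') (c + r *s c')) (U f z (a + r *s a') (c + r *s c') (s + r * s'))"
    by (rule U[OF f])
  have "sol z (force (fun_scale s f + fun_scale r (fun_scale s' f))) (bc1.init a c + pair_scale r (bc1.init a' c'))
      (\<lambda>x. U f z a c s x + pair_scale r (U f z a' c' s' x))"
    by (intro sol_lin L2_fun_scale f U)
  then show "sol z (force (fun_scale (s + r * s') f)) (bc1.init (a + r *s a') (c + r *s c'))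
      (\<lambda>x. U f z a c s x + pair_scale r (U f z a' c' s' x))"
    by (simp add: init_lin fun_scale.scale_left_distrib)
qed

lemma pair_scale_m1: "w + pair_scale (-1) w = 0"
  by (simp add: pair_scale_def prod_eq_iff)

lemma U_scale:
  assumes "L2_fun f" "x \<in> {0..pi}"
  shows "U f z (r *s a) (r *s c) (r * s) x = pair_scale r (U f z a c s x)"
proof -
  have "U f z (a + (-1) *s a) (c + (-1) *s c) (s + (-1) * s) x = 0"
    by (simp only: U_lin[OF assms] pair_scale_m1)
  then have 0: "U f z 0 0 0 x = 0" by simp
  show ?thesis using U_lin[OF assms, of z 0 r a 0 c 0 s] by (simp add: 0)
qed

lemma phi_vec_lin: "x \<in> {0..pi} \<Longrightarrow> phi_vec z (a + r *s a') x = phi_vec z a x + pair_scale r (phi_vec z a' x)"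
  using U_lin[OF L2_fun_zero, of x z a r a' 0 0 0 0] by (simp add: phi_vec_def)

lemma phi_vec_scale: "x \<in> {0..pi} \<Longrightarrow> phi_vec z (r *s a) x = pair_scale r (phi_vec z a x)"
  using U_scale[OF L2_fun_zero, of x z r a 0 0] by (simp add: phi_vec_def)

lemma phi_vec_0: "x \<in> {0..pi} \<Longrightarrow> phi_vec z 0 x = 0"
  using phi_vec_scale[of x z 0 0] by (simp add: pair_scale_def zero_prod_def)

text \<open>After \<open>sol_shift\<close> both solutions belong to the same parameter
  \<open>z\<close>, and the a priori bound for their difference gives the explicit rate
  \<open>d\<close>. A first bound \<open>M\<close>, uniform in \<open>n\<close> and
  \<open>x\<close>, is required because the shifted force contains the solution \<open>w n\<close>
  itself.\<close>

lemma sol_tendsto: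
  assumes f: "L2_fun f" and z: "zn \<longlonglongrightarrow> z" and p: "pn \<longlonglongrightarrow> p" and s: "sn \<longlonglongrightarrow> s"
    and w: "\<And>n. sol (zn n) (force (fun_scale (sn n) f)) (pn n) (w n)"
    and v: "sol z (force (fun_scale s f)) p v"
  shows "uniform_limit {0..pi} w v sequentially"
proof -
  define I where "I = integral {0..pi} (\<lambda>t. norm (f t))"
  have fi: "(\<lambda>t. norm (f t)) integrable_on {0..pi}"
    using L2_fun_integrable(2)[OF f] by (simp add: integrable_leb_pi_iff set_lebesgue_integral_eq_integral(1))
  have I0: "I \<ge> 0" unfolding I_def by (rule integral_nonneg_always) simp
  obtain Bz Bp Bs where B: "\<And>n. norm (zn n) \<le> Bz" "\<And>n. norm (pn n) \<le> Bp" "\<And>n. norm (sn n) \<le> Bs"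
    using z p s by (meson BseqE convergentI convergent_imp_Bseq)
  define M where "M = (Bp + Bs * I) * exp (2 * (integral {0..pi} ks + pi * (1 + Bz)))"
  have M: "norm (w n x) \<le> M" if x: "x \<in> {0..pi}" for n x
  proof -
    have "norm (w n x) \<le> (norm (pn n) + integral {0..pi} (\<lambda>t. norm (force (fun_scale (sn n) f) t))) *
        exp (2 * integral {0..pi} (k (zn n)))"
      by (rule linear_ode.is_sol_norm_le[OF ode w _ x]) (intro force_int L2_fun_scale f)
    also have "(\<lambda>t. norm (force (fun_scale (sn n) f) t)) = (\<lambda>t. cmod (sn n) * norm (f t))"
      by (simp add: force_def fun_scale_def norm_Pair norm_scale_vec)
    also have "integral {0..pi} \<dots> = cmod (sn n) * I" by (simp add: I_def)
    also have "(norm (pn n) + cmod (sn n) * I) * exp (2 * integral {0..pi} (k (zn n))) \<le> M"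
      unfolding M_def integral_k using B I0
      by (intro mult_mono add_mono mult_right_mono) (auto intro!: add_nonneg_nonneg mult_nonneg_nonneg intro: order_trans[OF norm_ge_zero])
    finally show ?thesis .
  qed
  define E where "E = exp (2 * integral {0..pi} (k z))"
  define d where "d = (\<lambda>n. (norm (pn n - p) + (cmod (sn n - s) * I + cmod (zn n - z) * (M * pi))) * E)"
  have le: "norm (w n x - v x) \<le> d n" if x: "x \<in> {0..pi}" for n x
  proof -
    let ?g = "fun_scale (sn n) f + fun_scale (zn n - z) (\<lambda>x. fst (w n x))"
    have c: "continuous_on {0..pi} (\<lambda>x. fst (w n x))" and wL: "L2_fun (\<lambda>x. fst (w n x))"
      using sol_continuous[OF w] by auto
    have gL: "L2_fun ?g" by (intro L2_fun_add L2_fun_scale f wL)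
    have ws: "sol z (force ?g) (pn n) (w n)" by (rule sol_shift[OF w c])
    have fg: "force ?g absolutely_integrable_on {0..pi}" "force (fun_scale s f) absolutely_integrable_on {0..pi}"
      by (intro force_int gL L2_fun_scale f)+
    let ?h = "\<lambda>t. force ?g t - force (fun_scale s f) t"
    have hi: "?h absolutely_integrable_on {0..pi}" by (intro set_integral_diff fg)
    have "norm (w n x - v x) \<le> (norm (pn n - p) + integral {0..pi} (\<lambda>t. norm (?h t))) * exp (2 * integral {0..pi} (k z))"
      by (rule linear_ode.is_sol_norm_le[OF ode linear_ode.is_sol_diff[OF ode ws v fg] hi x])
    moreover have "integral {0..pi} (\<lambda>t. norm (?h t)) \<le> cmod (sn n - s) * I + cmod (zn n - z) * (M * pi)"
    proof -
      have "integral {0..pi} (\<lambda>t. norm (?h t)) \<le>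
          integral {0..pi} (\<lambda>t. cmod (sn n - s) * norm (f t) + cmod (zn n - z) * M)"
      proof (rule integral_le)
        show "(\<lambda>t. norm (?h t)) integrable_on {0..pi}" using hi by (simp add: absolutely_integrable_on_def)
        show "(\<lambda>t. cmod (sn n - s) * norm (f t) + cmod (zn n - z) * M) integrable_on {0..pi}"
          by (intro integrable_add integrable_on_mult_right fi) auto
        fix t assume t: "t \<in> {0..pi}"
        have "?h t = (0, - ((sn n - s) *s f t + (zn n - z) *s fst (w n t)))"
          by (simp add: force_def fun_scale_def plus_fun_def vec.scale_left_diff_distrib)
        then have "norm (?h t) = norm ((sn n - s) *s f t + (zn n - z) *s fst (w n t))"
          by (simp only: norm_Pair1 norm_minus_cancel)
        also have "\<dots> \<le> norm ((sn n - s) *s f t) + norm ((zn n - z) *s fst (w n t))" by (rule norm_triangle_ineq)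
        also have "norm ((zn n - z) *s fst (w n t)) \<le> cmod (zn n - z) * M"
        proof -
          have "norm (fst (w n t)) \<le> norm (w n t)" by (cases "w n t"; simp add: norm_Pair real_le_rsqrt)
          then show ?thesis unfolding norm_scale_vec using M[OF t, of n] by (intro mult_left_mono) auto
        qed
        finally show "norm (?h t) \<le> cmod (sn n - s) * norm (f t) + cmod (zn n - z) * M"
          by (simp only: norm_scale_vec)
      qed
      also have "\<dots> = cmod (sn n - s) * I + cmod (zn n - z) * (M * pi)"
        using fi by (subst Henstock_Kurzweil_Integration.integral_add) (auto simp: I_def intro: integrable_on_mult_right)
      finally show ?thesis .
    qed
    ultimately show ?thesis unfolding d_def E_def by (meson add_left_mono exp_ge_zero mult_right_mono order_trans)
  qed
  have "(\<lambda>n. norm (pn n - p)) \<longlonglongrightarrow> 0" "(\<lambda>n. cmod (sn n - s)) \<longlonglongrightarrow> 0" "(\<lambda>n. cmod (zn n - z)) \<longlonglongrightarrow> 0"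
    using p s z by (auto intro!: tendsto_norm_zero LIM_zero)
  then have "d \<longlonglongrightarrow> (0 + (0 * I + 0 * (M * pi))) * E" unfolding d_def by (intro tendsto_intros)
  then have d0: "d \<longlonglongrightarrow> 0" by simp
  show ?thesis
  proof (rule uniform_limitI)
    fix e :: real assume "e > 0"
    then have "\<forall>\<^sub>F n in sequentially. d n < e" using d0 by (rule order_tendstoD(2)[rotated])
    then show "\<forall>\<^sub>F n in sequentially. \<forall>x\<in>{0..pi}. dist (w n x) (v x) < e"
    proof eventually_elim
      case (elim n)
      show ?case unfolding dist_norm by (intro ballI order_le_less_trans[OF le elim])
    qed
  qed
qed

lemma bounded_linear_init: "bounded_linear (\<lambda>p. bc1.init (fst p) (snd p))"
  unfolding bc1.init_def
  by (intro bounded_linear_Pair bounded_linear_sub bounded_linear_add bounded_linear_compose[OF matvec_bounded_linear]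
      bounded_linear_fst bounded_linear_snd)

lemma U_tendsto:
  assumes f: "L2_fun f" and z: "zn \<longlonglongrightarrow> z" and a: "an \<longlonglongrightarrow> a" and c: "cn \<longlonglongrightarrow> c" and s: "sn \<longlonglongrightarrow> s"
  shows "uniform_limit {0..pi} (\<lambda>n. U f (zn n) (an n) (cn n) (sn n)) (U f z a c s) sequentially"
proof (rule sol_tendsto[OF f z _ s U[OF f] U[OF f]])
  show "(\<lambda>n. bc1.init (an n) (cn n)) \<longlonglongrightarrow> bc1.init a c"
    using bounded_linear.tendsto[OF bounded_linear_init tendsto_Pair[OF a c]] by simp
qed

definition V2 :: "(complex^'m) \<times> (complex^'m) \<Rightarrow> complex^'m" where
  "V2 w = boundary_form (*v) T2 H2 (fst w) (snd w)"

lemma V2_lin: "V2 (w + pair_scale r v) = V2 w + r *s V2 v"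
  by (simp add: V2_def boundary_form_def pair_scale_def orth_compl_mult_vec matrix_vector_right_distrib
      matrix_vector_mult_diff_distrib vector_scalar_commute vec.scale_right_diff_distrib algebra_simps)

lemma V2_scale: "V2 (pair_scale r v) = r *s V2 v"
  using V2_lin[of 0 r v] by (simp add: V2_def[of 0] boundary_form_def)

lemma bounded_linear_V2: "bounded_linear V2"
  unfolding V2_def boundary_form_def
  by (intro bounded_linear_sub bounded_linear_compose[OF matvec_bounded_linear] bounded_linear_fst bounded_linear_snd)

abbreviation "eig z a \<equiv> V2 (phi_vec z a pi) = 0"

lemma bracket_pi: "V2 w = 0 \<Longrightarrow> V2 v = 0 \<Longrightarrow> cinner (fst w) (snd v) - cinner (snd w) (fst v) = 0"
  unfolding V2_def by (rule bc2.bracket_zero)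

text \<open>Both functions satisfy the condition at \<open>pi\<close>, so the bracket vanishes there
  and the endpoint 0 alone contributes, in the form given by \<open>bracket_init\<close>.\<close>

lemma green:
  assumes f: "L2_fun f" and g: "L2_fun g"
    and "V2 (U f z a c s pi) = 0" "V2 (U g \<zeta> a' c' s' pi) = 0"
  shows "cinner c a' - cinner a c' = (z - cnj \<zeta>) * L2_inner (y f z a c s) (y g \<zeta> a' c' s') +
     s * L2_inner f (y g \<zeta> a' c' s') - cnj s' * L2_inner (y f z a c s) g"
proof -
  have "0 - (cinner a c' - cinner c a') = (z - cnj \<zeta>) * L2_inner (y f z a c s) (y g \<zeta> a' c' s') +
     L2_inner (fun_scale s f) (y g \<zeta> a' c' s') - L2_inner (y f z a c s) (fun_scale s' g)"
    using lagrange_identity[OF L2_fun_scale[OF f, of s] L2_fun_scale[OF g, of s'] U[OF f, of z s a c] U[OF g, of \<zeta> s' a' c']]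
    unfolding U_at_0[OF f] U_at_0[OF g] bc1.bracket_init bracket_pi[OF assms(3,4)] .
  then show ?thesis by (simp add: L2_inner_scale_left L2_inner_scale_right)
qed

lemma green_eig:
  assumes f: "L2_fun f" and "V2 (U f z a c s pi) = 0" "eig \<zeta> \<alpha>"
  shows "cinner c \<alpha> = (z - cnj \<zeta>) * L2_inner (y f z a c s) (\<lambda>x. fst (phi_vec \<zeta> \<alpha> x)) + s * L2_inner f (\<lambda>x. fst (phi_vec \<zeta> \<alpha> x))"
  using green[OF f L2_fun_zero assms(2), where \<zeta>=\<zeta> and a'=\<alpha> and c'=0 and s'=0] assms(3) by (simp add: phi_vec_def)

text \<open>A solution with null first component has derivative 0, so its quasi-derivative vanishes
  almost everywhere. Continuity extends both statements to the whole interval.\<close>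

lemma sol_fst_zero:
  assumes f: "L2_fun f" and w: "sol z (force f) p w" and n: "L2_norm (\<lambda>x. fst (w x)) = 0" and x: "x \<in> {0..pi}"
  shows "w x = 0"
proof -
  let ?y = "\<lambda>x. fst (w x)" and ?u = "\<lambda>x. snd (w x)"
  note P = w[unfolded sol_unfold[OF f]]
  have c: "continuous_on {0..pi} ?y" "continuous_on {0..pi} ?u"
    using sol_continuous(1)[OF w] by (auto intro: continuous_on_fst continuous_on_snd)
  have "L2_eq ?y 0" using n by (subst L2_eq_iff_norm) (auto simp: sol_continuous(3)[OF w] L2_fun_zero)
  then have "AE x in leb_pi. ?y x = 0" by (simp add: L2_eq_def)
  then have y0: "?y x = 0" if "x \<in> {0..pi}" for x using continuous_AE_zero[OF c(1) _ that] by blast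
  have "AE x in leb_pi. x \<in> {0<..<pi}" by (rule AE_I2) simp
  then have "AE x in leb_pi. ?u x = 0"
    using P[THEN conjunct2, THEN conjunct2, THEN conjunct2, THEN conjunct1]
  proof eventually_elim
    case (elim x)
    have "((\<lambda>x. 0) has_vector_derivative \<sigma> x *v ?y x + ?u x) (at x)"
      by (rule has_vector_derivative_transform_within_open[OF elim(2), where S="{0<..<pi}"]) (use elim(1) y0 in auto)
    then have "\<sigma> x *v ?y x + ?u x = 0" by (rule vector_derivative_unique_at) simp
    then show ?case using y0[of x] elim(1) by simp
  qed
  then have "?u x = 0" by (rule continuous_AE_zero[OF c(2) _ x])
  then show ?thesis using y0[OF x] by (simp add: prod_eq_iff)
qed

lemma sol_fst_zero_force:
  assumes f: "L2_fun f" and w: "sol z (force f) p w" and n: "L2_norm (\<lambda>x. fst (w x)) = 0"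
  shows "L2_norm f = 0"
proof -
  have w0: "w x = 0" if "x \<in> {0..pi}" for x by (rule sol_fst_zero[OF f w n that])
  have "AE x in leb_pi. x \<in> {0<..<pi}" by (rule AE_I2) simp
  then have "AE x in leb_pi. f x = 0"
    using w[unfolded sol_unfold[OF f], THEN conjunct2, THEN conjunct2, THEN conjunct2, THEN conjunct2]
  proof eventually_elim
    case (elim x)
    let ?d = "- (\<sigma> x *v snd (w x)) - \<sigma> x *v (\<sigma> x *v fst (w x)) - z *s fst (w x) - f x"
    have "((\<lambda>x. 0) has_vector_derivative ?d) (at x)"
      by (rule has_vector_derivative_transform_within_open[OF elim(2), where S="{0<..<pi}"]) (use elim(1) w0 in auto)
    then have "?d = 0" by (rule vector_derivative_unique_at) simp
    then show ?case using w0[of x] elim(1) by simp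
  qed
  then have "L2_eq f 0" by (simp add: L2_eq_def)
  then show ?thesis using L2_eq_iff_norm[OF f L2_fun_zero] by simp
qed

lemma phi_vec_zero_imp:
  assumes "L2_norm (\<lambda>x. fst (phi_vec z a x)) = 0"
  shows "a = 0"
proof -
  have "phi_vec z a 0 = 0" by (rule sol_fst_zero[OF L2_fun_zero phi_vec assms]) simp
  then have "bc1.init a 0 = 0" using U_at_0[OF L2_fun_zero, of z a 0 0] by (simp add: phi_vec_def)
  then show ?thesis using bc1.init_dual[of a 0] by simp
qed

lemma phi_vec_inner_zero_imp: "L2_inner (\<lambda>x. fst (phi_vec z a x)) (\<lambda>x. fst (phi_vec z a x)) = 0 \<Longrightarrow> a = 0"
  by (rule phi_vec_zero_imp) (simp add: L2_inner_same)

lemma eig_real: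
  assumes "eig z a" "a \<noteq> 0"
  shows "cnj z = z"
proof -
  have "0 = (z - cnj z) * L2_inner (\<lambda>x. fst (phi_vec z a x)) (\<lambda>x. fst (phi_vec z a x))"
    using green_eig[OF L2_fun_zero, where z=z and a=a and c=0 and s=0 and \<zeta>=z and \<alpha>=a] assms(1) by (simp add: phi_vec_def)
  then show ?thesis using phi_vec_inner_zero_imp[of z a] assms(2) by auto
qed

lemma phi_vec_L2_zero: "\<alpha> = 0 \<Longrightarrow> L2_inner f (\<lambda>x. fst (phi_vec z \<alpha> x)) = 0"
proof -
  assume "\<alpha> = 0"
  then have "cinner (f x) (fst (phi_vec z \<alpha> x)) = 0" if "x \<in> {0<..<pi}" for x
    using phi_vec_0[of x z] that by simp
  then have "L2_inner f (\<lambda>x. fst (phi_vec z \<alpha> x)) = (LINT x|leb_pi. 0)"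
    unfolding L2_inner_def by (intro Bochner_Integration.integral_cong) auto
  then show ?thesis by simp
qed

lemma y_tendsto:
  assumes f: "L2_fun f" and z: "zn \<longlonglongrightarrow> z" and a: "an \<longlonglongrightarrow> a" and c: "cn \<longlonglongrightarrow> c" and s: "sn \<longlonglongrightarrow> s"
  shows "(\<lambda>n. L2_norm (y f (zn n) (an n) (cn n) (sn n) - y f z a c s)) \<longlonglongrightarrow> 0"
    and "(\<lambda>n. V2 (U f (zn n) (an n) (cn n) (sn n) pi)) \<longlonglongrightarrow> V2 (U f z a c s pi)"
proof -
  note u = U_tendsto[OF f z a c s]
  have "uniform_limit {0..pi} (\<lambda>n. y f (zn n) (an n) (cn n) (sn n)) (y f z a c s) sequentially"
    by (rule bounded_linear.uniform_limit[OF bounded_linear_fst u])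
  then show "(\<lambda>n. L2_norm (y f (zn n) (an n) (cn n) (sn n) - y f z a c s)) \<longlonglongrightarrow> 0"
    by (rule L2_norm_tendsto_uniform) (rule sol_continuous(2)[OF U[OF f]])
  have "(\<lambda>n. U f (zn n) (an n) (cn n) (sn n) pi) \<longlonglongrightarrow> U f z a c s pi"
    by (rule tendsto_uniform_limitI[OF u]) simp
  then show "(\<lambda>n. V2 (U f (zn n) (an n) (cn n) (sn n) pi)) \<longlonglongrightarrow> V2 (U f z a c s pi)"
    by (rule bounded_linear.tendsto[OF bounded_linear_V2])
qed

text \<open>If \<open>an\<close> were unbounded, the normalized solutions would converge to an eigenfunction orthogonal
  to the whole eigenspace of \<open>z0\<close>, hence to itself.\<close>

lemma U_converges:
  assumes f: "L2_fun f" and z: "zn \<longlonglongrightarrow> z0" and c: "cn \<longlonglongrightarrow> c0"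
    and V: "\<And>n. V2 (U f (zn n) (an n) (cn n) s pi) = 0"
    and lim: "\<And>\<alpha>. eig z0 \<alpha> \<Longrightarrow> (\<lambda>n. L2_inner (y f (zn n) (an n) (cn n) s) (\<lambda>x. fst (phi_vec z0 \<alpha> x))) \<longlonglongrightarrow> L \<alpha>"
  shows "\<exists>a0. (V2 (U f z0 a0 c0 s pi) = 0 \<and>
     (\<forall>\<alpha>. eig z0 \<alpha> \<longrightarrow> L2_inner (y f z0 a0 c0 s) (\<lambda>x. fst (phi_vec z0 \<alpha> x)) = L \<alpha>)) \<and> an \<longlonglongrightarrow> a0"
proof (rule bounded_unique_cluster)
  show "bounded (range an)"
  proof (rule ccontr)
    assume nb: "\<not> bounded (range an)"
    have "\<exists>m\<ge>n. norm (an m) > real (Suc n)" for n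
    proof (rule ccontr)
      assume "\<not> (\<exists>m\<ge>n. norm (an m) > real (Suc n))"
      then have "Bseq (\<lambda>m. an (m + n))" by (intro BseqI'[of _ "real (Suc n)"]) (meson le_add2 not_le)
      then have "Bseq an" by (rule Bseq_offset)
      then show False using nb by (simp add: Bseq_eq_bounded)
    qed
    then obtain q where q: "\<And>n. q n \<ge> n" "\<And>n. norm (an (q n)) > real (Suc n)" by metis
    have qt: "filterlim q at_top sequentially"
      by (rule filterlim_at_top_mono[OF filterlim_ident]) (use q(1) in auto)
    \<comment> \<open>Normalizing factor of the coefficient vectors; it tends to 0 and drives the
      remaining data to 0.\<close>
    define t where "t n = complex_of_real (1 / norm (an (q n)))" for n
    have an0: "norm (an (q n)) > 0" for n by (rule order_less_trans[OF _ q(2)]) simp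
    have t0: "t \<longlonglongrightarrow> 0"
    proof (rule Lim_null_comparison[OF _ LIMSEQ_Suc[OF lim_inverse_n']])
      have "norm (t n) \<le> 1 / real (Suc n)" for n
        using q(2)[of n] an0[of n] by (simp add: t_def norm_divide frac_le)
      then show "\<forall>\<^sub>F n in sequentially. norm (t n) \<le> 1 / real (Suc n)" by simp
    qed
    have "bounded (range (\<lambda>n. t n *s an (q n)))"
    proof (rule boundedI)
      fix v assume "v \<in> range (\<lambda>n. t n *s an (q n))"
      then show "norm v \<le> 1" using an0 by (auto simp: norm_scale_vec t_def norm_divide)
    qed
    then obtain \<beta> r where r: "strict_mono r" "((\<lambda>n. t n *s an (q n)) \<circ> r) \<longlonglongrightarrow> \<beta>"
      using bounded_imp_convergent_subsequence by blast
    have rt: "filterlim r at_top sequentially" by (rule filterlim_subseq[OF r(1)])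
    define q' where "q' n = q (r n)" for n
    define t' where "t' n = t (r n)" for n
    have q't: "filterlim q' at_top sequentially" unfolding q'_def by (rule filterlim_compose[OF qt rt])
    have t': "t' \<longlonglongrightarrow> 0" unfolding t'_def by (rule filterlim_compose[OF t0 rt])
    have b: "(\<lambda>n. t' n *s an (q' n)) \<longlonglongrightarrow> \<beta>" using r(2) by (simp add: comp_def t'_def q'_def)
    have "norm (t' n *s an (q' n)) = 1" for n
      using an0[of "r n"] by (simp add: norm_scale_vec t'_def q'_def t_def norm_divide)
    then have nb: "norm \<beta> = 1" using tendsto_norm[OF b] by (simp add: LIMSEQ_const_iff)
    have z': "(\<lambda>n. zn (q' n)) \<longlonglongrightarrow> z0" by (rule filterlim_compose[OF z q't])
    have c': "(\<lambda>n. t' n *s cn (q' n)) \<longlonglongrightarrow> 0"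
    proof -
      have "(\<lambda>n. cmod (t' n) * norm (cn (q' n))) \<longlonglongrightarrow> 0 * norm c0"
        using t' filterlim_compose[OF c q't] by (intro tendsto_mult tendsto_norm_zero tendsto_norm)
      then have "(\<lambda>n. norm (t' n *s cn (q' n))) \<longlonglongrightarrow> 0" by (simp add: norm_scale_vec)
      then show ?thesis by (rule tendsto_norm_zero_cancel)
    qed
    have s': "(\<lambda>n. t' n * s) \<longlonglongrightarrow> 0" by (rule tendsto_mult_left_zero[OF t'])
    note lim' = y_tendsto[OF f z' b c' s']
    have Us: "U f (zn (q' n)) (t' n *s an (q' n)) (t' n *s cn (q' n)) (t' n * s) x = pair_scale (t' n) (U f (zn (q' n)) (an (q' n)) (cn (q' n)) s x)"
      if "x \<in> {0..pi}" for n x by (rule U_scale[OF f that])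
    have "V2 (U f (zn (q' n)) (t' n *s an (q' n)) (t' n *s cn (q' n)) (t' n * s) pi) = 0" for n
      by (simp add: Us V2_scale V)
    \<comment> \<open>The scaled boundary data and the scaled force vanish in the limit, so the
      limit solution is homogeneous with coefficient \<open>\<beta>\<close>, and the condition at
      \<open>pi\<close> survives by uniform convergence.\<close>
    then have eb: "eig z0 \<beta>" using lim'(2) by (simp add: U_no_force LIMSEQ_const_iff)
    let ?v = "\<lambda>x. fst (phi_vec z0 \<beta> x)"
    have h1: "(\<lambda>n. L2_inner (y f (zn (q' n)) (t' n *s an (q' n)) (t' n *s cn (q' n)) (t' n * s)) ?v) \<longlonglongrightarrow> L2_inner ?v ?v"
      using L2_inner_tendsto[OF U_L2[OF f] U_L2[OF f] phi_vec_L2 lim'(1), of z0 \<beta>] by (simp add: U_no_force)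
    have h2: "L2_inner (y f (zn (q' n)) (t' n *s an (q' n)) (t' n *s cn (q' n)) (t' n * s)) ?v =
        t' n * L2_inner (y f (zn (q' n)) (an (q' n)) (cn (q' n)) s) ?v" for n
    proof -
      have "L2_inner (y f (zn (q' n)) (t' n *s an (q' n)) (t' n *s cn (q' n)) (t' n * s)) ?v =
          L2_inner (fun_scale (t' n) (y f (zn (q' n)) (an (q' n)) (cn (q' n)) s)) ?v"
        unfolding L2_inner_def
        by (intro Bochner_Integration.integral_cong) (auto simp: Us pair_scale_def fun_scale_def)
      then show ?thesis by (simp add: L2_inner_scale_left)
    qed
    \<comment> \<open>The unscaled scalar products converge by assumption, so after multiplication
      with \<open>t'\<close> they tend to 0.\<close>
    have h3: "(\<lambda>n. t' n * L2_inner (y f (zn (q' n)) (an (q' n)) (cn (q' n)) s) ?v) \<longlonglongrightarrow> 0 * L \<beta>"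
      by (intro tendsto_mult t' filterlim_compose[OF lim[OF eb] q't])
    have "L2_inner ?v ?v = 0 * L \<beta>" by (rule LIMSEQ_unique[OF h1[unfolded h2] h3])
    then have "\<beta> = 0" by (intro phi_vec_inner_zero_imp) simp
    then show False using nb by simp
  qed
next
  fix r and l :: "complex^'m" assume r: "filterlim r at_top sequentially" and l: "(\<lambda>n. an (r n)) \<longlonglongrightarrow> l"
  note lim' = y_tendsto[OF f filterlim_compose[OF z r] l filterlim_compose[OF c r] tendsto_const, of s]
  have "V2 (U f z0 l c0 s pi) = 0" using lim'(2) by (simp add: V LIMSEQ_const_iff)
  moreover have "L2_inner (y f z0 l c0 s) (\<lambda>x. fst (phi_vec z0 \<alpha> x)) = L \<alpha>" if "eig z0 \<alpha>" for \<alpha>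
    by (rule LIMSEQ_unique[OF L2_inner_tendsto[OF U_L2[OF f] U_L2[OF f] phi_vec_L2 lim'(1)]
          filterlim_compose[OF lim[OF that] r]])
  ultimately show "V2 (U f z0 l c0 s pi) = 0 \<and>
     (\<forall>\<alpha>. eig z0 \<alpha> \<longrightarrow> L2_inner (y f z0 l c0 s) (\<lambda>x. fst (phi_vec z0 \<alpha> x)) = L \<alpha>)" by blast
next
  fix l l' :: "complex^'m"
  assume l: "V2 (U f z0 l c0 s pi) = 0 \<and>
     (\<forall>\<alpha>. eig z0 \<alpha> \<longrightarrow> L2_inner (y f z0 l c0 s) (\<lambda>x. fst (phi_vec z0 \<alpha> x)) = L \<alpha>)"
    and l': "V2 (U f z0 l' c0 s pi) = 0 \<and>
     (\<forall>\<alpha>. eig z0 \<alpha> \<longrightarrow> L2_inner (y f z0 l' c0 s) (\<lambda>x. fst (phi_vec z0 \<alpha> x)) = L \<alpha>)"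
  \<comment> \<open>Two limits differ by an eigenfunction that is orthogonal to the whole
    eigenspace, in particular to itself.\<close>
  have d: "phi_vec z0 (l - l') x = U f z0 l c0 s x + pair_scale (-1) (U f z0 l' c0 s x)" if "x \<in> {0..pi}" for x
    using U_lin[OF f that, of z0 l "-1" l' c0 c0 s s] by (simp add: U_no_force)
  have e: "eig z0 (l - l')" using l l' by (simp add: d V2_lin)
  let ?v = "\<lambda>x. fst (phi_vec z0 (l - l') x)"
  have "L2_inner ?v ?v = L2_inner (y f z0 l c0 s - y f z0 l' c0 s) ?v"
    unfolding L2_inner_def by (intro Bochner_Integration.integral_cong) (auto simp: d pair_scale_def)
  also have "\<dots> = 0" using l l' e by (simp add: L2_inner_diff_left U_L2[OF f] phi_vec_L2)
  finally have "l - l' = 0" by (rule phi_vec_inner_zero_imp)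
  then show "l = l'" by simp
qed

end

section \<open>Weyl matrix and completeness of the eigenfunctions\<close>

text \<open>On the circle \<open>\<bar>z\<bar> = R\<close> the factor \<open>z\<^sup>2 - R\<^sup>2\<close> is bounded by \<open>2R\<bar>Im z\<bar>\<close>, which absorbs the blow-up
  of the bound at the real axis.\<close>

lemma entire_resolvent_bound_zero:
  assumes F: "F holomorphic_on UNIV" and bd: "\<And>z. \<bar>Im z\<bar> * cmod (F z) \<le> C"
  shows "F \<i> = 0"
proof -
  have C: "C \<ge> 0" using bd[of 0] by simp
  have R: "cmod (F \<i>) \<le> 2 * C / R" if R: "R > 1" for R :: real
  proof -
    let ?G = "\<lambda>z. (z\<^sup>2 - (complex_of_real R)\<^sup>2) * F z"
    have hol: "?G holomorphic_on UNIV" by (intro holomorphic_intros F)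
    have "norm (?G \<i>) \<le> 2 * R * C"
    proof (rule maximum_modulus_frontier[of ?G "cball 0 R"])
      show "?G holomorphic_on interior (cball 0 R)" by (rule holomorphic_on_subset[OF hol]) auto
      show "continuous_on (closure (cball 0 R)) ?G"
        by (rule continuous_on_subset[OF holomorphic_on_imp_continuous_on[OF hol]]) auto
      fix z :: complex assume "z \<in> frontier (cball 0 R)"
      then have z: "cmod z = R" using R by (simp add: frontier_cball)
      have "z\<^sup>2 - (complex_of_real R)\<^sup>2 = z * (z - cnj z)"
        using complex_norm_square[of z] z by (simp add: power2_eq_square algebra_simps)
      also have "z - cnj z = 2 * \<i> * of_real (Im z)" by (simp add: complex_eq_iff)
      finally have "cmod (z\<^sup>2 - (complex_of_real R)\<^sup>2) = R * (2 * \<bar>Im z\<bar>)" by (simp add: norm_mult z)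
      then have "norm (?G z) = 2 * R * (\<bar>Im z\<bar> * cmod (F z))" by (simp add: norm_mult)
      also have "\<dots> \<le> 2 * R * C" using bd R by (intro mult_left_mono) auto
      finally show "norm (?G z) \<le> 2 * R * C" .
    qed (use R in auto)
    \<comment> \<open>At the fixed point \<open>\<i>\<close> the factor grows quadratically in
      \<open>R\<close>, but the bound only linearly; letting \<open>R\<close> tend to infinity gives
      0.\<close>
    moreover have "norm (?G \<i>) = (1 + R\<^sup>2) * cmod (F \<i>)"
    proof -
      have "\<i>\<^sup>2 - (complex_of_real R)\<^sup>2 = - of_real (1 + R\<^sup>2)" by simp
      then have "cmod (\<i>\<^sup>2 - (complex_of_real R)\<^sup>2) = 1 + R\<^sup>2"
        by (simp only: norm_minus_cancel norm_of_real) (simp add: abs_of_nonneg)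
      then show ?thesis by (simp add: norm_mult)
    qed
    moreover have "R\<^sup>2 * cmod (F \<i>) \<le> (1 + R\<^sup>2) * cmod (F \<i>)" by (intro mult_right_mono) auto
    ultimately have "R * (R * cmod (F \<i>)) \<le> R * (2 * C)" by (simp add: power2_eq_square mult_ac)
    then have "R * cmod (F \<i>) \<le> 2 * C" using R by simp
    then show ?thesis using R by (simp add: field_simps)
  qed
  have "cmod (F \<i>) \<le> 0"
  proof (rule LIMSEQ_le_const)
    show "(\<lambda>n. 2 * C * (1 / real n)) \<longlonglongrightarrow> 0" by (intro tendsto_mult_right_zero lim_1_over_n)
    show "\<exists>N. \<forall>n\<ge>N. cmod (F \<i>) \<le> 2 * C * (1 / real n)" using R by (intro exI[of _ 2]) auto
  qed
  then show ?thesis by simp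
qed

lemma boundary_form_column_matrix:
  "boundary_form (**) T H (\<Sum>j\<in>UNIV. column_matrix j (y j)) (\<Sum>j\<in>UNIV. column_matrix j (u j)) =
     (\<Sum>j\<in>UNIV. column_matrix j (boundary_form (*v) T H (y j) (u j)))"
proof -
  have lin: "linear (column_matrix j)" for j :: 'a
    by (rule bounded_linear.linear[OF bounded_linear_column_matrix])
  show ?thesis
    by (simp add: boundary_form_def matrix_mult_sum matrix_mult_column_matrix
        flip: linear_diff[OF lin] sum_subtractf)
qed

lemma boundary_form_mult_vec:
  fixes Y Y1 :: "complex^'m^'m"
  shows "boundary_form (**) T H Y Y1 *v c = boundary_form (*v) T H (Y *v c) (Y1 *v c)"
  by (simp add: boundary_form_def matrix_vector_mult_diff_rdistrib matrix_vector_mul_assoc[symmetric])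

lemma column_matrix_zero: "column_matrix j 0 = 0"
  by (simp add: column_matrix_def vec_eq_iff)

lemma matvec_axis: "A *v axis j 1 = column j A" for A :: "complex^'m^'m"
  by (simp add: vec_eq_iff matrix_vector_mult_def axis_def column_def if_distrib cong: if_cong)

lemma sum_column_matrix_mult_axis: "(\<Sum>j\<in>UNIV. column_matrix j (A *v axis j 1)) = A"
  using sum_column_matrix_column[of A] by (simp add: matvec_axis)

lemma vec_sum_axis: "v = (\<Sum>j\<in>UNIV. v $ j *s axis j 1)" for v :: "complex^'m"
  by (simp add: vec_eq_iff axis_def if_distrib cong: if_cong)

context sturm_liouville
begin

definition regular :: "complex \<Rightarrow> bool" where "regular z \<longleftrightarrow> (\<forall>a. eig z a \<longrightarrow> a = 0)"

lemma nonreal_regular: "cnj z \<noteq> z \<Longrightarrow> regular z"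
  unfolding regular_def using eig_real by blast

lemma eig_scale: "eig z a \<Longrightarrow> eig z (r *s a)"
  by (simp add: phi_vec_scale V2_scale)

lemma eig_lin: "eig z a \<Longrightarrow> eig z b \<Longrightarrow> eig z (a + r *s b)"
  by (simp add: phi_vec_lin V2_lin)

lemma eig_sum: "(\<And>i. i \<in> S \<Longrightarrow> eig z (v i)) \<Longrightarrow> eig z (\<Sum>i\<in>S. a i *s v i)"
proof (induction S rule: infinite_finite_induct)
  case (insert i S)
  then have "eig z ((\<Sum>i\<in>S. a i *s v i) + a i *s v i)" by (intro eig_lin) auto
  then show ?case using insert.hyps by (simp add: add.commute)
qed (simp_all add: phi_vec_0 V2_def boundary_form_def)

text \<open>Covers two situations: with \<open>s = 0\<close> orthogonality of eigenfunctions to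
  different eigenvalues, with \<open>s = 1\<close> orthogonality of the solution with force
  \<open>f\<close> to every eigenspace not belonging to its own parameter.\<close>

lemma eig_inner_zero:
  assumes f: "L2_fun f" and V: "V2 (U f z a 0 s pi) = 0" and e: "eig \<zeta> \<alpha>" and ne: "z \<noteq> \<zeta>"
    and o: "L2_inner f (\<lambda>x. fst (phi_vec \<zeta> \<alpha> x)) = 0"
  shows "L2_inner (y f z a 0 s) (\<lambda>x. fst (phi_vec \<zeta> \<alpha> x)) = 0"
proof (cases "\<alpha> = 0")
  case True
  then show ?thesis by (rule phi_vec_L2_zero)
next
  case False
  then have "cnj \<zeta> = \<zeta>" using eig_real[OF e] by blast
  then show ?thesis using green_eig[OF f V e] o ne by simp
qed

text \<open>Normalized coefficients of eigenfunctions at \<open>zn n\<close> would converge to a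
  unit vector. Its eigenfunction at \<open>z0\<close> is a limit of functions orthogonal to the
  eigenspace of \<open>z0\<close> and hence orthogonal to itself.\<close>

lemma eigenvalues_isolated:
  assumes z: "zn \<longlonglongrightarrow> z0" and ne: "\<And>n. zn n \<noteq> z0" and e: "\<And>n. eig (zn n) (an n)"
    and a: "\<And>n. an n \<noteq> 0"
  shows False
proof -
  define bn where "bn n = complex_of_real (1 / norm (an n)) *s an n" for n
  have nb: "norm (bn n) = 1" for n using a[of n] by (simp add: bn_def norm_scale_vec norm_divide)
  have eb: "eig (zn n) (bn n)" for n unfolding bn_def by (rule eig_scale[OF e])
  have V: "V2 (U 0 (zn n) (bn n) 0 0 pi) = 0" for n using eb by (simp add: U_no_force)
  have "\<exists>a0. (V2 (U 0 z0 a0 0 0 pi) = 0 \<and>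
     (\<forall>\<alpha>. eig z0 \<alpha> \<longrightarrow> L2_inner (y 0 z0 a0 0 0) (\<lambda>x. fst (phi_vec z0 \<alpha> x)) = 0)) \<and> bn \<longlonglongrightarrow> a0"
  proof (rule U_converges[OF L2_fun_zero z tendsto_const V])
    fix \<alpha> assume "eig z0 \<alpha>"
    then show "(\<lambda>n. L2_inner (y 0 (zn n) (bn n) 0 0) (\<lambda>x. fst (phi_vec z0 \<alpha> x))) \<longlonglongrightarrow> 0"
      using eig_inner_zero[OF L2_fun_zero V _ ne] by simp
  qed
  then obtain a0 where a0: "eig z0 a0" "\<And>\<alpha>. eig z0 \<alpha> \<Longrightarrow> L2_inner (\<lambda>x. fst (phi_vec z0 a0 x)) (\<lambda>x. fst (phi_vec z0 \<alpha> x)) = 0"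
    "bn \<longlonglongrightarrow> a0" by (auto simp: U_no_force)
  have "a0 = 0" by (rule phi_vec_inner_zero_imp[OF a0(2)[OF a0(1)]])
  then show False using tendsto_norm[OF a0(3)] nb by (simp add: LIMSEQ_const_iff)
qed

lemma regular_punctured_ball:
  obtains e where "e > 0" "\<And>z. z \<in> ball z0 e - {z0} \<Longrightarrow> regular z"
proof -
  have "\<exists>e>0. \<forall>z\<in>ball z0 e - {z0}. regular z"
  proof (rule ccontr)
    assume "\<not> ?thesis"
    then have "\<exists>z a. z \<in> ball z0 (1 / real (Suc n)) \<and> z \<noteq> z0 \<and> eig z a \<and> a \<noteq> 0" for n
      unfolding regular_def by (metis Diff_iff insertI1 of_nat_0_less_iff singletonD zero_less_Suc zero_less_divide_1_iff)
    then obtain zn an where zn: "\<And>n. zn n \<in> ball z0 (1 / real (Suc n))" "\<And>n. zn n \<noteq> z0" "\<And>n. eig (zn n) (an n)" "\<And>n. an n \<noteq> 0"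
      by metis
    have "zn \<longlonglongrightarrow> z0"
    proof (rule metric_LIMSEQ_I)
      fix r :: real assume "r > 0"
      then obtain N where N: "1 / real (Suc N) < r" using nat_approx_posE by blast
      have "dist (zn n) z0 < r" if "n \<ge> N" for n
      proof -
        have "dist (zn n) z0 < 1 / real (Suc n)" using zn(1)[of n] by (simp add: dist_commute)
        also have "\<dots> \<le> 1 / real (Suc N)" using that by (simp add: frac_le)
        finally show ?thesis using N by simp
      qed
      then show "\<exists>N. \<forall>n\<ge>N. dist (zn n) z0 < r" by blast
    qed
    then show False by (rule eigenvalues_isolated[OF _ zn(2-4)])
  qed
  then show ?thesis using that by blast
qed

lemma scaleR_eq_vec_scale: "r *\<^sub>R v = complex_of_real r *s v" for v :: "complex^'m"
  by (simp add: vec_eq_iff complex_eq_iff)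

text \<open>Fredholm alternative in C^m: a particular solution misses the condition at
  \<open>pi\<close> by a vector, and the linear map \<open>a \<mapsto> V2 (phi_vec z a pi)\<close>,
  injective at a regular point, is surjective and corrects it.\<close>

lemma regular_solve:
  assumes r: "regular z" and f: "L2_fun f"
  shows "\<exists>a. V2 (U f z a c s pi) = 0"
proof -
  have add: "V2 (phi_vec z (a + b) pi) = V2 (phi_vec z a pi) + V2 (phi_vec z b pi)" for a b
    using phi_vec_lin[of pi z a 1 b] V2_lin[of "phi_vec z a pi" 1 "phi_vec z b pi"] by simp
  have lin: "linear (\<lambda>a. V2 (phi_vec z a pi))"
    by (rule linearI) (simp_all add: add scaleR_eq_vec_scale phi_vec_scale V2_scale)
  have "inj (\<lambda>a. V2 (phi_vec z a pi))"
    using r unfolding linear_injective_0[OF lin] regular_def by blast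
  then have "surj (\<lambda>a. V2 (phi_vec z a pi))" using linear_injective_imp_surjective[OF lin] by simp
  from surjD[OF this, of "- V2 (U f z 0 c s pi)"]
  obtain a where a: "V2 (phi_vec z a pi) = - V2 (U f z 0 c s pi)" by auto
  have "U f z a c s pi = U f z 0 c s pi + pair_scale 1 (phi_vec z a pi)"
    using U_lin[OF f, of pi z 0 1 a c 0 s 0] by (simp add: U_no_force)
  then have "V2 (U f z a c s pi) = 0" by (simp add: V2_lin a)
  then show ?thesis by blast
qed

lemma regular_unique:
  assumes r: "regular z" and f: "L2_fun f" and "V2 (U f z a c s pi) = 0" "V2 (U f z b c s pi) = 0"
  shows "a = b"
proof -
  have "phi_vec z (a - b) pi = U f z a c s pi + pair_scale (-1) (U f z b c s pi)"
    using U_lin[OF f, of pi z a "-1" b c c s s] by (simp add: U_no_force)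
  then have "eig z (a - b)" using assms by (simp add: V2_lin)
  then show ?thesis using r by (auto simp: regular_def)
qed

lemma solution_U:
  "solution (*v) \<sigma> z (\<lambda>x. fst (U 0 z a c 0 x)) (\<lambda>x. snd (U 0 z a c 0 x))"
  using U[OF L2_fun_zero, of z 0 a c] sol_iff_solution[of z "fst (bc1.init a c)" "snd (bc1.init a c)"
      "\<lambda>x. fst (U 0 z a c 0 x)" "\<lambda>x. snd (U 0 z a c 0 x)"] by simp

lemma solution_eq_U:
  assumes "solution (*v) \<sigma> z v u" "x \<in> {0..pi}"
  shows "(v x, u x) = U 0 z (T1 *v v 0 + orth_compl T1 *v u 0) (boundary_form (*v) T1 H1 (v 0) (u 0)) 0 x"
proof -
  let ?a = "T1 *v v 0 + orth_compl T1 *v u 0" and ?c = "boundary_form (*v) T1 H1 (v 0) (u 0)"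
  have "sol z (force 0) (bc1.init ?a ?c) (\<lambda>x. (v x, u x))"
    using assms(1) unfolding bc1.init_of_values sol_iff_solution by simp
  moreover have "sol z (force 0) (bc1.init ?a ?c) (U 0 z ?a ?c 0)"
    using U[OF L2_fun_zero, of z 0 ?a ?c] by simp
  ultimately show ?thesis by (rule sol_unique[OF L2_fun_zero _ _ assms(2)])
qed

section \<open>The Weyl matrix and its residues\<close>

abbreviation "Wm z \<equiv> Weyl_matrix \<sigma> T1 T2 H1 H2 z"

text \<open>Translates the chosen Weyl solution into boundary data: applied to \<open>c\<close> it
  has \<open>V\<^sub>1 = c\<close>, and its dual boundary value is \<open>Wm z c\<close>. Everything
  later about the Weyl matrix is derived from this.\<close>

lemma weyl_boundary:
  assumes r: "regular z"
  shows "V2 (U 0 z (Wm z *v c) c 0 pi) = 0"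
proof -
  let ?P = "\<lambda>\<Phi> \<Phi>1. solution (**) \<sigma> z \<Phi> \<Phi>1 \<and> boundary_form (**) T1 H1 (\<Phi> 0) (\<Phi>1 0) = mat 1 \<and>
    boundary_form (**) T2 H2 (\<Phi> pi) (\<Phi>1 pi) = 0"
  obtain a where a: "\<And>j. V2 (U 0 z (a j) (axis j 1) 0 pi) = 0"
  proof -
    have "\<forall>j. \<exists>a. V2 (U 0 z a (axis j 1) 0 pi) = 0" using regular_solve[OF r L2_fun_zero] by blast
    from choice[OF this] show ?thesis using that by blast
  qed
  let ?Y = "\<lambda>x. \<Sum>j\<in>UNIV. column_matrix j (fst (U 0 z (a j) (axis j 1) 0 x))"
  let ?Y1 = "\<lambda>x. \<Sum>j\<in>UNIV. column_matrix j (snd (U 0 z (a j) (axis j 1) 0 x))"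
  have "?P ?Y ?Y1"
  proof (intro conjI)
    show "solution (**) \<sigma> z ?Y ?Y1" by (rule solution_of_columns[OF solution_U])
    show "boundary_form (**) T1 H1 (?Y 0) (?Y1 0) = mat 1"
      unfolding boundary_form_column_matrix U_at_0[OF L2_fun_zero] bc1.boundary_form_init
      using sum_column_matrix_mult_axis[of "mat 1"] by simp
    show "boundary_form (**) T2 H2 (?Y pi) (?Y1 pi) = 0"
      unfolding boundary_form_column_matrix
      using a by (simp add: V2_def column_matrix_zero)
  qed
  then have "\<exists>p. case p of (\<Phi>, \<Phi>1) \<Rightarrow> ?P \<Phi> \<Phi>1" by (intro exI[of _ "(?Y, ?Y1)"]) simp
  then have W: "case Weyl_solution \<sigma> T1 T2 H1 H2 z of (\<Phi>, \<Phi>1) \<Rightarrow> ?P \<Phi> \<Phi>1"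
    unfolding Weyl_solution_def by (rule someI_ex)
  obtain \<Phi> \<Phi>1 where eq: "Weyl_solution \<sigma> T1 T2 H1 H2 z = (\<Phi>, \<Phi>1)" by (metis surj_pair)
  then have P: "?P \<Phi> \<Phi>1" using W by simp
  have M: "Wm z *v c = T1 *v (\<Phi> 0 *v c) + orth_compl T1 *v (\<Phi>1 0 *v c)"
    unfolding Weyl_matrix_def eq by (simp add: matrix_vector_mult_add_rdistrib matrix_vector_mul_assoc)
  have "boundary_form (*v) T1 H1 (\<Phi> 0 *v c) (\<Phi>1 0 *v c) = c"
    using P boundary_form_mult_vec[of T1 H1 "\<Phi> 0" "\<Phi>1 0" c] by simp
  then have "(\<Phi> pi *v c, \<Phi>1 pi *v c) = U 0 z (Wm z *v c) c 0 pi"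
    using solution_eq_U[OF solution_matrix_vec[OF P[THEN conjunct1], of c], of pi] by (simp add: M)
  moreover have "V2 (\<Phi> pi *v c, \<Phi>1 pi *v c) = 0"
    using P boundary_form_mult_vec[of T2 H2 "\<Phi> pi" "\<Phi>1 pi" c] by (simp add: V2_def)
  ultimately show ?thesis by simp
qed

lemma regular_cnj: "regular z \<Longrightarrow> regular (cnj z)"
  using nonreal_regular[of "cnj z"] by (cases "cnj z = z") auto

abbreviation "yW z c \<equiv> y 0 z (Wm z *v c) c 0"

text \<open>Green's formula is used twice against the Weyl solution at \<open>cnj w\<close>. With
  \<open>w\<close> in place of \<open>z\<close> its right-hand side vanishes, so the subtraction
  leaves a multiple of \<open>z - w\<close>.\<close>

lemma weyl_difference:
  assumes z: "regular z" and w: "regular w"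
  shows "cinner (Wm z *v c) \<gamma> - cinner (Wm w *v c) \<gamma> = - (z - w) * L2_inner (yW z c) (yW (cnj w) \<gamma>)"
proof -
  have 1: "cinner c (Wm (cnj w) *v \<gamma>) - cinner (Wm z *v c) \<gamma> = (z - w) * L2_inner (yW z c) (yW (cnj w) \<gamma>)" if z: "regular z" for z
    using green[OF L2_fun_zero L2_fun_zero weyl_boundary[OF z, of c] weyl_boundary[OF regular_cnj[OF w], of \<gamma>]] by simp
  show ?thesis using 1[OF z] 1[OF w] by (simp add: algebra_simps)
qed

lemma weyl_tendsto:
  assumes w: "regular w" and X: "X \<longlonglongrightarrow> w" "\<And>n. regular (X n)"
  shows "(\<lambda>n. Wm (X n) *v c) \<longlonglongrightarrow> Wm w *v c"
proof -
  have "\<exists>a0. (V2 (U 0 w a0 c 0 pi) = 0 \<and>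
     (\<forall>\<alpha>. eig w \<alpha> \<longrightarrow> L2_inner (y 0 w a0 c 0) (\<lambda>x. fst (phi_vec w \<alpha> x)) = 0)) \<and> (\<lambda>n. Wm (X n) *v c) \<longlonglongrightarrow> a0"
  proof (rule U_converges[OF L2_fun_zero X(1) tendsto_const])
    show "V2 (U 0 (X n) (Wm (X n) *v c) c 0 pi) = 0" for n by (rule weyl_boundary[OF X(2)])
    fix \<alpha> assume "eig w \<alpha>"
    \<comment> \<open>At a regular point the eigenspace is trivial, so the scalar products required
      by \<open>U_converges\<close> are all 0.\<close>
    then have "\<alpha> = 0" using w by (simp add: regular_def)
    then show "(\<lambda>n. L2_inner (y 0 (X n) (Wm (X n) *v c) c 0) (\<lambda>x. fst (phi_vec w \<alpha> x))) \<longlonglongrightarrow> 0"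
      by (simp add: phi_vec_L2_zero)
  qed
  then show ?thesis using regular_unique[OF w L2_fun_zero _ weyl_boundary[OF w]] by metis
qed

lemma weyl_has_derivative:
  assumes S: "open S" "\<And>z. z \<in> S \<Longrightarrow> regular z" and w: "w \<in> S"
  shows "((\<lambda>z. cinner (Wm z *v c) \<gamma>) has_field_derivative - L2_inner (yW w c) (yW (cnj w) \<gamma>)) (at w)"
proof -
  have "((\<lambda>z. (cinner (Wm z *v c) \<gamma> - cinner (Wm w *v c) \<gamma>) / (z - w)) \<longlongrightarrow> - L2_inner (yW w c) (yW (cnj w) \<gamma>)) (at w within S)"
    unfolding tendsto_at_iff_sequentially
  proof (intro allI impI)
    fix X assume X: "\<forall>i. X i \<in> S - {w}" "X \<longlonglongrightarrow> w"
    have r: "regular (X n)" "X n \<noteq> w" for n using X S by auto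
    have rw: "regular w" using S w by blast
    note lim = y_tendsto(1)[OF L2_fun_zero X(2) weyl_tendsto[OF rw X(2) r(1), of c] tendsto_const[of c] tendsto_const[of 0]]
    have "(\<lambda>n. - L2_inner (yW (X n) c) (yW (cnj w) \<gamma>)) \<longlonglongrightarrow> - L2_inner (yW w c) (yW (cnj w) \<gamma>)"
      using lim by (intro tendsto_minus L2_inner_tendsto U_L2 L2_fun_zero) simp
    moreover have "(cinner (Wm (X n) *v c) \<gamma> - cinner (Wm w *v c) \<gamma>) / (X n - w) = - L2_inner (yW (X n) c) (yW (cnj w) \<gamma>)" for n
      using weyl_difference[OF r(1)[of n] rw, of c \<gamma>] r(2)[of n] by (simp add: field_simps)
    ultimately show "((\<lambda>z. (cinner (Wm z *v c) \<gamma> - cinner (Wm w *v c) \<gamma>) / (z - w)) \<circ> X) \<longlonglongrightarrow> - L2_inner (yW w c) (yW (cnj w) \<gamma>)"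
      by (simp add: comp_def)
  qed
  then show ?thesis unfolding has_field_derivative_iff at_within_open[OF w S(1)] .
qed

lemma matrix_entry_cinner: "A $ i $ j = cinner (A *v axis j 1) (axis i 1)" for A :: "complex^'m^'m"
  unfolding matvec_axis by (simp add: cinner_def column_def axis_def if_distrib cong: if_cong)

text \<open>The residue exists as a simple one: by Green's formula every cluster point of
  \<open>(z - \<mu>) M(z) c\<close> is the coefficient of an eigenfunction with prescribed scalar products with
  the whole eigenspace.\<close>

lemma weyl_residue:
  "\<exists>a0. eig \<mu> a0 \<and> ((\<lambda>z. (z - \<mu>) *s (Wm z *v c)) \<longlongrightarrow> a0) (at \<mu>)"
proof -
  obtain e where e: "e > 0" "\<And>z. z \<in> ball \<mu> e - {\<mu>} \<Longrightarrow> regular z" using regular_punctured_ball by blast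
  define Q where "Q a \<longleftrightarrow> V2 (U 0 \<mu> a 0 0 pi) = 0 \<and>
     (\<forall>\<alpha>. eig \<mu> \<alpha> \<longrightarrow> L2_inner (y 0 \<mu> a 0 0) (\<lambda>x. fst (phi_vec \<mu> \<alpha> x)) = cinner c \<alpha>)" for a
  have Qu: "a = b" if "Q a" "Q b" for a b
  proof -
    have e: "eig \<mu> (a - b)" using that eig_lin[of \<mu> a b "-1"] by (simp add: Q_def U_no_force)
    let ?v = "\<lambda>x. fst (phi_vec \<mu> (a - b) x)"
    have "?v x = fst (phi_vec \<mu> a x) - fst (phi_vec \<mu> b x)" if "x \<in> {0..pi}" for x
      using phi_vec_lin[OF that, of \<mu> a "-1" b] by (simp add: pair_scale_def)
    then have "L2_inner ?v ?v = L2_inner ((\<lambda>x. fst (phi_vec \<mu> a x)) - (\<lambda>x. fst (phi_vec \<mu> b x))) ?v"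
      unfolding L2_inner_def by (intro Bochner_Integration.integral_cong) auto
    also have "\<dots> = 0" using that e by (simp add: L2_inner_diff_left phi_vec_L2 Q_def U_no_force)
    finally have "a - b = 0" by (rule phi_vec_inner_zero_imp)
    then show ?thesis by simp
  qed
  have seq: "\<exists>a0. Q a0 \<and> (\<lambda>n. (X n - \<mu>) *s (Wm (X n) *v c)) \<longlonglongrightarrow> a0"
    if X: "\<And>n. X n \<in> ball \<mu> e - {\<mu>}" "X \<longlonglongrightarrow> \<mu>" for X
    unfolding Q_def
  proof (rule U_converges[OF L2_fun_zero X(2)])
    have "(\<lambda>n. cmod (X n - \<mu>) * norm c) \<longlonglongrightarrow> 0 * norm c"
      using X(2) by (intro tendsto_mult tendsto_const tendsto_norm_zero LIM_zero)
    then have "(\<lambda>n. norm ((X n - \<mu>) *s c)) \<longlonglongrightarrow> 0" by (simp only: norm_scale_vec mult_zero_left)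
    then show "(\<lambda>n. (X n - \<mu>) *s c) \<longlonglongrightarrow> 0" by (rule tendsto_norm_zero_cancel)
    show V: "V2 (U 0 (X n) ((X n - \<mu>) *s (Wm (X n) *v c)) ((X n - \<mu>) *s c) 0 pi) = 0" for n
      using U_scale[OF L2_fun_zero, of pi "X n" "X n - \<mu>" "Wm (X n) *v c" c 0] weyl_boundary[OF e(2)[OF X(1)], of n c]
      by (simp add: V2_scale)
    fix \<alpha> assume \<alpha>: "eig \<mu> \<alpha>"
    have "L2_inner (y 0 (X n) ((X n - \<mu>) *s (Wm (X n) *v c)) ((X n - \<mu>) *s c) 0) (\<lambda>x. fst (phi_vec \<mu> \<alpha> x)) = cinner c \<alpha>" for n
    proof (cases "\<alpha> = 0")
      case True
      then show ?thesis by (simp add: phi_vec_L2_zero)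
    next
      case False
      then have "cnj \<mu> = \<mu>" using eig_real[OF \<alpha>] by blast
      then have "(X n - \<mu>) * cinner c \<alpha> = (X n - \<mu>) *
          L2_inner (y 0 (X n) ((X n - \<mu>) *s (Wm (X n) *v c)) ((X n - \<mu>) *s c) 0) (\<lambda>x. fst (phi_vec \<mu> \<alpha> x))"
        using green_eig[OF L2_fun_zero V \<alpha>, of n] unfolding cinner_scale_left by (simp only: mult_zero_left add_0_right)
      then show ?thesis using X(1)[of n] by auto
    qed
    then show "(\<lambda>n. L2_inner (y 0 (X n) ((X n - \<mu>) *s (Wm (X n) *v c)) ((X n - \<mu>) *s c) 0) (\<lambda>x. fst (phi_vec \<mu> \<alpha> x))) \<longlonglongrightarrow> cinner c \<alpha>"
      by simp
  qed
  have "\<mu> islimpt ball \<mu> e" using e(1) by (simp add: islimpt_ball)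
  then obtain X0 where "\<And>n. X0 n \<in> ball \<mu> e - {\<mu>}" "X0 \<longlonglongrightarrow> \<mu>" unfolding islimpt_sequential by blast
  then obtain a0 where a0: "Q a0" using seq by blast
  have "((\<lambda>z. (z - \<mu>) *s (Wm z *v c)) \<longlongrightarrow> a0) (at \<mu> within ball \<mu> e)"
    unfolding tendsto_at_iff_sequentially
  proof (intro allI impI)
    fix X assume "\<forall>i. X i \<in> ball \<mu> e - {\<mu>}" "X \<longlonglongrightarrow> \<mu>"
    then obtain a1 where "Q a1" "(\<lambda>n. (X n - \<mu>) *s (Wm (X n) *v c)) \<longlonglongrightarrow> a1" using seq by blast
    then show "((\<lambda>z. (z - \<mu>) *s (Wm z *v c)) \<circ> X) \<longlonglongrightarrow> a0" using Qu[OF a0] by (simp add: comp_def)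
  qed
  then have "((\<lambda>z. (z - \<mu>) *s (Wm z *v c)) \<longlongrightarrow> a0) (at \<mu>)"
    by (subst (asm) at_within_open) (use e(1) in auto)
  then show ?thesis using a0 by (auto simp: Q_def U_no_force)
qed

text \<open>Columnwise, the residue at an at most simple pole is the limit of
  \<open>(z - \<mu>) M(z)\<close>, which \<open>weyl_residue\<close> identifies as the coefficient
  of an eigenfunction. Holomorphy in the punctured ball makes the residue formula
  applicable.\<close>

lemma eig_weight_matrix: "eig \<mu> (weight_matrix \<sigma> T1 T2 H1 H2 \<mu> *v c)"
proof -
  obtain e where e: "e > 0" "\<And>z. z \<in> ball \<mu> e - {\<mu>} \<Longrightarrow> regular z" using regular_punctured_ball by blast
  let ?W = "weight_matrix \<sigma> T1 T2 H1 H2 \<mu>"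
  have col: "eig \<mu> (?W *v axis j 1)" for j
  proof -
    obtain a0 where a0: "eig \<mu> a0" "((\<lambda>z. (z - \<mu>) *s (Wm z *v axis j 1)) \<longlongrightarrow> a0) (at \<mu>)"
      using weyl_residue by blast
    have "residue (\<lambda>z. Wm z $ i $ j) \<mu> = a0 $ i" for i
    proof (rule residue_simple'[of "ball \<mu> e"])
      show "(\<lambda>z. Wm z $ i $ j) holomorphic_on ball \<mu> e - {\<mu>}"
      proof -
        have op: "open (ball \<mu> e - {\<mu>})" by (intro open_Diff) auto
        have "(\<lambda>z. cinner (Wm z *v axis j 1) (axis i 1)) holomorphic_on ball \<mu> e - {\<mu>}"
          unfolding holomorphic_on_open[OF op] using weyl_has_derivative[OF op e(2)] by blast
        then show ?thesis by (simp only: matrix_entry_cinner)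
      qed
      have "((\<lambda>z. ((z - \<mu>) *s (Wm z *v axis j 1)) $ i) \<longlongrightarrow> a0 $ i) (at \<mu>)" by (rule tendsto_vec_nth[OF a0(2)])
      moreover have "((z - \<mu>) *s (Wm z *v axis j 1)) $ i = Wm z $ i $ j * (z - \<mu>)" for z
        unfolding matvec_axis vector_smult_component column_def vec_lambda_beta by (rule mult.commute)
      ultimately show "((\<lambda>z. Wm z $ i $ j * (z - \<mu>)) \<longlongrightarrow> a0 $ i) (at \<mu>)"
        by (simp only:)
    qed (use e(1) in auto)
    then have "?W *v axis j 1 = a0" by (simp add: matvec_axis column_def weight_matrix_def vec_eq_iff)
    then show ?thesis using a0 by simp
  qed
  have "eig \<mu> (\<Sum>j\<in>UNIV. c $ j *s (?W *v axis j 1))" by (rule eig_sum[OF col])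
  moreover have "?W *v c = (\<Sum>j\<in>UNIV. c $ j *s (?W *v axis j 1))"
    by (subst (1) vec_sum_axis[of c]) (simp add: vec.sum vec.scale)
  ultimately show ?thesis by simp
qed

lemma phi_eq:
  assumes x: "x \<in> {0..pi}"
  shows "phi \<sigma> T1 H1 z x *v a = fst (phi_vec z a x)"
proof -
  let ?P = "\<lambda>Y. \<exists>Y1. solution (**) \<sigma> z Y Y1 \<and> Y 0 = T1 \<and> Y1 0 = orth_compl T1 + H1"
  have init: "bc1.init a 0 = (T1 *v a, (orth_compl T1 + H1) *v a)" for a by (simp add: bc1.init_def)
  have "\<exists>Y. ?P Y"
  proof (intro exI conjI)
    show "solution (**) \<sigma> z (\<lambda>x. \<Sum>j\<in>UNIV. column_matrix j (fst (U 0 z (axis j 1) 0 0 x)))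
        (\<lambda>x. \<Sum>j\<in>UNIV. column_matrix j (snd (U 0 z (axis j 1) 0 0 x)))"
      by (rule solution_of_columns[OF solution_U])
  qed (simp_all add: U_at_0[OF L2_fun_zero] init sum_column_matrix_mult_axis)
  then have "?P (phi \<sigma> T1 H1 z)" unfolding phi_def by (rule someI_ex)
  then obtain Y1 where Y: "solution (**) \<sigma> z (phi \<sigma> T1 H1 z) Y1" "phi \<sigma> T1 H1 z 0 = T1" "Y1 0 = orth_compl T1 + H1" by blast
  have "(phi \<sigma> T1 H1 z x *v a, Y1 x *v a) = U 0 z (T1 *v fst (bc1.init a 0) + orth_compl T1 *v snd (bc1.init a 0))
      (boundary_form (*v) T1 H1 (fst (bc1.init a 0)) (snd (bc1.init a 0))) 0 x"
    using solution_eq_U[OF solution_matrix_vec[OF Y(1), of a] x] by (simp add: Y(2,3) init)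
  then have "(phi \<sigma> T1 H1 z x *v a, Y1 x *v a) = phi_vec z a x"
    unfolding bc1.init_dual bc1.boundary_form_init by (simp add: phi_vec_def)
  then show ?thesis by (metis fst_conv)
qed

text \<open>If \<open>f\<close> is orthogonal to all eigenfunctions, then \<open>\<ell>Y = zY + f\<close> together with the boundary conditions
  has for every \<open>z\<close>, eigenvalues included, a unique solution \<open>Y z\<close> orthogonal to the eigenspace, so that
  \<open>F z = \<langle>Y z, f\<rangle>\<close> is entire.\<close>

lemma weak_completeness:
  assumes f: "L2_fun f" and orth: "\<And>z \<alpha>. eig z \<alpha> \<Longrightarrow> L2_inner f (\<lambda>x. fst (phi_vec z \<alpha> x)) = 0"
  shows "L2_norm f = 0"
proof -
  define Q where "Q z a \<longleftrightarrow> V2 (U f z a 0 1 pi) = 0 \<and>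
     (\<forall>\<alpha>. eig z \<alpha> \<longrightarrow> L2_inner (y f z a 0 1) (\<lambda>x. fst (phi_vec z \<alpha> x)) = 0)" for z a
  have Qu: "a = b" if "Q z a" "Q z b" for z a b
  proof -
    have "phi_vec z (a - b) x = U f z a 0 1 x + pair_scale (-1) (U f z b 0 1 x)" if "x \<in> {0..pi}" for x
      using U_lin[OF f that, of z a "-1" b 0 0 1 1] by (simp add: U_no_force)
    note d = this
    have e: "eig z (a - b)" using that by (simp add: d V2_lin Q_def)
    let ?v = "\<lambda>x. fst (phi_vec z (a - b) x)"
    have "L2_inner ?v ?v = L2_inner (y f z a 0 1 - y f z b 0 1) ?v"
      unfolding L2_inner_def by (intro Bochner_Integration.integral_cong) (auto simp: d pair_scale_def)
    also have "\<dots> = 0" using that e by (simp add: L2_inner_diff_left U_L2[OF f] phi_vec_L2 Q_def)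
    finally have "a - b = 0" by (rule phi_vec_inner_zero_imp)
    then show ?thesis by simp
  qed
  have conv: "\<exists>a0. Q z a0 \<and> an \<longlonglongrightarrow> a0" if zn: "zn \<longlonglongrightarrow> z" and Qn: "\<And>n. Q (zn n) (an n)" for zn z an
    unfolding Q_def
  proof (rule U_converges[OF f zn tendsto_const])
    show V: "V2 (U f (zn n) (an n) 0 1 pi) = 0" for n using Qn by (simp add: Q_def)
    fix \<alpha> assume \<alpha>: "eig z \<alpha>"
    have "L2_inner (y f (zn n) (an n) 0 1) (\<lambda>x. fst (phi_vec z \<alpha> x)) = 0" for n
    proof (cases "zn n = z")
      case True
      then show ?thesis using Qn[of n] \<alpha> by (simp add: Q_def)
    next
      case False
      then show ?thesis by (rule eig_inner_zero[OF f V \<alpha> _ orth[OF \<alpha>]])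
    qed
    then show "(\<lambda>n. L2_inner (y f (zn n) (an n) 0 1) (\<lambda>x. fst (phi_vec z \<alpha> x))) \<longlonglongrightarrow> 0" by simp
  qed
  have Qreg: "\<exists>a. Q z a" if rz: "regular z" for z
  proof -
    obtain a where a: "V2 (U f z a 0 1 pi) = 0" using regular_solve[OF rz f] by blast
    have "L2_inner (y f z a 0 1) (\<lambda>x. fst (phi_vec z \<alpha> x)) = 0" if "eig z \<alpha>" for \<alpha>
      using rz that by (intro phi_vec_L2_zero) (simp add: regular_def)
    with a show ?thesis unfolding Q_def by blast
  qed
  have "\<exists>a. Q z a" for z
  proof -
    \<comment> \<open>At an eigenvalue the coefficient is obtained as a limit along regular points;
      the orthogonality demanded by \<open>Q\<close> survives the limit and makes it unique.\<close>
    obtain e where e: "e > 0" "\<And>w. w \<in> ball z e - {z} \<Longrightarrow> regular w" using regular_punctured_ball by blast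
    have "z islimpt ball z e" using e(1) by (simp add: islimpt_ball)
    then obtain X where X: "\<And>n. X n \<in> ball z e - {z}" "X \<longlonglongrightarrow> z" unfolding islimpt_sequential by blast
    have "\<forall>n. \<exists>a. Q (X n) a" using Qreg[OF e(2)[OF X(1)]] by blast
    from choice[OF this] obtain an where "\<And>n. Q (X n) (an n)" by blast
    then show ?thesis using conv[OF X(2)] by blast
  qed
  then obtain a where a: "\<And>z. Q z (a z)" by metis
  define Y where "Y z = y f z (a z) 0 1" for z
  have YL: "L2_fun (Y z)" for z unfolding Y_def by (rule U_L2[OF f])
  have Va: "V2 (U f z (a z) 0 1 pi) = 0" for z using a by (simp add: Q_def)
  have Ylim: "(\<lambda>n. L2_norm (Y (zn n) - Y z)) \<longlonglongrightarrow> 0" if zn: "zn \<longlonglongrightarrow> z" for zn z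
  proof -
    obtain a0 where a0: "Q z a0" "(\<lambda>n. a (zn n)) \<longlonglongrightarrow> a0" using conv[OF zn, of "\<lambda>n. a (zn n)"] a by blast
    then have "(\<lambda>n. a (zn n)) \<longlonglongrightarrow> a z" using Qu[OF a0(1) a] by simp
    then show ?thesis using y_tendsto(1)[OF f zn _ tendsto_const tendsto_const, of "\<lambda>n. a (zn n)" "a z" 0 1]
      by (simp add: Y_def)
  qed
  have gr: "0 = (z - cnj w) * L2_inner (Y z) (Y w) + L2_inner f (Y w) - L2_inner (Y z) f" for z w
    using green[OF f f Va[of z] Va[of w]] by (simp add: Y_def)
  define F where "F z = L2_inner (Y z) f" for z
  \<comment> \<open>Both Green identities are taken against \<open>Y (cnj w)\<close>, whose
    parameter conjugates back to \<open>w\<close>, so that the second one has no term with a scalar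
    product of two \<open>Y\<close>.\<close>
  have Fd: "F z - F w = (z - w) * L2_inner (Y z) (Y (cnj w))" for z w
    using gr[of z "cnj w"] gr[of w "cnj w"] by (simp add: F_def diff_eq_eq)
  have "(F has_field_derivative L2_inner (Y w) (Y (cnj w))) (at w)" for w
  proof -
    have "((\<lambda>z. (F z - F w) / (z - w)) \<longlongrightarrow> L2_inner (Y w) (Y (cnj w))) (at w within UNIV)"
      unfolding tendsto_at_iff_sequentially
    proof (intro allI impI)
      fix X assume X: "\<forall>i. X i \<in> UNIV - {w}" "X \<longlonglongrightarrow> w"
      have "(F (X n) - F w) / (X n - w) = L2_inner (Y (X n)) (Y (cnj w))" for n
        using Fd[of "X n" w] X(1) by simp
      moreover have "(\<lambda>n. L2_inner (Y (X n)) (Y (cnj w))) \<longlonglongrightarrow> L2_inner (Y w) (Y (cnj w))"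
        by (intro L2_inner_tendsto YL Ylim X)
      ultimately show "((\<lambda>z. (F z - F w) / (z - w)) \<circ> X) \<longlonglongrightarrow> L2_inner (Y w) (Y (cnj w))"
        by (simp add: comp_def)
    qed
    then show ?thesis by (simp add: has_field_derivative_iff)
  qed
  then have "F holomorphic_on UNIV" unfolding holomorphic_on_open[OF open_UNIV] by blast
  moreover have ImF: "Im z * (L2_norm (Y z))\<^sup>2 = Im (F z)" for z
  proof -
    have "0 = Im ((z - cnj z) * L2_inner (Y z) (Y z) + L2_inner f (Y z) - L2_inner (Y z) f)" using gr[of z z] by simp
    also have "L2_inner f (Y z) = cnj (F z)" unfolding F_def by (rule L2_inner_commute)
    finally show ?thesis by (simp add: L2_inner_same F_def[symmetric] del: of_real_power)
  qed
  moreover have "\<bar>Im z\<bar> * cmod (F z) \<le> (L2_norm f)\<^sup>2" for z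
  proof -
    have FY: "cmod (F z) \<le> L2_norm (Y z) * L2_norm f" unfolding F_def by (rule L2_Cauchy_Schwarz[OF YL f])
    have "\<bar>Im z\<bar> * (L2_norm (Y z))\<^sup>2 = \<bar>Im (F z)\<bar>" using ImF[of z] by (metis abs_mult abs_power2)
    also have "\<dots> \<le> L2_norm (Y z) * L2_norm f" using abs_Im_le_cmod[of "F z"] FY by linarith
    finally have 0: "L2_norm (Y z) * (\<bar>Im z\<bar> * L2_norm (Y z)) \<le> L2_norm (Y z) * L2_norm f"
      by (simp add: power2_eq_square mult_ac)
    \<comment> \<open>The common factor \<open>L2_norm (Y z)\<close> is cancelled; when it is 0 the
      claim is trivial.\<close>
    have 1: "\<bar>Im z\<bar> * L2_norm (Y z) \<le> L2_norm f"
    proof (cases "L2_norm (Y z) = 0")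
      case False
      then have "L2_norm (Y z) > 0" using L2_norm_nonneg[of "Y z"] by linarith
      then show ?thesis using 0 by (rule mult_left_le_imp_le[rotated])
    qed simp
    have "\<bar>Im z\<bar> * cmod (F z) \<le> \<bar>Im z\<bar> * (L2_norm (Y z) * L2_norm f)" by (rule mult_left_mono[OF FY]) simp
    also have "\<dots> \<le> L2_norm f * L2_norm f" using mult_right_mono[OF 1, of "L2_norm f"] by (simp add: mult.assoc)
    finally show ?thesis by (simp add: power2_eq_square)
  qed
  ultimately have "F \<i> = 0" by (intro entire_resolvent_bound_zero)
  \<comment> \<open>At \<open>\<i>\<close> the identity \<open>ImF\<close> has the factor 1, so a
    vanishing \<open>F\<close> makes \<open>Y \<i>\<close> a null function, and the equation then
    leaves no room for a force.\<close>
  then have "(L2_norm (Y \<i>))\<^sup>2 = 0" using ImF[of \<i>] by simp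
  then have n0: "L2_norm (y f \<i> (a \<i>) 0 1) = 0" by (simp add: Y_def)
  show ?thesis using sol_fst_zero_force[OF L2_fun_scale[OF f, of 1] U[OF f] n0] by simp
qed

end

section \<open>Uniform bounds for eigenfunctions\<close>

text \<open>The function \<open>N exp K\<close> has a nonnegative derivative almost everywhere and
  is absolutely continuous, hence nondecreasing. The kernel may have either sign: for the energy
  \<open>N\<close> it is used with \<open>ks\<close>, for \<open>-N\<close> with
  \<open>-ks\<close>.\<close>

lemma gronwall_lower:
  fixes N n k :: "real \<Rightarrow> real"
  assumes ac: "abs_cont_on {0..b} N" and k: "k absolutely_integrable_on {0..b}"
    and ae: "AE x in lebesgue_on {0<..<b}. (N has_vector_derivative n x) (at x) \<and> - (k x * N x) \<le> n x"
    and x: "x \<in> {0..b}"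
  shows "N 0 \<le> N x * exp (integral {0..x} k)"
proof -
  let ?K = "\<lambda>t. integral {0..t} k" and ?P = "\<lambda>t. N t * exp (integral {0..t} k)"
  define bad where "bad = {x \<in> {0<..<b}. \<not> ((N has_vector_derivative n x) (at x) \<and> - (k x * N x) \<le> n x)}"
  have bad: "negligible bad" unfolding bad_def using ae by (subst (asm) AE_lebesgue_on_iff_negligible) auto
  obtain M where M: "negligible M" "\<And>t. t \<in> {0<..<b} - M \<Longrightarrow> (?K has_vector_derivative k t) (at t)"
    using has_vector_derivative_indefinite_integral_AE[OF set_lebesgue_integral_eq_integral(1)[OF k]] by blast
  have "abs_cont_on {0..b} ?P"
    by (rule abs_cont_on_bilinear[OF bounded_bilinear_mult ac abs_cont_on_exp[OF abs_cont_on_indefinite_integral[OF k]]])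
  then have P: "abs_cont_on {0..x} ?P" by (rule abs_cont_on_subset) (use x in auto)
  define d where "d t = (if t \<in> {0<..<b} - (bad \<union> M) then n t * exp (?K t) + N t * (k t * exp (?K t)) else 0)" for t
  have "(d has_integral ?P x - ?P 0) {0..x}"
  proof (rule fundamental_theorem_of_calculus_abs_cont[OF _ P negligible_Un[OF bad M(1)]])
    fix t assume "t \<in> {0<..<x} - (bad \<union> M)"
    then have t: "t \<in> {0<..<b} - (bad \<union> M)" using x by auto
    then have "(N has_real_derivative n t) (at t)" "(?K has_real_derivative k t) (at t)"
      using M(2)[of t] by (auto simp: bad_def has_real_derivative_iff_has_vector_derivative)
    then have "(?P has_real_derivative d t) (at t)" using t
      by (auto intro!: derivative_eq_intros simp: d_def)
    then show "(?P has_vector_derivative d t) (at t)" by (simp add: has_real_derivative_iff_has_vector_derivative)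
  qed (use x in auto)
  moreover have "d t \<ge> 0" for t
  proof (cases "t \<in> {0<..<b} - (bad \<union> M)")
    case True
    then have "0 \<le> n t + k t * N t" by (auto simp: bad_def)
    then have "0 \<le> (n t + k t * N t) * exp (?K t)" by simp
    then show ?thesis using True by (simp add: d_def algebra_simps)
  qed (simp only: d_def if_False)
  ultimately have "0 \<le> ?P x - ?P 0" by (rule has_integral_nonneg)
  then show ?thesis by simp
qed

lemma inner_eq_Re_cinner: "v \<bullet> w = Re (cinner v w)" for v w :: "complex^'m"
  by (simp add: inner_vec_def cinner_def inner_complex_def)

text \<open>Only \<open>V\<close> is finitely spanned, not the surrounding function space. A vector
  of \<open>V\<close> outside the span of \<open>B\<close> would enlarge \<open>B\<close> to an
  independent set with more elements than a basis of \<open>V\<close>.\<close>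

lemma (in vector_space) subset_span_of_card_eq_dim:
  assumes S: "finite S" "V \<subseteq> span S" and B: "B \<subseteq> V" "independent B" "card B = dim V"
  shows "V \<subseteq> span B"
proof
  fix v assume v: "v \<in> V"
  obtain C where C: "C \<subseteq> V" "independent C" "V \<subseteq> span C" "card C = dim V" using basis_exists by blast
  have "finite C" by (rule independent_span_bound[OF S(1) C(2), THEN conjunct1]) (use C(1) S(2) in blast)
  have finB: "finite B" by (rule independent_span_bound[OF S(1) B(2), THEN conjunct1]) (use B(1) S(2) in blast)
  show "v \<in> span B"
  proof (rule ccontr)
    assume nv: "v \<notin> span B"
    then have "independent (insert v B)" using B(2) by (rule independent_insertI)
    then have "card (insert v B) \<le> card C"
      using independent_span_bound[OF \<open>finite C\<close>, of "insert v B"] B(1) v C(3) by blast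
    moreover have "v \<notin> B" using nv span_base by blast
    ultimately show False using finB B(3) C(4) by simp
  qed
qed

lemma L2_fun_cong: "(\<And>x. x \<in> {0<..<pi} \<Longrightarrow> f x = g x) \<Longrightarrow> L2_fun f \<longleftrightarrow> L2_fun g"
  unfolding L2_fun_def
  by (intro arg_cong2[where f="(\<and>)"] measurable_cong Bochner_Integration.integrable_cong) auto

lemma L2_norm_cong: "(\<And>x. x \<in> {0<..<pi} \<Longrightarrow> f x = g x) \<Longrightarrow> L2_norm f = L2_norm g"
  unfolding L2_norm_def by (intro arg_cong[where f=sqrt] Bochner_Integration.integral_cong) auto

lemma L2_inner_cong:
  "(\<And>x. x \<in> {0<..<pi} \<Longrightarrow> f x = f' x) \<Longrightarrow> (\<And>x. x \<in> {0<..<pi} \<Longrightarrow> g x = g' x) \<Longrightarrow> L2_inner f g = L2_inner f' g'"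
  unfolding L2_inner_def by (intro Bochner_Integration.integral_cong) auto

lemma L2_norm_sum_orthogonal:
  assumes "finite S" "\<And>i. i \<in> S \<Longrightarrow> L2_fun (h i)"
    "\<And>i j. i \<in> S \<Longrightarrow> j \<in> S \<Longrightarrow> i \<noteq> j \<Longrightarrow> L2_inner (h i) (h j) = 0"
  shows "(L2_norm (\<Sum>i\<in>S. h i))\<^sup>2 = (\<Sum>i\<in>S. (L2_norm (h i))\<^sup>2)"
  using assms
proof (induction S)
  case (insert i S)
  have L: "L2_fun (h i)" "L2_fun (\<Sum>i\<in>S. h i)" using insert.prems by (auto intro: L2_fun_sum)
  have "L2_inner (h i) (\<Sum>j\<in>S. h j) = (\<Sum>j\<in>S. L2_inner (h i) (h j))"
    using insert.prems by (intro L2_inner_sum_right) auto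
  also have "\<dots> = 0" using insert.prems insert.hyps by (intro sum.neutral ballI) auto
  finally show ?case
    unfolding sum.insert[OF insert.hyps] L2_norm_add_sq[OF L]
    using insert.IH insert.prems by simp
qed simp

lemma norm_sum_orthonormal:
  fixes E :: "'i \<Rightarrow> complex^'m"
  assumes "finite S" "\<And>i j. i \<in> S \<Longrightarrow> j \<in> S \<Longrightarrow> cinner (E i) (E j) = (if i = j then 1 else 0)"
  shows "(norm (\<Sum>i\<in>S. a i *s E i))\<^sup>2 = (\<Sum>i\<in>S. (cmod (a i))\<^sup>2)"
  using assms
proof (induction S)
  case (insert i S)
  let ?s = "\<Sum>j\<in>S. a j *s E j"
  have lin: "linear (\<lambda>v. cinner v (E i))"
    by (rule bounded_linear.linear[OF bounded_bilinear.bounded_linear_left[OF bounded_bilinear_cinner]])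
  have "cinner ?s (a i *s E i) = cnj (a i) * (\<Sum>j\<in>S. a j * cinner (E j) (E i))"
    by (simp add: cinner_scale_right linear_sum[OF lin] cinner_scale_left)
  also have "\<dots> = 0" using insert.prems insert.hyps by (simp add: sum.neutral)
  finally have o: "cinner ?s (a i *s E i) = 0" .
  have "complex_of_real ((norm (E i))\<^sup>2) = 1" using insert.prems unfolding cinner_same[symmetric] by simp
  then have "(norm (E i))\<^sup>2 = 1" by (simp only: of_real_eq_1_iff)
  then have n: "(norm (a i *s E i))\<^sup>2 = (cmod (a i))\<^sup>2" by (simp add: norm_scale_vec power_mult_distrib)
  have "(norm (a i *s E i + ?s))\<^sup>2 = (norm (a i *s E i))\<^sup>2 + (norm ?s)\<^sup>2"
    by (rule norm_add_Pythagorean) (use o in \<open>simp add: orthogonal_def inner_eq_Re_cinner cinner_commute[of "a i *s E i" ?s]\<close>)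
  then show ?case using insert n by simp
qed simp

lemma rho_of_real:
  assumes "r > 0"
  shows "rho (of_real r) = of_real (sqrt r)"
  unfolding rho_def
proof (rule the_equality)
  have sq: "(complex_of_real (sqrt r))\<^sup>2 = of_real r" using assms by (simp flip: of_real_power)
  then show "(complex_of_real (sqrt r))\<^sup>2 = of_real r \<and> - pi / 2 \<le> Arg (complex_of_real (sqrt r)) \<and> Arg (complex_of_real (sqrt r)) < pi / 2"
    using assms by (simp add: Arg_of_real)
  fix s assume s: "s\<^sup>2 = complex_of_real r \<and> - pi / 2 \<le> Arg s \<and> Arg s < pi / 2"
  then have "s = of_real (sqrt r) \<or> s = of_real (- sqrt r)" using sq by (metis of_real_minus power2_eq_iff)
  moreover have "s \<noteq> of_real (- sqrt r)"
  proof
    assume "s = of_real (- sqrt r)"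
    then have "Arg s = pi" using assms by (simp only: Arg_of_real) simp
    then show False using s by simp
  qed
  ultimately show "s = of_real (sqrt r)" by blast
qed

context sturm_liouville
begin

text \<open>Up to terms with \<open>\<sigma>\<close>, the pair of \<open>y\<close> and \<open>u = Y\<^sup>[\<^sup>1\<^sup>]/\<rho>\<close> rotates with speed \<open>\<rho>\<close>: the energy
  \<open>N = \<bar>y\<bar>\<^sup>2 + \<bar>u\<bar>\<^sup>2\<close> stays comparable to its initial value, and integrating \<open>(y \<bullet> u)' \<approx> \<rho>(\<bar>u\<bar>\<^sup>2 - \<bar>y\<bar>\<^sup>2)\<close>
  shows that it is shared equally up to \<open>O(1/\<rho>)\<close>.\<close>

lemma energy_bounds:
  assumes \<rho>: "\<rho> \<ge> 1" and w: "sol (of_real (\<rho>\<^sup>2)) (force 0) p w"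
  defines "\<kappa> \<equiv> integral {0..pi} ks"
  defines "N0 \<equiv> (norm (fst p))\<^sup>2 + (norm ((1/\<rho>) *\<^sub>R snd p))\<^sup>2"
  shows "(L2_norm (\<lambda>x. fst (w x)))\<^sup>2 \<le> pi * (exp \<kappa> * N0)"
    and "pi * N0 / exp \<kappa> - exp \<kappa> * N0 * (1 + \<kappa>) / \<rho> \<le> 2 * (L2_norm (\<lambda>x. fst (w x)))\<^sup>2"
proof -
  define y where "y x = fst (w x)" for x
  define u where "u x = (1/\<rho>) *\<^sub>R snd (w x)" for x
  define N where "N x = y x \<bullet> y x + u x \<bullet> u x" for x
  define q where "q x = y x \<bullet> u x" for x
  define s where "s x = mult_bound * norm (\<sigma> x)" for x
  have s0: "s x \<ge> 0" for x using mult_bound(1) by (simp add: s_def)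
  have ks: "ks x = 2 * s x + (s x)\<^sup>2" for x by (simp add: ks_def s_def)
  have sv: "norm (\<sigma> x *v v) \<le> s x * norm v" for x v using mult_bound(2)[of "\<sigma> x" v] by (simp add: s_def mult_ac)
  note W = w[unfolded sol_unfold[OF L2_fun_zero]]
  have acy: "abs_cont_on {0..pi} y" using W by (simp add: y_def[abs_def])
  have acu: "abs_cont_on {0..pi} u" unfolding u_def[abs_def]
    using W by (intro abs_cont_on_linear[OF bounded_linear_scaleR_right]) auto
  have cy: "continuous_on {0..pi} y" and cu: "continuous_on {0..pi} u"
    by (intro abs_cont_on_imp_continuous_on acy acu)+
  have acN: "abs_cont_on {0..pi} N" unfolding N_def[abs_def]
    by (intro abs_cont_on_add abs_cont_on_bilinear[OF bounded_bilinear_inner] acy acu)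
  have acq: "abs_cont_on {0..pi} q" unfolding q_def[abs_def]
    by (rule abs_cont_on_bilinear[OF bounded_bilinear_inner acy acu])
  have cN: "continuous_on {0..pi} N" by (rule abs_cont_on_imp_continuous_on[OF acN])
  have N: "N x = (norm (y x))\<^sup>2 + (norm (u x))\<^sup>2" for x by (simp add: N_def power2_norm_eq_inner)
  have N00: "N 0 = N0" using W by (simp add: N N0_def y_def u_def)
  \<comment> \<open>\<open>n\<close> and \<open>m\<close> are the derivatives of \<open>N\<close>
    and \<open>q\<close>. In \<open>n\<close> the terms with the large factor \<open>\<rho>\<close>
    cancel, so the energy changes only at the rate \<open>ks\<close>.\<close>
  define n where "n x = 2 * (y x \<bullet> (\<sigma> x *v y x)) - 2 * (u x \<bullet> (\<sigma> x *v u x)) - (2/\<rho>) * (u x \<bullet> (\<sigma> x *v (\<sigma> x *v y x)))" for x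
  define m where "m x = \<rho> * ((norm (u x))\<^sup>2 - (norm (y x))\<^sup>2) - (1/\<rho>) * (norm (\<sigma> x *v y x))\<^sup>2" for x
  have ae: "AE x in leb_pi. (N has_vector_derivative n x) (at x) \<and> (q has_vector_derivative m x) (at x)"
    using W[THEN conjunct2, THEN conjunct2, THEN conjunct2, THEN conjunct1]
      W[THEN conjunct2, THEN conjunct2, THEN conjunct2, THEN conjunct2] \<sigma>_herm
  proof eventually_elim
    case (elim x)
    have snd_u: "snd (w x) = \<rho> *\<^sub>R u x" using \<rho> by (simp add: u_def)
    let ?dy = "\<sigma> x *v y x + \<rho> *\<^sub>R u x"
    let ?du = "- (\<sigma> x *v u x) - (1/\<rho>) *\<^sub>R (\<sigma> x *v (\<sigma> x *v y x)) - \<rho> *\<^sub>R y x"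
    have dy: "(y has_vector_derivative ?dy) (at x)" using elim(1) by (simp add: y_def[abs_def] snd_u)
    have "(u has_vector_derivative (1/\<rho>) *\<^sub>R (- (\<sigma> x *v snd (w x)) - \<sigma> x *v (\<sigma> x *v fst (w x)) - of_real (\<rho>\<^sup>2) *s fst (w x) - 0 x)) (at x)"
      unfolding u_def[abs_def] by (rule bounded_linear.has_vector_derivative[OF bounded_linear_scaleR_right elim(2)])
    also have "(1/\<rho>) *\<^sub>R (- (\<sigma> x *v snd (w x)) - \<sigma> x *v (\<sigma> x *v fst (w x)) - of_real (\<rho>\<^sup>2) *s fst (w x) - 0 x) = ?du"
      using \<rho> unfolding snd_u y_def scaleR_eq_vec_scale[of "\<rho>\<^sup>2", symmetric]
      by (simp add: linear_cmul[OF bounded_linear.linear[OF matvec_bounded_linear]]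
          scaleR_diff_right power2_eq_square)
    finally have du: "(u has_vector_derivative ?du) (at x)" .
    have herm: "(\<sigma> x *v a) \<bullet> b = a \<bullet> (\<sigma> x *v b)" for a b
      unfolding inner_eq_Re_cinner by (simp only: cinner_hermitian[OF elim(3)])
    have "(N has_vector_derivative (y x \<bullet> ?dy + ?dy \<bullet> y x) + (u x \<bullet> ?du + ?du \<bullet> u x)) (at x)"
      unfolding N_def[abs_def]
      by (intro has_vector_derivative_add bounded_bilinear.has_vector_derivative[OF bounded_bilinear_inner] dy du)
    moreover have "(y x \<bullet> ?dy + ?dy \<bullet> y x) + (u x \<bullet> ?du + ?du \<bullet> u x) = n x"
      unfolding n_def inner_commute[of ?dy "y x"] inner_commute[of ?du "u x"]
      by (simp add: inner_add_right inner_diff_right inner_commute[of "u x" "y x"] algebra_simps)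
    moreover have "(q has_vector_derivative (y x \<bullet> ?du + ?dy \<bullet> u x)) (at x)"
      unfolding q_def[abs_def] by (rule bounded_bilinear.has_vector_derivative[OF bounded_bilinear_inner dy du])
    moreover have "y x \<bullet> ?du + ?dy \<bullet> u x = m x"
      unfolding m_def
      by (simp add: inner_add_left inner_diff_right power2_norm_eq_inner herm algebra_simps)
    ultimately show ?case by simp
  qed
  have n_le: "\<bar>n x\<bar> \<le> ks x * N x" for x
  proof -
    have i: "\<bar>a \<bullet> (\<sigma> x *v b)\<bar> \<le> s x * (norm a * norm b)" for a b
    proof -
      have "\<bar>a \<bullet> (\<sigma> x *v b)\<bar> \<le> norm a * norm (\<sigma> x *v b)" by (rule Cauchy_Schwarz_ineq2)
      also have "\<dots> \<le> norm a * (s x * norm b)" by (intro mult_left_mono sv) auto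
      finally show ?thesis by (simp add: mult_ac)
    qed
    have 1: "\<bar>y x \<bullet> (\<sigma> x *v y x)\<bar> \<le> s x * (norm (y x))\<^sup>2" "\<bar>u x \<bullet> (\<sigma> x *v u x)\<bar> \<le> s x * (norm (u x))\<^sup>2"
      using i[of "y x" "y x"] i[of "u x" "u x"] by (simp_all add: power2_eq_square)
    have "\<bar>u x \<bullet> (\<sigma> x *v (\<sigma> x *v y x))\<bar> \<le> s x * (norm (u x) * norm (\<sigma> x *v y x))" by (rule i)
    also have "\<dots> \<le> s x * (norm (u x) * (s x * norm (y x)))" by (intro mult_left_mono sv s0) auto
    finally have 2: "\<bar>u x \<bullet> (\<sigma> x *v (\<sigma> x *v y x))\<bar> \<le> (s x)\<^sup>2 * (norm (u x) * norm (y x))"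
      by (simp add: power2_eq_square mult_ac)
    have "(2/\<rho>) * \<bar>u x \<bullet> (\<sigma> x *v (\<sigma> x *v y x))\<bar> \<le> 2 * ((s x)\<^sup>2 * (norm (u x) * norm (y x)))"
      using \<rho> 2 by (intro mult_mono) (auto simp: field_simps)
    also have "\<dots> = (s x)\<^sup>2 * (2 * norm (u x) * norm (y x))" by simp
    also have "\<dots> \<le> (s x)\<^sup>2 * N x" unfolding N
      by (rule mult_left_mono) (use sum_squares_bound[of "norm (u x)" "norm (y x)"] in auto)
    finally have 3: "\<bar>(2/\<rho>) * (u x \<bullet> (\<sigma> x *v (\<sigma> x *v y x)))\<bar> \<le> (s x)\<^sup>2 * N x"
      using \<rho> by (simp add: abs_mult)
    have "\<bar>n x\<bar> \<le> 2 * (s x * (norm (y x))\<^sup>2) + 2 * (s x * (norm (u x))\<^sup>2) + (s x)\<^sup>2 * N x"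
      unfolding n_def using 1 3 by linarith
    then show ?thesis by (simp add: ks N algebra_simps)
  qed
  have ksx: "integral {0..x} ks \<le> \<kappa>" if "x \<in> {0..pi}" for x
    unfolding \<kappa>_def using that ks_nonneg set_lebesgue_integral_eq_integral(1)[OF ks_int]
    by (intro integral_subset_le) (auto intro: integrable_on_subinterval)
  have N_nn: "N x \<ge> 0" for x by (simp add: N)
  have lower: "N0 / exp \<kappa> \<le> N x" if x: "x \<in> {0..pi}" for x
  proof -
    have "N 0 \<le> N x * exp (integral {0..x} ks)"
    proof (rule gronwall_lower[OF acN ks_int _ x])
      show "AE x in leb_pi. (N has_vector_derivative n x) (at x) \<and> - (ks x * N x) \<le> n x"
        using ae by eventually_elim (use n_le in \<open>auto simp: abs_le_iff minus_le_iff\<close>)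
    qed
    also have "\<dots> \<le> N x * exp \<kappa>" using ksx[OF x] N_nn by (intro mult_left_mono) auto
    finally show ?thesis by (simp add: N00 field_simps)
  qed
  have upper: "N x \<le> exp \<kappa> * N0" if x: "x \<in> {0..pi}" for x
  proof -
    have ki: "(\<lambda>x. - ks x) absolutely_integrable_on {0..pi}"
      using absolutely_integrable_scaleR_left[OF ks_int, of "-1"] by simp
    \<comment> \<open>The lower Gronwall bound for \<open>-N\<close> with kernel \<open>-ks\<close>
      is an upper bound for \<open>N\<close>.\<close>
    have "- N 0 \<le> - N x * exp (integral {0..x} (\<lambda>x. - ks x))"
    proof (rule gronwall_lower[OF _ ki _ x, where n="\<lambda>x. - n x"])
      show "abs_cont_on {0..pi} (\<lambda>x. - N x)"
        by (rule abs_cont_on_linear[OF bounded_linear_minus[OF bounded_linear_ident] acN])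
      show "AE x in leb_pi. ((\<lambda>x. - N x) has_vector_derivative - n x) (at x) \<and> - (- ks x * - N x) \<le> - n x"
        using ae by eventually_elim (use n_le in \<open>auto simp: abs_le_iff intro: has_vector_derivative_minus\<close>)
    qed
    then have "N x * exp (- integral {0..x} ks) \<le> N0" by (simp add: N00)
    then have "N x \<le> exp (integral {0..x} ks) * N0" by (simp add: exp_minus field_simps)
    also have "\<dots> \<le> exp \<kappa> * N0" using ksx[OF x] N_nn[of 0] N00 by (intro mult_right_mono) auto
    finally show ?thesis .
  qed
  have iy: "((\<lambda>x. (norm (y x))\<^sup>2) has_integral (L2_norm (\<lambda>x. fst (w x)))\<^sup>2) {0..pi}"
  proof -
    have "integrable leb_pi (\<lambda>x. (norm (y x))\<^sup>2)" using L2_fun_continuous[OF cy] by (simp add: L2_fun_def)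
    then have "(L2_norm y)\<^sup>2 = integral {0..pi} (\<lambda>x. (norm (y x))\<^sup>2)"
      unfolding L2_norm_sq by (rule lebesgue_integral_leb_pi)
    moreover have "(\<lambda>x. (norm (y x))\<^sup>2) integrable_on {0..pi}"
      by (intro integrable_continuous_real continuous_intros cy)
    ultimately show ?thesis unfolding y_def[abs_def, symmetric] by (simp add: has_integral_integrable_integral)
  qed
  let ?I = "(L2_norm (\<lambda>x. fst (w x)))\<^sup>2"
  have hc: "((\<lambda>x. c) has_integral pi * c) {0..pi}" for c :: real
    using has_integral_const_real[of c 0 pi] by simp
  show "?I \<le> pi * (exp \<kappa> * N0)"
  proof (rule has_integral_le[OF iy hc])
    fix x assume "x \<in> {0..pi}"
    then have "N x \<le> exp \<kappa> * N0" by (rule upper)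
    then show "(norm (y x))\<^sup>2 \<le> exp \<kappa> * N0" unfolding N using zero_le_power2[of "norm (u x)"] by linarith
  qed
  define V where "V = integral {0..pi} (\<lambda>x. (norm (u x))\<^sup>2)"
  have iu: "((\<lambda>x. (norm (u x))\<^sup>2) has_integral V) {0..pi}"
    unfolding V_def by (intro integrable_integral integrable_continuous_real continuous_intros cu)
  have sum: "pi * (N0 / exp \<kappa>) \<le> ?I + V"
    by (rule has_integral_le[OF hc has_integral_add[OF iy iu]]) (use lower in \<open>auto simp: N\<close>)
  have neg: "negligible {x \<in> {0<..<pi}. \<not> ((N has_vector_derivative n x) (at x) \<and> (q has_vector_derivative m x) (at x))}"
    using ae by (subst (asm) AE_lebesgue_on_iff_negligible) auto
  have im: "(m has_integral q pi - q 0) {0..pi}"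
    by (rule fundamental_theorem_of_calculus_abs_cont[OF _ acq neg]) auto
  have ik: "((\<lambda>x. exp \<kappa> * N0 * ks x) has_integral exp \<kappa> * N0 * \<kappa>) {0..pi}"
    unfolding \<kappa>_def using integrable_integral[OF set_lebesgue_integral_eq_integral(1)[OF ks_int]]
    by (rule has_integral_mult_right)
  \<comment> \<open>An upper bound for \<open>V - ?I\<close> of order \<open>1 / \<rho>\<close>,
    combined with the lower bound for \<open>?I + V\<close>, bounds \<open>?I\<close> from
    below.\<close>
  have "\<rho> * (V - ?I) \<le> (q pi - q 0) + exp \<kappa> * N0 * \<kappa>"
  proof (rule has_integral_le[OF has_integral_mult_right[OF has_integral_diff[OF iu iy]] has_integral_add[OF im ik]])
    fix x assume x: "x \<in> {0..pi}"
    have "norm (\<sigma> x *v y x) \<le> s x * norm (y x)" by (rule sv)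
    then have "(norm (\<sigma> x *v y x))\<^sup>2 \<le> (s x)\<^sup>2 * (norm (y x))\<^sup>2"
      unfolding power_mult_distrib[symmetric] by (rule power_mono) simp
    then have "(1/\<rho>) * (norm (\<sigma> x *v y x))\<^sup>2 \<le> 1 * ((s x)\<^sup>2 * (norm (y x))\<^sup>2)"
      using \<rho> by (intro mult_mono) auto
    also have "\<dots> \<le> ks x * N x"
      unfolding mult_1 by (rule mult_mono) (auto simp: ks N s0)
    also have "\<dots> \<le> ks x * (exp \<kappa> * N0)" by (rule mult_left_mono[OF upper[OF x] ks_nonneg])
    finally show "\<rho> * ((norm (u x))\<^sup>2 - (norm (y x))\<^sup>2) \<le> m x + exp \<kappa> * N0 * ks x"
      unfolding m_def by (simp add: mult_ac)
  qed
  also have "q pi - q 0 \<le> exp \<kappa> * N0"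
  proof -
    have q2: "2 * \<bar>q x\<bar> \<le> exp \<kappa> * N0" if x: "x \<in> {0..pi}" for x
    proof -
      have "2 * \<bar>q x\<bar> \<le> 2 * norm (y x) * norm (u x)" unfolding q_def using Cauchy_Schwarz_ineq2[of "y x" "u x"] by simp
      also have "\<dots> \<le> N x" unfolding N by (rule sum_squares_bound)
      also have "\<dots> \<le> exp \<kappa> * N0" by (rule upper[OF x])
      finally show ?thesis .
    qed
    show ?thesis using q2[of 0] q2[of pi] by auto
  qed
  finally have "\<rho> * (V - ?I) \<le> exp \<kappa> * N0 * (1 + \<kappa>)" by (simp add: algebra_simps)
  then have "V - ?I \<le> exp \<kappa> * N0 * (1 + \<kappa>) / \<rho>" using \<rho> by (simp add: pos_le_divide_eq mult.commute)
  with sum show "pi * N0 / exp \<kappa> - exp \<kappa> * N0 * (1 + \<kappa>) / \<rho> \<le> 2 * ?I" by simp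
qed

section \<open>Two-sided bounds for the scaled eigenfunctions\<close>

lemma T_mat_mult_vec:
  "T_mat T1 \<mu> *v v = (if rho \<mu> \<noteq> 0 then T1 *v v + rho \<mu> *s (v - T1 *v v) else v)"
  by (simp add: T_mat_def matrix_vector_mult_add_rdistrib mat_mult_vec orth_compl_mult_vec flip: matrix_vector_mul_assoc)

lemma invertible_T_mat: "invertible (T_mat T1 \<mu>)"
proof (cases "rho \<mu> = 0")
  case True
  then show ?thesis by (auto simp: T_mat_def invertible_def intro!: exI[of _ "mat 1"])
next
  case False
  \<comment> \<open>\<open>T1\<close> and its complement are complementary projections, so the
    inverse is obtained by inverting the scalar \<open>rho\<close>.\<close>
  let ?A = "T1 + mat (1 / rho \<mu>) ** orth_compl T1"
  have A: "?A *v v = T1 *v v + (1 / rho \<mu>) *s (v - T1 *v v)" for v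
    by (simp add: matrix_vector_mult_add_rdistrib mat_mult_vec orth_compl_mult_vec flip: matrix_vector_mul_assoc)
  note s = A T_mat_mult_vec False matrix_vector_right_distrib matrix_vector_mult_diff_distrib vector_scalar_commute
    bc1.TT matrix_vector_mul_assoc[symmetric]
  have "T_mat T1 \<mu> ** ?A = mat 1" "?A ** T_mat T1 \<mu> = mat 1"
    unfolding matrix_eq by (simp_all add: s)
  then show ?thesis unfolding invertible_def by blast
qed

lemma T_mat_inverse:
  "T_mat T1 \<mu> ** matrix_inv (T_mat T1 \<mu>) = mat 1" "matrix_inv (T_mat T1 \<mu>) ** T_mat T1 \<mu> = mat 1"
  using someI_ex[OF invertible_T_mat[of \<mu>, unfolded invertible_def]] unfolding matrix_inv_def by blast+

definition phi_T :: "complex \<Rightarrow> complex^'m \<Rightarrow> real \<Rightarrow> complex^'m" where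
  "phi_T z v = (\<lambda>x. fst (phi_vec z (T_mat T1 z *v v) x))"

lemma phi_T_L2: "L2_fun (phi_T z v)"
  unfolding phi_T_def by (rule phi_vec_L2)

lemma phi_vec_sum: "x \<in> {0..pi} \<Longrightarrow> fst (phi_vec z (\<Sum>i\<in>S. a i *s v i) x) = (\<Sum>i\<in>S. a i *s fst (phi_vec z (v i) x))"
proof (induction S rule: infinite_finite_induct)
  case (insert i S)
  then show ?case using phi_vec_lin[of x z "\<Sum>i\<in>S. a i *s v i" "a i" "v i"]
    by (simp add: add.commute pair_scale_def)
qed (simp_all add: phi_vec_0)

lemma phi_T_sum: "x \<in> {0..pi} \<Longrightarrow> phi_T z (\<Sum>i\<in>S. a i *s v i) x = (\<Sum>i\<in>S. a i *s phi_T z (v i) x)"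
  by (simp add: phi_T_def phi_vec_sum vec.sum vec.scale)

lemma phi_T_zero_imp: "L2_norm (phi_T z v) = 0 \<Longrightarrow> v = 0"
proof -
  assume "L2_norm (phi_T z v) = 0"
  then have "T_mat T1 z *v v = 0" unfolding phi_T_def by (rule phi_vec_zero_imp)
  then have "(matrix_inv (T_mat T1 z) ** T_mat T1 z) *v v = 0" by (simp add: matrix_vector_mul_assoc[symmetric])
  then show "v = 0" by (simp add: T_mat_inverse)
qed

lemma phi_T_bounds_large:
  obtains R c C where "c > 0" "\<And>r v. r \<ge> R \<Longrightarrow> c * (norm v)\<^sup>2 \<le> (L2_norm (phi_T (of_real r) v))\<^sup>2"
    "\<And>r v. r \<ge> R \<Longrightarrow> (L2_norm (phi_T (of_real r) v))\<^sup>2 \<le> C * (norm v)\<^sup>2"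
proof -
  define \<kappa> where "\<kappa> = integral {0..pi} ks"
  have k0: "\<kappa> \<ge> 0" unfolding \<kappa>_def by (rule integral_nonneg_always[OF ks_nonneg])
  \<comment> \<open>Beyond this threshold the error term of \<open>energy_bounds\<close> is at most
    half of its main term, which leaves the constant \<open>pi / (4 exp \<kappa>)\<close>.\<close>
  define \<rho>0 where "\<rho>0 = max 1 (2 * (exp \<kappa>)\<^sup>2 * (1 + \<kappa>) / pi)"
  obtain B where B: "B \<ge> 0" "\<And>v. norm (H1 *v v) \<le> B * norm v"
  proof
    show "0 \<le> norm H1 * mult_bound" using mult_bound(1) by simp
    show "norm (H1 *v v) \<le> norm H1 * mult_bound * norm v" for v using mult_bound(2)[of H1 v] by (simp add: mult_ac)
  qed
  have main: "pi / (4 * exp \<kappa>) * (norm v)\<^sup>2 \<le> (L2_norm (phi_T (of_real r) v))\<^sup>2 \<and>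
      (L2_norm (phi_T (of_real r) v))\<^sup>2 \<le> (pi * exp \<kappa> * (1 + B\<^sup>2)) * (norm v)\<^sup>2" if r: "r \<ge> \<rho>0\<^sup>2" for r v
  proof -
    define \<rho> where "\<rho> = sqrt r"
    have "\<rho>0 \<ge> 1" by (simp add: \<rho>0_def)
    then have "\<rho>0 \<le> \<rho>" unfolding \<rho>_def using r by (intro real_le_rsqrt)
    have "0 \<le> \<rho>0\<^sup>2" by simp
    then have r0: "r \<ge> 0" using r by linarith
    have \<rho>: "\<rho> \<ge> 1" "\<rho>\<^sup>2 = r" "2 * (exp \<kappa>)\<^sup>2 * (1 + \<kappa>) / pi \<le> \<rho>"
      using \<open>\<rho>0 \<le> \<rho>\<close> r0 by (auto simp: \<rho>0_def \<rho>_def)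
    have rpos: "r > 0" using \<rho>(1,2) by (metis less_le_trans zero_less_one zero_less_power)
    have rho: "rho (of_real r) = of_real \<rho>" unfolding \<rho>_def by (rule rho_of_real[OF rpos])
    let ?a = "T_mat T1 (of_real r) *v v"
    have a: "?a = T1 *v v + of_real \<rho> *s (v - T1 *v v)" using \<rho>(1) by (simp add: T_mat_mult_vec rho)
    let ?p = "bc1.init ?a 0"
    have f: "fst ?p = T1 *v v"
      by (simp add: bc1.init_def a matrix_vector_right_distrib vector_scalar_commute matrix_vector_mult_diff_distrib bc1.TT)
    have "snd ?p = of_real \<rho> *s (v - T1 *v v) + H1 *v v"
      by (simp add: bc1.init_def a matrix_vector_right_distrib vector_scalar_commute matrix_vector_mult_diff_distrib
          bc1.TT bc1.HT matrix_vector_mult_add_rdistrib orth_compl_mult_vec)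
    then have s: "(1/\<rho>) *\<^sub>R snd ?p = (v - T1 *v v) + (1/\<rho>) *\<^sub>R (H1 *v v)"
      using \<rho>(1) by (simp add: scaleR_add_right scaleR_diff_right flip: scaleR_eq_vec_scale)
    \<comment> \<open>\<open>H1 v\<close> lies in the range of \<open>T1\<close>, hence is
      orthogonal to \<open>v - T1 v\<close>. The initial energy is therefore exactly
      \<open>\<bar>v\<bar>\<^sup>2\<close> plus the square of \<open>H1 v / \<rho>\<close>, without
      mixed terms.\<close>
    have o1: "(v - T1 *v v) \<bullet> (H1 *v v) = 0"
      unfolding inner_eq_Re_cinner by (simp add: cinner_diff_left bc1.T_adj bc1.TH)
    have o2: "(T1 *v v) \<bullet> (v - T1 *v v) = 0"
      unfolding inner_eq_Re_cinner by (simp add: bc1.T_adj matrix_vector_mult_diff_distrib bc1.TT)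
    have "(norm v)\<^sup>2 = (norm (T1 *v v + (v - T1 *v v)))\<^sup>2" by simp
    also have "\<dots> = (norm (T1 *v v))\<^sup>2 + (norm (v - T1 *v v))\<^sup>2"
      by (rule norm_add_Pythagorean) (use o2 in \<open>simp add: orthogonal_def\<close>)
    finally have nv: "(norm v)\<^sup>2 = (norm (T1 *v v))\<^sup>2 + (norm (v - T1 *v v))\<^sup>2" .
    define N0 where "N0 = (norm (fst ?p))\<^sup>2 + (norm ((1/\<rho>) *\<^sub>R snd ?p))\<^sup>2"
    have "(norm ((1/\<rho>) *\<^sub>R snd ?p))\<^sup>2 = (norm (v - T1 *v v))\<^sup>2 + (norm ((1/\<rho>) *\<^sub>R (H1 *v v)))\<^sup>2"
      unfolding s by (rule norm_add_Pythagorean) (use o1 in \<open>simp add: orthogonal_def\<close>)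
    then have N0: "N0 = (norm v)\<^sup>2 + (norm ((1/\<rho>) *\<^sub>R (H1 *v v)))\<^sup>2" by (simp add: N0_def f nv)
    have "norm ((1/\<rho>) *\<^sub>R (H1 *v v)) \<le> 1 * (B * norm v)"
      using \<rho>(1) B by (simp only: norm_scaleR) (intro mult_mono, auto)
    then have "(norm ((1/\<rho>) *\<^sub>R (H1 *v v)))\<^sup>2 \<le> B\<^sup>2 * (norm v)\<^sup>2"
      unfolding power_mult_distrib[symmetric] mult_1 by (rule power_mono) simp
    then have N0u: "N0 \<le> (1 + B\<^sup>2) * (norm v)\<^sup>2" by (simp add: N0 algebra_simps)
    have N0l: "(norm v)\<^sup>2 \<le> N0" by (simp add: N0)
    have w: "sol (of_real (\<rho>\<^sup>2)) (force 0) ?p (phi_vec (of_real r) ?a)" unfolding \<rho>(2) by (rule phi_vec)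
    note eb = energy_bounds[OF \<rho>(1) w, folded \<kappa>_def N0_def phi_T_def]
    have "(L2_norm (phi_T (of_real r) v))\<^sup>2 \<le> pi * (exp \<kappa> * N0)" by (rule eb(1))
    also have "\<dots> \<le> pi * (exp \<kappa> * ((1 + B\<^sup>2) * (norm v)\<^sup>2))" using N0u by (intro mult_left_mono) auto
    finally have up: "(L2_norm (phi_T (of_real r) v))\<^sup>2 \<le> (pi * exp \<kappa> * (1 + B\<^sup>2)) * (norm v)\<^sup>2" by (simp add: mult.assoc)
    have "exp \<kappa> * N0 * (1 + \<kappa>) / \<rho> \<le> pi * N0 / exp \<kappa> / 2"
    proof -
      have "2 * (exp \<kappa>)\<^sup>2 * (1 + \<kappa>) \<le> \<rho> * pi" using \<rho>(3) by (simp add: pos_divide_le_eq)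
      then have "(2 * (exp \<kappa>)\<^sup>2 * (1 + \<kappa>)) * N0 \<le> (\<rho> * pi) * N0" by (rule mult_right_mono) (simp add: N0)
      then show ?thesis using \<rho>(1) by (simp add: field_simps power2_eq_square)
    qed
    then have "pi * N0 / exp \<kappa> / 2 \<le> 2 * (L2_norm (phi_T (of_real r) v))\<^sup>2" using eb(2) by linarith
    moreover have "pi / (4 * exp \<kappa>) * (norm v)\<^sup>2 \<le> pi / (4 * exp \<kappa>) * N0" by (rule mult_left_mono[OF N0l]) simp
    ultimately have "pi / (4 * exp \<kappa>) * (norm v)\<^sup>2 \<le> (L2_norm (phi_T (of_real r) v))\<^sup>2" by simp
    with up show ?thesis by blast
  qed
  show ?thesis
    by (rule that[of "pi / (4 * exp \<kappa>)" "\<rho>0\<^sup>2" "pi * exp \<kappa> * (1 + B\<^sup>2)"]) (use main in auto)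
qed

text \<open>For a single parameter compactness suffices: the norm of \<open>phi_T z v\<close> is
  continuous and positive on the unit sphere and homogeneous in \<open>v\<close>. The constants
  depend on \<open>z\<close>, so this serves only finitely many eigenvalues.\<close>

lemma phi_T_bounds_fixed:
  obtains c C where "c > 0" "\<And>v. c * (norm v)\<^sup>2 \<le> (L2_norm (phi_T z v))\<^sup>2" "\<And>v. (L2_norm (phi_T z v))\<^sup>2 \<le> C * (norm v)\<^sup>2"
proof -
  have cont: "continuous_on (sphere 0 1) (\<lambda>v. L2_norm (phi_T z v))"
    unfolding continuous_on_sequentially
  proof (intro allI ballI impI)
    fix X :: "nat \<Rightarrow> complex^'m" and a assume X: "(\<forall>n. X n \<in> sphere 0 1) \<and> X \<longlonglongrightarrow> a"
    have "(\<lambda>n. T_mat T1 z *v X n) \<longlonglongrightarrow> T_mat T1 z *v a"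
      using X by (intro bounded_linear.tendsto[OF matvec_bounded_linear]) auto
    from y_tendsto(1)[OF L2_fun_zero tendsto_const this tendsto_const tendsto_const, of z 0 0]
    have "(\<lambda>n. L2_norm (phi_T z (X n) - phi_T z a)) \<longlonglongrightarrow> 0" unfolding phi_T_def U_no_force .
    then show "((\<lambda>v. L2_norm (phi_T z v)) \<circ> X) \<longlonglongrightarrow> L2_norm (phi_T z a)"
      unfolding comp_def by (intro L2_norm_tendsto phi_T_L2)
  qed
  have "axis undefined 1 \<in> sphere (0 :: complex^'m) 1" by simp
  then have ne: "sphere (0 :: complex^'m) 1 \<noteq> {}" by blast
  obtain v1 where v1: "v1 \<in> sphere 0 1" "\<And>v. v \<in> sphere 0 1 \<Longrightarrow> L2_norm (phi_T z v1) \<le> L2_norm (phi_T z v)"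
    using continuous_attains_inf[OF compact_sphere ne cont] by blast
  obtain v2 where v2: "\<And>v. v \<in> sphere 0 1 \<Longrightarrow> L2_norm (phi_T z v) \<le> L2_norm (phi_T z v2)"
    using continuous_attains_sup[OF compact_sphere ne cont] by blast
  have "L2_norm (phi_T z v1) \<noteq> 0" using phi_T_zero_imp[of z v1] v1(1) by auto
  then have pos: "L2_norm (phi_T z v1) > 0" using L2_norm_nonneg[of "phi_T z v1"] by linarith
  have sc: "L2_norm (phi_T z v) = norm v * L2_norm (phi_T z ((1 / norm v) *\<^sub>R v))" if "v \<noteq> 0" for v
  proof -
    have "phi_T z v x = fun_scale (of_real (norm v)) (phi_T z ((1 / norm v) *\<^sub>R v)) x" if "x \<in> {0<..<pi}" for x
      using phi_T_sum[of x z "\<lambda>_. of_real (norm v)" "\<lambda>_. (1 / norm v) *\<^sub>R v" "{()}"] that \<open>v \<noteq> 0\<close>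
      by (simp add: fun_scale_def flip: scaleR_eq_vec_scale)
    then have "L2_norm (phi_T z v) = L2_norm (fun_scale (of_real (norm v)) (phi_T z ((1 / norm v) *\<^sub>R v)))" by (rule L2_norm_cong)
    then show ?thesis by (simp add: L2_norm_scale)
  qed
  have T0: "L2_norm (phi_T z 0) = 0" using phi_vec_0 L2_norm_cong[of "phi_T z 0" 0] by (simp add: phi_T_def)
  have 1: "norm v * L2_norm (phi_T z v1) \<le> L2_norm (phi_T z v) \<and> L2_norm (phi_T z v) \<le> norm v * L2_norm (phi_T z v2)" for v
  proof (cases "v = 0")
    case False
    then have "(1 / norm v) *\<^sub>R v \<in> sphere 0 1" by simp
    then show ?thesis unfolding sc[OF False] using v1(2) v2 by (auto intro!: mult_left_mono)
  qed (simp add: T0)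
  have "(L2_norm (phi_T z v1))\<^sup>2 * (norm v)\<^sup>2 \<le> (L2_norm (phi_T z v))\<^sup>2 \<and> (L2_norm (phi_T z v))\<^sup>2 \<le> (L2_norm (phi_T z v2))\<^sup>2 * (norm v)\<^sup>2" for v
    using 1[of v] unfolding power_mult_distrib[symmetric] by (auto intro!: power_mono simp: mult.commute)
  then show ?thesis using that[of "(L2_norm (phi_T z v1))\<^sup>2" "(L2_norm (phi_T z v2))\<^sup>2"] pos by auto
qed

section \<open>The Riesz basis property\<close>

lemma phi_T_inner_zero:
  assumes "eig z (T_mat T1 z *v v)" "eig \<zeta> (T_mat T1 \<zeta> *v v')" "z \<noteq> \<zeta>"
  shows "L2_inner (phi_T z v) (phi_T \<zeta> v') = 0"
  using eig_inner_zero[OF L2_fun_zero, of z "T_mat T1 z *v v" 0 \<zeta> "T_mat T1 \<zeta> *v v'"] assms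
  by (simp add: U_no_force phi_T_def)

text \<open>Blocks with different eigenvalues are orthogonal, and inside one block the coefficient
  vectors are orthonormal, so two-sided bounds for \<open>phi_T\<close> that are uniform in the eigenvalue
  carry over to all finite sums.\<close>

lemma phi_T_family_bounds:
  fixes l :: "'i \<Rightarrow> real" and e :: "'i \<Rightarrow> complex^'m" and a :: "'i \<Rightarrow> complex"
  assumes S: "finite S"
    and eig: "\<And>i. i \<in> S \<Longrightarrow> eig (of_real (l i)) (T_mat T1 (of_real (l i)) *v e i)"
    and orth: "\<And>i j. i \<in> S \<Longrightarrow> j \<in> S \<Longrightarrow> l i = l j \<Longrightarrow> cinner (e i) (e j) = (if i = j then 1 else 0)"
    and lo: "\<And>i v. i \<in> S \<Longrightarrow> c * (norm v)\<^sup>2 \<le> (L2_norm (phi_T (of_real (l i)) v))\<^sup>2"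
    and up: "\<And>i v. i \<in> S \<Longrightarrow> (L2_norm (phi_T (of_real (l i)) v))\<^sup>2 \<le> C * (norm v)\<^sup>2"
  defines "s \<equiv> \<Sum>i\<in>S. fun_scale (a i) (phi_T (of_real (l i)) (e i))"
  shows "c * (\<Sum>i\<in>S. (cmod (a i))\<^sup>2) \<le> (L2_norm s)\<^sup>2" "(L2_norm s)\<^sup>2 \<le> C * (\<Sum>i\<in>S. (cmod (a i))\<^sup>2)"
proof -
  define B where "B r = {i \<in> S. l i = r}" for r
  define h where "h r = (\<Sum>i\<in>B r. fun_scale (a i) (phi_T (of_real (l i)) (e i)))" for r
  define v where "v r = (\<Sum>i\<in>B r. a i *s e i)" for r
  have hL: "L2_fun (h r)" for r unfolding h_def by (intro L2_fun_sum L2_fun_scale phi_T_L2)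
  have hv: "h r x = phi_T (of_real r) (v r) x" if "x \<in> {0<..<pi}" for r x
  proof -
    have "phi_T (of_real r) (v r) x = (\<Sum>i\<in>B r. a i *s phi_T (of_real r) (e i) x)"
      unfolding v_def by (rule phi_T_sum) (use that in auto)
    also have "\<dots> = h r x" unfolding h_def sum_fun_apply fun_scale_def
      by (intro sum.cong refl) (auto simp: B_def)
    finally show ?thesis by simp
  qed
  have nh: "L2_norm (h r) = L2_norm (phi_T (of_real r) (v r))" for r by (rule L2_norm_cong[OF hv])
  have ev: "eig (of_real r) (T_mat T1 (of_real r) *v v r)" for r
  proof -
    have "eig (of_real r) (\<Sum>i\<in>B r. a i *s (T_mat T1 (of_real r) *v e i))"
      by (rule eig_sum) (use eig in \<open>auto simp: B_def\<close>)
    then show ?thesis by (simp add: v_def vec.sum vec.scale)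
  qed
  have nv: "(norm (v r))\<^sup>2 = (\<Sum>i\<in>B r. (cmod (a i))\<^sup>2)" for r
    unfolding v_def by (rule norm_sum_orthonormal) (use S orth in \<open>auto simp: B_def\<close>)
  have s: "s = (\<Sum>r\<in>l ` S. h r)"
    unfolding s_def h_def B_def by (rule sum.image_gen[OF S])
  have a: "(\<Sum>i\<in>S. (cmod (a i))\<^sup>2) = (\<Sum>r\<in>l ` S. (norm (v r))\<^sup>2)"
    unfolding nv B_def by (rule sum.image_gen[OF S])
  have sn: "(L2_norm s)\<^sup>2 = (\<Sum>r\<in>l ` S. (L2_norm (phi_T (of_real r) (v r)))\<^sup>2)"
    unfolding s nh[symmetric]
  proof (rule L2_norm_sum_orthogonal)
    show "finite (l ` S)" using S by simp
    show "L2_fun (h r)" for r by (rule hL)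
    fix r t :: real assume "r \<noteq> t"
    then have "L2_inner (phi_T (of_real r) (v r)) (phi_T (of_real t) (v t)) = 0" by (intro phi_T_inner_zero ev) simp
    then show "L2_inner (h r) (h t) = 0" using L2_inner_cong[OF hv hv] by simp
  qed
  show "c * (\<Sum>i\<in>S. (cmod (a i))\<^sup>2) \<le> (L2_norm s)\<^sup>2"
    unfolding a sn sum_distrib_left by (intro sum_mono) (use lo in auto)
  show "(L2_norm s)\<^sup>2 \<le> C * (\<Sum>i\<in>S. (cmod (a i))\<^sup>2)"
    unfolding a sn sum_distrib_left by (intro sum_mono) (use up in auto)
qed

text \<open>Extended by 0 as the members of \<open>eigenspace\<close> are. The map is linear and
  injective in \<open>a\<close>, and carries the coefficient vectors of eigenfunctions onto the
  eigenspace.\<close>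

definition phi_ext :: "complex \<Rightarrow> complex^'m \<Rightarrow> real \<Rightarrow> complex^'m" where
  "phi_ext z a = (\<lambda>x. if x \<in> {0..pi} then fst (phi_vec z a x) else 0)"

lemma phi_ext_sum: "phi_ext z (\<Sum>i\<in>S. a i *s v i) = (\<Sum>i\<in>S. fun_scale (a i) (phi_ext z (v i)))"
  by (rule ext) (auto simp: phi_ext_def sum_fun_apply fun_scale_def phi_vec_sum)

lemma phi_ext_zero_imp: "phi_ext z a = 0 \<Longrightarrow> a = 0"
proof -
  assume e: "phi_ext z a = 0"
  have "fst (phi_vec z a x) = 0" if "x \<in> {0<..<pi}" for x
    using fun_cong[OF e, of x] that by (simp add: phi_ext_def)
  then have "L2_norm (\<lambda>x. fst (phi_vec z a x)) = L2_norm (0 :: real \<Rightarrow> complex^'m)" by (intro L2_norm_cong) simp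
  then show "a = 0" by (intro phi_vec_zero_imp) simp
qed

lemma eigenspace_eq: "eigenspace \<sigma> T1 T2 H1 H2 z = phi_ext z ` {a. eig z a}"
proof (intro equalityI subsetI)
  fix Y assume "Y \<in> eigenspace \<sigma> T1 T2 H1 H2 z"
  then obtain Y1 where Y: "\<And>x. x \<notin> {0..pi} \<Longrightarrow> Y x = 0" "solution (*v) \<sigma> z Y Y1"
    "boundary_form (*v) T1 H1 (Y 0) (Y1 0) = 0" "boundary_form (*v) T2 H2 (Y pi) (Y1 pi) = 0"
    unfolding eigenspace_def by blast
  define a where "a = T1 *v Y 0 + orth_compl T1 *v Y1 0"
  have eq: "(Y x, Y1 x) = phi_vec z a x" if "x \<in> {0..pi}" for x
    using solution_eq_U[OF Y(2) that] unfolding Y(3) a_def[symmetric] phi_vec_def .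
  have "eig z a" using eq[of pi] Y(4) by (simp add: V2_def flip: eq)
  moreover have "Y = phi_ext z a" unfolding phi_ext_def using Y(1) by (auto simp: fun_eq_iff simp flip: eq)
  ultimately show "Y \<in> phi_ext z ` {a. eig z a}" by blast
next
  fix Y assume "Y \<in> phi_ext z ` {a. eig z a}"
  then obtain a where a: "eig z a" "Y = phi_ext z a" by blast
  let ?u = "\<lambda>x. snd (phi_vec z a x)"
  have "sol z (force 0) (bc1.init a 0) (\<lambda>x. (Y x, ?u x))"
    unfolding linear_ode.is_sol_def[OF ode]
  proof (intro conjI ballI)
    have eq: "(Y x, ?u x) = phi_vec z a x" if "x \<in> {0..pi}" for x using that by (simp add: a(2) phi_ext_def)
    have P: "continuous_on {0..pi} (phi_vec z a)"
      "\<And>x. x \<in> {0..pi} \<Longrightarrow> phi_vec z a x = bc1.init a 0 + integral {0..x} (\<lambda>t. sys z t (phi_vec z a t) + force 0 t)"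
      using phi_vec[of z a] unfolding linear_ode.is_sol_def[OF ode] by blast+
    show "continuous_on {0..pi} (\<lambda>x. (Y x, ?u x))"
      using P(1) by (rule continuous_on_eq) (simp add: eq)
    fix x assume x: "x \<in> {0..pi}"
    have "integral {0..x} (\<lambda>t. sys z t (phi_vec z a t) + force 0 t) = integral {0..x} (\<lambda>t. sys z t (Y t, ?u t) + force 0 t)"
      by (rule integral_cong) (use x in \<open>simp add: eq\<close>)
    then show "(Y x, ?u x) = bc1.init a 0 + integral {0..x} (\<lambda>t. sys z t (Y t, ?u t) + force 0 t)"
      using P(2)[OF x] eq[OF x] by simp
  qed
  then have "sol z (force 0) (fst (bc1.init a 0), snd (bc1.init a 0)) (\<lambda>x. (Y x, ?u x))" by simp
  then have s: "solution (*v) \<sigma> z Y ?u" "Y 0 = fst (bc1.init a 0)" "?u 0 = snd (bc1.init a 0)"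
    unfolding sol_iff_solution by blast+
  have "boundary_form (*v) T1 H1 (Y 0) (?u 0) = 0" unfolding s(2,3) by (rule bc1.boundary_form_init)
  moreover have "boundary_form (*v) T2 H2 (Y pi) (?u pi) = 0" using a(1) by (simp add: V2_def a(2) phi_ext_def)
  moreover have "\<forall>x. x \<notin> {0..pi} \<longrightarrow> Y x = 0" by (simp add: a(2) phi_ext_def)
  ultimately show "Y \<in> eigenspace \<sigma> T1 T2 H1 H2 z" unfolding eigenspace_def using s(1) by blast
qed

text \<open>Dimension count: independent coefficient vectors give independent eigenfunctions, and
  there are as many of them as the multiplicity, so they exhaust the eigenspace.\<close>

lemma eigenfunctions_span:
  assumes G: "finite G" "card G = multiplicity_L \<sigma> T1 T2 H1 H2 z"
    and eig: "\<And>q. q \<in> G \<Longrightarrow> eig z (b q)"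
    and indep: "\<And>g. (\<Sum>q\<in>G. g q *s b q) = 0 \<Longrightarrow> (\<And>q. q \<in> G \<Longrightarrow> g q = 0)"
    and \<alpha>: "eig z \<alpha>"
  shows "phi_ext z \<alpha> \<in> fun_scale.span ((\<lambda>q. phi_ext z (b q)) ` G)"
proof -
  have indep': "g q = 0" if "(\<Sum>q\<in>G. fun_scale (g q) (phi_ext z (b q))) = 0" "q \<in> G" for g q
  proof -
    have "phi_ext z (\<Sum>q\<in>G. g q *s b q) = 0" unfolding phi_ext_sum by (rule that(1))
    then show ?thesis by (rule indep[OF phi_ext_zero_imp that(2)])
  qed
  have inj: "inj_on (\<lambda>q. phi_ext z (b q)) G"
  proof (rule inj_onI, rule ccontr)
    fix p q assume pq: "p \<in> G" "q \<in> G" "phi_ext z (b p) = phi_ext z (b q)" "p \<noteq> q"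
    let ?g = "\<lambda>r. if r = p then 1 else if r = q then - 1 else (0::complex)"
    have "(\<Sum>r\<in>G. fun_scale (?g r) (phi_ext z (b r))) = (\<Sum>r\<in>{p,q}. fun_scale (?g r) (phi_ext z (b r)))"
      using G(1) pq by (intro sum.mono_neutral_right) auto
    also have "\<dots> = 0" using pq by simp
    finally have "?g p = 0" using pq(1) by (rule indep')
    then show False by simp
  qed
  \<comment> \<open>The columns of \<open>\<phi>\<close> span every eigenspace, which certifies the
    finite dimension on which the count relies.\<close>
  let ?S0 = "(\<lambda>j. phi_ext z (axis j 1)) ` UNIV"
  have "eigenspace \<sigma> T1 T2 H1 H2 z \<subseteq> fun_scale.span ((\<lambda>q. phi_ext z (b q)) ` G)"
  proof (rule fun_scale.subset_span_of_card_eq_dim[of ?S0])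
    show "finite ?S0" by simp
    show "eigenspace \<sigma> T1 T2 H1 H2 z \<subseteq> fun_scale.span ?S0"
      unfolding eigenspace_eq
    proof (rule image_subsetI)
      fix a
      have "phi_ext z (\<Sum>j\<in>UNIV. a $ j *s axis j 1) \<in> fun_scale.span ?S0"
        unfolding phi_ext_sum by (intro fun_scale.span_sum fun_scale.span_scale fun_scale.span_base) auto
      then show "phi_ext z a \<in> fun_scale.span ?S0" by (simp flip: vec_sum_axis)
    qed
    show "(\<lambda>q. phi_ext z (b q)) ` G \<subseteq> eigenspace \<sigma> T1 T2 H1 H2 z"
      unfolding eigenspace_eq using eig by blast
    show "fun_scale.independent ((\<lambda>q. phi_ext z (b q)) ` G)"
    proof (rule fun_scale.independent_if_scalars_zero)
      fix f x assume "(\<Sum>x\<in>(\<lambda>q. phi_ext z (b q)) ` G. fun_scale (f x) x) = 0" and x: "x \<in> (\<lambda>q. phi_ext z (b q)) ` G"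
      then have "(\<Sum>q\<in>G. fun_scale (f (phi_ext z (b q))) (phi_ext z (b q))) = 0"
        by (subst (asm) sum.reindex[OF inj]) (simp add: comp_def)
      from indep'[OF this] x show "f x = 0" by blast
    qed (use G(1) in simp)
    show "card ((\<lambda>q. phi_ext z (b q)) ` G) = fun_scale.dim (eigenspace \<sigma> T1 T2 H1 H2 z)"
      unfolding card_image[OF inj] G(2) multiplicity_L_def ..
  qed
  then show ?thesis using \<alpha> unfolding eigenspace_eq by blast
qed

text \<open>An infinite set of eigenvalues in a compact interval would accumulate at some
  \<open>z\<close>, against the regular punctured ball around \<open>z\<close>.\<close>

lemma finite_eigenvalues_bounded:
  assumes "\<And>r. r \<in> \<Lambda> \<Longrightarrow> m \<le> r \<and> r \<le> R \<and> \<not> regular (of_real r)"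
  shows "finite \<Lambda>"
proof (rule ccontr)
  assume inf: "infinite \<Lambda>"
  have "infinite (complex_of_real ` \<Lambda>)" using inf by (simp add: finite_image_iff inj_on_def)
  moreover have "compact (complex_of_real ` {m..R})" by (intro compact_continuous_image continuous_intros) auto
  moreover have "complex_of_real ` \<Lambda> \<subseteq> complex_of_real ` {m..R}" using assms by auto
  ultimately obtain z where z: "z islimpt complex_of_real ` \<Lambda>"
    using Heine_Borel_imp_Bolzano_Weierstrass by blast
  obtain e where e: "e > 0" "\<And>w. w \<in> ball z e - {z} \<Longrightarrow> regular w" using regular_punctured_ball by blast
  obtain w where "w \<in> complex_of_real ` \<Lambda>" "w \<noteq> z" "dist w z < e"
    using z e(1) unfolding islimpt_approachable by blast
  then show False using e(2)[of w] assms by (auto simp: dist_commute)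
qed

theorem eigenfunctions_Riesz_basis:
  fixes lam :: "nat \<times> nat \<Rightarrow> real" and E :: "nat \<times> nat \<Rightarrow> complex^'m"
  assumes num: "eigenvalue_numbering \<sigma> T1 T2 H1 H2 lam" and basis: "basis_choice \<sigma> T1 T2 H1 H2 lam E"
  defines "F \<equiv> (\<lambda>p x. phi \<sigma> T1 H1 (of_real (lam p)) x *v (T_mat T1 (of_real (lam p)) *v E p))"
  shows "complete_in_L2 (index_set T1 T2) F \<and> Riesz_basis_L2 (index_set T1 T2) F"
proof -
  define J where "J = index_set T1 T2"
  define G where "G r = {q \<in> J. lam q = r}" for r
  have Geq: "{q \<in> J. complex_of_real (lam q) = of_real r} = G r" for r by (auto simp: G_def)
  have Gfin: "finite (G r)" and Gcard: "card (G r) = multiplicity_L \<sigma> T1 T2 H1 H2 (of_real r)" for r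
    using num unfolding eigenvalue_numbering_def Geq[symmetric] J_def by blast+
  have bas: "(\<forall>q\<in>G (lam p). \<forall>r\<in>G (lam p). cinner (E q) (E r) = (if q = r then 1 else 0)) \<and>
      vec.span (E ` G (lam p)) = range ((*v) (B_mat \<sigma> T1 T2 H1 H2 (of_real (lam p))))" if "p \<in> J" for p
    using basis that unfolding basis_choice_def Let_def G_def J_def by blast
  have orth: "cinner (E p) (E q) = (if p = q then 1 else 0)" if "p \<in> J" "q \<in> J" "lam p = lam q" for p q
  proof -
    have "p \<in> G (lam p)" "q \<in> G (lam p)" using that by (auto simp: G_def)
    then show ?thesis using bas[OF that(1)] by blast
  qed
  have eigE: "eig (of_real (lam p)) (T_mat T1 (of_real (lam p)) *v E p)" if p: "p \<in> J" for p
  proof -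
    let ?z = "complex_of_real (lam p)"
    let ?T = "T_mat T1 ?z" and ?W = "weight_matrix \<sigma> T1 T2 H1 H2 ?z"
    have "E p \<in> vec.span (E ` G (lam p))" using p by (intro vec.span_base) (simp add: G_def)
    then obtain w where w: "E p = B_mat \<sigma> T1 T2 H1 H2 ?z *v w" using bas[OF p] by auto
    have "E p = (pi/2) *\<^sub>R ((matrix_inv ?T ** ?W ** matrix_inv ?T) *v w)"
      unfolding w B_mat_def by (rule linear_cmul[OF bounded_linear.linear[OF matvec_bounded_linear_left]])
    \<comment> \<open>The left factor of \<open>B_mat\<close> is the inverse of \<open>?T\<close>,
      so applying \<open>?T\<close> leaves a vector in the range of the weight matrix.\<close>
    then have "?T *v E p = (pi/2) *\<^sub>R ((?T ** matrix_inv ?T) *v (?W *v (matrix_inv ?T *v w)))"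
      by (simp add: linear_cmul[OF bounded_linear.linear[OF matvec_bounded_linear]] matrix_vector_mul_assoc matrix_mul_assoc)
    also have "\<dots> = ?W *v ((pi/2) *\<^sub>R (matrix_inv ?T *v w))"
      by (simp add: T_mat_inverse linear_cmul[OF bounded_linear.linear[OF matvec_bounded_linear]])
    finally show ?thesis by (simp only: eig_weight_matrix)
  qed
  have T_inj: "v = 0" if "T_mat T1 z *v v = 0" for z v
  proof -
    have "(matrix_inv (T_mat T1 z) ** T_mat T1 z) *v v = 0" using that by (simp add: matrix_vector_mul_assoc[symmetric])
    then show ?thesis by (simp add: T_mat_inverse)
  qed
  have nonreg: "\<not> regular (of_real (lam p))" if p: "p \<in> J" for p
  proof
    assume "regular (of_real (lam p))"
    then have "E p = 0" using eigE[OF p] T_inj unfolding regular_def by blast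
    then show False using orth[OF p p] by simp
  qed
  have le: "lam (n,k) \<le> lam (n',k')" if "(n,k) \<in> J" "(n',k') \<in> J" "n < n' \<or> (n = n' \<and> k \<le> k')" for n k n' k'
    using num that unfolding eigenvalue_numbering_def J_def by blast
  have one: "1 \<le> CARD('m)" by (simp add: Suc_leI)
  have J11: "(Suc n, 1) \<in> J" for n using one by (simp add: J_def index_set_def)
  \<comment> \<open>The eigenvalues are bounded below: row 0 of the index set is finite, and all
    later rows dominate the entry at \<open>(1,1)\<close> by monotonicity.\<close>
  obtain ml where ml: "\<And>p. p \<in> J \<Longrightarrow> ml \<le> lam p"
  proof
    let ?A = "lam ` insert (1,1) ({0} \<times> {..CARD('m)})"
    fix p assume p: "p \<in> J"
    obtain n k where nk: "p = (n,k)" by (metis surj_pair)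
    show "Min ?A \<le> lam p"
    proof (cases "n = 0")
      case True
      then have "lam p \<in> ?A" using p nk by (auto simp: J_def index_set_def)
      then show ?thesis by (intro Min_le) auto
    next
      case False
      then have "lam (1,1) \<le> lam p" unfolding nk using p nk J11[of 0]
        by (intro le) (auto simp: J_def index_set_def)
      moreover have "Min ?A \<le> lam (1,1)" by (intro Min_le) auto
      ultimately show ?thesis by linarith
    qed
  qed
  obtain R c1 C1 where large: "c1 > 0" "\<And>r v. r \<ge> R \<Longrightarrow> c1 * (norm v)\<^sup>2 \<le> (L2_norm (phi_T (of_real r) v))\<^sup>2"
    "\<And>r v. r \<ge> R \<Longrightarrow> (L2_norm (phi_T (of_real r) v))\<^sup>2 \<le> C1 * (norm v)\<^sup>2"
    by (rule phi_T_bounds_large) (rule that)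
  define \<Lambda> where "\<Lambda> = {lam p | p. p \<in> J \<and> lam p < R}"
  have fin\<Lambda>: "finite \<Lambda>"
    by (rule finite_eigenvalues_bounded[of _ ml R]) (use ml nonreg in \<open>auto simp: \<Lambda>_def less_imp_le\<close>)
  have "\<forall>r::real. \<exists>d. fst d > 0 \<and> (\<forall>v. fst d * (norm v)\<^sup>2 \<le> (L2_norm (phi_T (of_real r) v))\<^sup>2 \<and>
      (L2_norm (phi_T (of_real r) v))\<^sup>2 \<le> snd d * (norm v)\<^sup>2)"
  proof
    fix r :: real
    obtain c C where "c > 0" "\<And>v. c * (norm v)\<^sup>2 \<le> (L2_norm (phi_T (of_real r) v))\<^sup>2"
      "\<And>v. (L2_norm (phi_T (of_real r) v))\<^sup>2 \<le> C * (norm v)\<^sup>2" by (rule phi_T_bounds_fixed[of "of_real r"]) (rule that)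
    then show "\<exists>d. fst d > 0 \<and> (\<forall>v. fst d * (norm v)\<^sup>2 \<le> (L2_norm (phi_T (of_real r) v))\<^sup>2 \<and>
      (L2_norm (phi_T (of_real r) v))\<^sup>2 \<le> snd d * (norm v)\<^sup>2)" by (intro exI[of _ "(c,C)"]) simp
  qed
  from choice[OF this] obtain d :: "real \<Rightarrow> real \<times> real" where
    d0: "\<forall>r. fst (d r) > 0 \<and> (\<forall>v. fst (d r) * (norm v)\<^sup>2 \<le> (L2_norm (phi_T (of_real r) v))\<^sup>2 \<and>
      (L2_norm (phi_T (of_real r) v))\<^sup>2 \<le> snd (d r) * (norm v)\<^sup>2)" ..
  then have d: "fst (d r) > 0" "fst (d r) * (norm v)\<^sup>2 \<le> (L2_norm (phi_T (of_real r) v))\<^sup>2"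
      "(L2_norm (phi_T (of_real r) v))\<^sup>2 \<le> snd (d r) * (norm v)\<^sup>2" for r v by simp_all
  \<comment> \<open>Above \<open>R\<close> the energy estimate provides one pair of constants; the
    finitely many eigenvalues below \<open>R\<close> contribute their own, and the worst ones are
    taken.\<close>
  define c where "c = Min (insert c1 ((fst \<circ> d) ` \<Lambda>))"
  define C where "C = Max (insert C1 ((snd \<circ> d) ` \<Lambda>))"
  have cpos: "c > 0" unfolding c_def using fin\<Lambda> large(1) d(1) by (subst Min_gr_iff) auto
  have lo: "c * (norm v)\<^sup>2 \<le> (L2_norm (phi_T (of_real (lam p)) v))\<^sup>2" if p: "p \<in> J" for p v
  proof (cases "lam p < R")
    case True
    then have "lam p \<in> \<Lambda>" using p unfolding \<Lambda>_def by blast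
    then have "c \<le> fst (d (lam p))" unfolding c_def using fin\<Lambda> by (intro Min_le) auto
    then have "c * (norm v)\<^sup>2 \<le> fst (d (lam p)) * (norm v)\<^sup>2" by (rule mult_right_mono) simp
    then show ?thesis using d(2) by (rule order_trans)
  next
    case False
    have "c \<le> c1" unfolding c_def using fin\<Lambda> by (intro Min_le) auto
    then have "c * (norm v)\<^sup>2 \<le> c1 * (norm v)\<^sup>2" by (rule mult_right_mono) simp
    then show ?thesis using False by (intro order_trans[OF _ large(2)]) auto
  qed
  have up: "(L2_norm (phi_T (of_real (lam p)) v))\<^sup>2 \<le> C * (norm v)\<^sup>2" if p: "p \<in> J" for p v
  proof (cases "lam p < R")
    case True
    then have "lam p \<in> \<Lambda>" using p unfolding \<Lambda>_def by blast
    then have "snd (d (lam p)) \<le> C" unfolding C_def using fin\<Lambda> by (intro Max_ge) auto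
    then have "snd (d (lam p)) * (norm v)\<^sup>2 \<le> C * (norm v)\<^sup>2" by (rule mult_right_mono) simp
    with d(3) show ?thesis by (rule order_trans)
  next
    case False
    have "C1 \<le> C" unfolding C_def using fin\<Lambda> by (intro Max_ge) auto
    then have "C1 * (norm v)\<^sup>2 \<le> C * (norm v)\<^sup>2" by (rule mult_right_mono) simp
    then show ?thesis using False by (intro order_trans[OF large(3)]) auto
  qed
  have FT: "F p x = phi_T (of_real (lam p)) (E p) x" if "x \<in> {0<..<pi}" for p x
    unfolding F_def phi_T_def by (rule phi_eq) (use that in auto)
  have FL: "L2_fun (F p)" for p
  proof -
    have "L2_fun (F p) = L2_fun (phi_T (of_real (lam p)) (E p))" by (rule L2_fun_cong) (rule FT)
    then show ?thesis using phi_T_L2 by simp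
  qed
  \<comment> \<open>Weak completeness concerns all eigenfunctions. Each eigenspace is spanned by the
    members of \<open>F\<close> from its group, so orthogonality to \<open>F\<close> carries
    over.\<close>
  have total: "L2_norm f = 0" if f: "L2_fun f" and fF: "\<And>p. p \<in> J \<Longrightarrow> L2_inner f (F p) = 0" for f
  proof (rule weak_completeness[OF f])
    fix z \<alpha> assume \<alpha>: "eig z \<alpha>"
    show "L2_inner f (\<lambda>x. fst (phi_vec z \<alpha> x)) = 0"
    proof (cases "\<alpha> = 0")
      case True
      then show ?thesis by (rule phi_vec_L2_zero)
    next
      case False
      then have "cnj z = z" using eig_real[OF \<alpha>] by blast
      then obtain r where r: "z = of_real r" by (metis Reals_cases Reals_cnj_iff)
      let ?b = "\<lambda>q. T_mat T1 z *v E q"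
      have span: "phi_ext z \<alpha> \<in> fun_scale.span ((\<lambda>q. phi_ext z (?b q)) ` G r)"
      proof (rule eigenfunctions_span[OF Gfin _ _ _ \<alpha>])
        show "card (G r) = multiplicity_L \<sigma> T1 T2 H1 H2 z" unfolding r by (rule Gcard)
        show "eig z (?b q)" if "q \<in> G r" for q using eigE[of q] that by (simp add: G_def r)
        fix g q assume "(\<Sum>q\<in>G r. g q *s ?b q) = 0" and q: "q \<in> G r"
        then have "T_mat T1 z *v (\<Sum>q\<in>G r. g q *s E q) = 0" by (simp add: vec.sum vec.scale)
        then have "(\<Sum>q\<in>G r. g q *s E q) = 0" by (rule T_inj)
        moreover have "(norm (\<Sum>q\<in>G r. g q *s E q))\<^sup>2 = (\<Sum>q\<in>G r. (cmod (g q))\<^sup>2)"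
          by (rule norm_sum_orthonormal[OF Gfin]) (use orth in \<open>auto simp: G_def\<close>)
        ultimately have "(\<Sum>q\<in>G r. (cmod (g q))\<^sup>2) = 0" by simp
        then show "g q = 0" using q Gfin by (simp add: sum_nonneg_eq_0_iff)
      qed
      have "L2_fun (phi_ext z \<alpha>) \<and> L2_inner f (phi_ext z \<alpha>) = 0"
        using span
      proof (induction rule: fun_scale.span_induct_alt)
        case base
        show ?case using L2_fun_zero L2_inner_zero(2)[of f] by (simp add: zero_fun_def)
      next
        case (step s h t)
        then obtain q where q: "q \<in> G r" "h = phi_ext z (?b q)" by blast
        have h: "h x = F q x" if "x \<in> {0<..<pi}" for x
          using that q(1) unfolding FT[OF that] by (simp add: q(2) phi_ext_def phi_T_def G_def r)
        have "L2_fun h = L2_fun (F q)" by (rule L2_fun_cong) (rule h)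
        then have hL: "L2_fun h" using FL by simp
        have "L2_inner f h = L2_inner f (F q)" by (rule L2_inner_cong) (simp_all add: h)
        then have "L2_inner f h = 0" using fF q(1) by (simp add: G_def)
        then have "L2_inner h f = 0" "L2_inner t f = 0"
          using step.IH by (simp_all add: L2_inner_commute[of _ f])
        then have "L2_inner (fun_scale s h + t) f = 0"
          using step.IH L2_inner_add_left[OF L2_fun_scale[OF hL, of s] _ f, of t]
          by (simp add: L2_inner_scale_left)
        then have "L2_inner f (fun_scale s h + t) = 0"
          by (subst L2_inner_commute) simp
        then show ?case using step.IH L2_fun_add[OF L2_fun_scale[OF hL, of s], of t] by (simp add: plus_fun_def)
      qed
      moreover have "L2_inner f (phi_ext z \<alpha>) = L2_inner f (\<lambda>x. fst (phi_vec z \<alpha> x))"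
        by (rule L2_inner_cong) (auto simp: phi_ext_def)
      ultimately show ?thesis by simp
    qed
  qed
  \<comment> \<open>The countable index set is infinite, so it can be enumerated by all of
    \<open>nat\<close>, as \<open>riesz_system\<close> requires.\<close>
  have "infinite J"
  proof
    assume "finite J"
    then have "finite (range (\<lambda>n. (Suc n, 1::nat)))" using J11 by (elim finite_subset[rotated]) auto
    then show False by (simp add: finite_image_iff inj_on_def)
  qed
  then have b: "bij_betw (from_nat_into J) UNIV J" by (intro bij_betw_from_nat_into) auto
  define b where "b = from_nat_into J"
  have bJ: "b n \<in> J" for n using b unfolding b_def bij_betw_def by blast
  have binj: "b m = b n \<longleftrightarrow> m = n" for m n using b unfolding b_def bij_betw_def inj_on_def by blast
  have norm_eq: "L2_norm (\<Sum>k<n. fun_scale (a k) (F (b k))) = L2_norm (\<Sum>k<n. fun_scale (a k) (phi_T (of_real (lam (b k))) (E (b k))))"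
    for a and n :: nat
    by (rule L2_norm_cong) (simp add: sum_fun_apply fun_scale_def FT)
  have "riesz_system (\<lambda>n. F (b n)) c C"
  proof
    show "0 < c" by (rule cpos)
    show "L2_fun (F (b n))" for n by (rule FL)
    have "c * (\<Sum>k<n. (cmod (a k))\<^sup>2) \<le> (L2_norm (\<Sum>k<n. fun_scale (a k) (F (b k))))\<^sup>2 \<and>
        (L2_norm (\<Sum>k<n. fun_scale (a k) (F (b k))))\<^sup>2 \<le> C * (\<Sum>k<n. (cmod (a k))\<^sup>2)" for a and n :: nat
      unfolding norm_eq
      using phi_T_family_bounds[of "{..<n}" "\<lambda>k. lam (b k)" "\<lambda>k. E (b k)" c C a] eigE[OF bJ] orth[OF bJ bJ] lo[OF bJ] up[OF bJ]
      by (simp add: binj)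
    then show "c * (\<Sum>k<n. (cmod (a k))\<^sup>2) \<le> (L2_norm (\<Sum>k<n. fun_scale (a k) (F (b k))))\<^sup>2"
      "(L2_norm (\<Sum>k<n. fun_scale (a k) (F (b k))))\<^sup>2 \<le> C * (\<Sum>k<n. (cmod (a k))\<^sup>2)" for a and n :: nat
      by blast+
    fix f :: "real \<Rightarrow> complex^'m" assume f: "L2_fun f" and o: "\<And>n. L2_inner f (F (b n)) = 0"
    show "L2_norm f = 0"
    proof (rule total[OF f])
      fix p assume "p \<in> J"
      then obtain n where "p = b n" using b unfolding b_def bij_betw_def by blast
      then show "L2_inner f (F p) = 0" using o by simp
    qed
  qed
  then have "complete_in_L2 UNIV (\<lambda>n. F (b n)) \<and> Riesz_basis_L2 UNIV (\<lambda>n. F (b n))"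
    by (rule riesz_system.complete_and_Riesz)
  then show ?thesis using Riesz_basis_L2_reindex[OF b, of F] by (simp add: J_def b_def)
qed

end

theorem mainTheorem5:
  fixes \<sigma> :: "real \<Rightarrow> complex^'m^'m"
    and T1 T2 H1 H2 :: "complex^'m^'m"
    and lam :: "nat \<times> nat \<Rightarrow> real"
    and E :: "nat \<times> nat \<Rightarrow> complex^'m"
  assumes "L2_fun \<sigma>" and "AE x in leb_pi. \<sigma> x = dagger (\<sigma> x)"
    and "T1 = dagger T1" and "T1 ** T1 = T1"
    and "T2 = dagger T2" and "T2 ** T2 = T2"
    and "H1 = dagger H1" and "H1 = T1 ** H1 ** T1"
    and "H2 = dagger H2" and "H2 = T2 ** H2 ** T2"
    and "eigenvalue_numbering \<sigma> T1 T2 H1 H2 lam"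
    and "basis_choice \<sigma> T1 T2 H1 H2 lam E"
  defines "F \<equiv> (\<lambda>p x. phi \<sigma> T1 H1 (of_real (lam p)) x *v (T_mat T1 (of_real (lam p)) *v E p))"
  shows "complete_in_L2 (index_set T1 T2) F \<and> Riesz_basis_L2 (index_set T1 T2) F"
proof -
  interpret sturm_liouville T1 H1 T2 H2 \<sigma>
    by unfold_locales (fact assms)+
  show ?thesis unfolding F_def by (rule eigenfunctions_Riesz_basis[OF assms(11,12)])
qed

end
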